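(* Let $\tau$ be an allowable inert place of $F$ (with $n=3$). Let $\mathcal L_\tau$ be the set of pairs $(L_{V,\tau},L_{W,\tau})$, where $L_{V,\tau}\subset V_\tau$ and $L_{W,\tau}\subset W_\tau$ are self-dual $\mathcal O_{E_\tau}$-lattices; $G_\tau=G_{V,\tau}\times G_{W,\tau}$ acts transitively on $\mathcal L_\tau$ with stabilizer $K_\tau$, so $\mathcal L_\tau\cong G_\tau/K_\tau$. (i) The map $$\mathrm{inv}_\tau:(L_{V,\tau},L_{W,\tau})\mapsto\big(\mathrm{dist}(L_{V,\tau},\mathrm{pr}_{W_\tau}(L_{V,\tau})),\ \mathrm{dist}(\mathrm{pr}_{W_\tau}(L_{V,\tau}),L_{W,\tau})\big)$$ induces a bijection between the set of $H_\tau$-orbits on $G_\tau/K_\tau$ and the set $\mathbf{Inv}_\tau=\{(a,b): a,b\ge 0\}$ of pairs of nonnegative integers. (ii) If an $H_\tau$-orbit $[(L_{V,\tau},L_{W,\tau})]$ has $\mathrm{inv}_\tau=(a,b)$, then its local conductor is $\mathbf c_\tau([L_{V,\tau},L_{W,\tau}])=\varpi^{\min\{a,2b\}}$; that is, $\det\big(\mathrm{Stab}_{H_\tau}(L_{V,\tau},L_{W,\tau})\big)=r(\mathcal O_c^\times)$ with $c=\min\{a,2b\}$.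
   Context: Global setting: $F$ is a totally real number field, $E/F$ a totally imaginary quadratic extension with conjugation $x\mapsto\bar x$. $V$ is a non-degenerate Hermitian space over $E$ of dimension $n=3$, $W\subset V$ a non-degenerate subspace of dimension $2$, $D=W^\perp$, and $D$ contains $e_D$ with $\langle e_D,e_D\rangle=1$, so $V=W\perp Ee_D$. Let $\mathbf G=\mathrm{Res}_{F/\mathbf Q}(\mathbf U(V)\times\mathbf U(W))$ and $\mathbf H=\mathrm{Res}_{F/\mathbf Q}\mathbf U(W)$ embedded diagonally (an isometry of $W$ is extended to $V$ by the identity on $D$ in the first factor, and is the identity map in the second factor). $K=K_V\times K_W\subset\mathbf G(\mathbf A_f)$ is a compact open subgroup. For a finite place $\tau$ of $F$ put $G_{V,\tau}=\mathbf U(V)(F_\tau)$, $G_{W,\tau}=\mathbf U(W)(F_\tau)$, $G_\tau=G_{V,\tau}\times G_{W,\tau}$, and let $H_\tau$ be the diagonal image of $G_{W,\tau}$ in $G_\tau$. A finite place $\tau$ of $F$ of odd residue characteristic is an allowable inert place if it is inert in $E$, $G_\tau$ and $H_\tau$ are quasi-split, and $K_\tau=K_{V,\tau}\times K_{W,\tau}$ with $K_{V,\tau}\subset G_{V,\tau}$ and $K_{W,\tau}=G_{W,\tau}\cap K_{V,\tau}$ both hyperspecial maximal compact subgroups. Local notation: $V_\tau=V\otimes_E E_\tau$, $W_\tau=W\otimes_EE_\tau$; $\varpi$ is a uniformizer of $F_\tau$ (also of $E_\tau$). A lattice $L$ is self-dual if $L^\vee=L$, where $L^\vee=\{v:\langle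 v,L\rangle\subset\mathcal O_{E_\tau}\}$, and almost self-dual if $\varpi L^\vee\subsetneq L\subsetneq L^\vee$. The Bruhat–Tits building $\mathcal B(V_\tau)$ of $G_{V,\tau}$ is a tree whose hyperspecial vertices correspond to the self-dual lattices of $V_\tau$ and whose other vertices correspond to the almost self-dual lattices, with the metric normalized so that adjacent vertices are at distance $1/2$. Concretely, for a Witt basis $(e_+,e_0,e_-)$ of $V_\tau$ with $\langle e_+,e_-\rangle=1$, $\langle e_0,e_0\rangle=1$ and all other pairings zero, the lattices $\langle\varpi^a e_+,e_0,\varpi^be_-\rangle$ lie on one apartment and are at distance $\tfrac12(|a-a'|+|b-b'|)$ from one another. The building $\mathcal B(W_\tau)$ is identified with a subtree of $\mathcal B(V_\tau)$ via $L\mapsto L\oplus\mathcal O_{E_\tau}e_D$. A self-dual lattice $L_{W,\tau}$ of $W_\tau$ is viewed as the point $L_{W,\tau}\oplus\mathcal O_{E_\tau}e_D$, and $\mathrm{dist}$ denotes the distance in $\mathcal B(V_\tau)$. The map $\mathrm{pr}_{W_\tau}$ is the convex (nearest-point) projection of $\mathcal B(V_\tau)$ onto $\mathcal B(W_\tau)$; it sends hyperspecial vertices to hyperspecial vertices. Local conductor: for $c\ge0$ let $\mathcal O_c=\mathcal O_{F_\tau}+\varpi^c\mathcal O_{E_\tau}$. Let $r:E_\tau^\times\to\mathbf U(1)(F_\tau)$ be $r(s)=\bar s/s$. The map $\det:H_\tau\to\mathbf U(1)(F_\tau)$ is the determinant. The local conductor of an $H_\tau$-orbit of pairs is $\varpi^c$,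 where $c$ is such that $\det(\mathrm{Stab}_{H_\tau}(L_{V,\tau},L_{W,\tau}))=r(\mathcal O_c^\times)$. *)

theory Defs
  imports "HOL-Analysis.Analysis" "HOL-Algebra.Group_Action" "HOL-Algebra.Left_Coset"
begin

section \<open>Global data\<close>

text \<open>
  Vector spaces are written in coordinates: \<open>V = E\<^sup>3\<close> with an arbitrary Hermitian form, and
  \<open>V \<otimes>\<^sub>E E\<^sub>\<tau> = E\<^sub>\<tau>\<^sup>3\<close>. The field \<open>F\<close> is a subset of the type of \<open>E\<close>. A finite place \<open>\<tau>\<close> of \<open>F\<close>
  is given by the absolute value \<open>x \<mapsto> |\<iota> x|\<close> on \<open>F\<close>, where \<open>\<iota>\<close> embeds \<open>E\<close> into the completion \<open>E\<^sub>\<tau>\<close>;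
  the completion \<open>F\<^sub>\<tau>\<close> is the closure of \<open>\<iota> F\<close> in \<open>E\<^sub>\<tau>\<close>.
\<close>

record ('e, 'k) datum =
  base :: "'e set"                                  \<comment> \<open>\<open>F\<close>\<close>
  conj :: "'e \<Rightarrow> 'e"                                 \<comment> \<open>\<open>x \<mapsto> \<bar>x\<close> on \<open>E\<close>\<close>
  herm :: "'e ^ 3 \<Rightarrow> 'e ^ 3 \<Rightarrow> 'e"                   \<comment> \<open>the form on \<open>V\<close>\<close>
  subW :: "('e ^ 3) set"                            \<comment> \<open>\<open>W\<close>\<close>
  eD :: "'e ^ 3"                                    \<comment> \<open>\<open>e\<^sub>D\<close>\<close>
  emb :: "'e \<Rightarrow> 'k"                                  \<comment> \<open>\<open>\<iota>: E \<rightarrow> E\<^sub>\<tau>\<close>\<close>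
  absv :: "'k \<Rightarrow> real"                               \<comment> \<open>absolute value of \<open>E\<^sub>\<tau>\<close>\<close>
  conjt :: "'k \<Rightarrow> 'k"                                \<comment> \<open>conjugation on \<open>E\<^sub>\<tau>\<close>\<close>
  unif :: 'k                                        \<comment> \<open>\<open>\<varpi>\<close>\<close>

definition subfield_of :: "'a::field set \<Rightarrow> bool" where
  "subfield_of F \<longleftrightarrow> 0 \<in> F \<and> 1 \<in> F \<and>
     (\<forall>x\<in>F. \<forall>y\<in>F. x - y \<in> F \<and> x * y \<in> F) \<and> (\<forall>x\<in>F. inverse x \<in> F)"

definition field_hom_on :: "'a::field set \<Rightarrow> ('a \<Rightarrow> 'b::field) \<Rightarrow> bool" where
  "field_hom_on F \<phi> \<longleftrightarrow> \<phi> 1 = 1 \<and>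
     (\<forall>x\<in>F. \<forall>y\<in>F. \<phi> (x + y) = \<phi> x + \<phi> y \<and> \<phi> (x * y) = \<phi> x * \<phi> y)"

definition number_field :: "'e::field_char_0 set \<Rightarrow> bool" where
  "number_field F \<longleftrightarrow> subfield_of F \<and>
     (\<exists>B. finite B \<and> F = {\<Sum>b\<in>B. of_rat (q b) * b | q :: 'e \<Rightarrow> rat. True})"

definition totally_real :: "'e::field set \<Rightarrow> bool" where
  "totally_real F \<longleftrightarrow> (\<forall>\<phi> :: 'e \<Rightarrow> complex. field_hom_on F \<phi> \<longrightarrow> \<phi> ` F \<subseteq> \<real>)"

definition totally_imaginary :: "'e::field set \<Rightarrow> bool" where
  "totally_imaginary F \<longleftrightarrow> (\<forall>\<phi> :: 'e \<Rightarrow> complex. field_hom_on F \<phi> \<longrightarrow> \<not> \<phi> ` F \<subseteq> \<real>)"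

definition cm_extension :: "('e::field_char_0, 'k) datum \<Rightarrow> bool" where
  "cm_extension S \<longleftrightarrow>
     number_field (base S) \<and> totally_real (base S) \<and> totally_imaginary (UNIV :: 'e set) \<and>
     (\<exists>\<delta>. \<delta> \<notin> base S \<and> (\<forall>x. \<exists>a\<in>base S. \<exists>b\<in>base S. x = a + b * \<delta>)) \<and>
     field_hom_on UNIV (conj S) \<and> (\<forall>x\<in>base S. conj S x = x) \<and> conj S \<noteq> id"

definition hermitian_form :: "('e::field \<Rightarrow> 'e) \<Rightarrow> ('e ^ 3 \<Rightarrow> 'e ^ 3 \<Rightarrow> 'e) \<Rightarrow> bool" where
  "hermitian_form \<sigma> h \<longleftrightarrow>
     (\<forall>x y z. h (x + y) z = h x z + h y z) \<and> (\<forall>c x y. h (c *s x) y = c * h x y) \<and>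
     (\<forall>x y. h y x = \<sigma> (h x y))"

definition nondegenerate_on :: "('e::field ^ 3) set \<Rightarrow> ('e ^ 3 \<Rightarrow> 'e ^ 3 \<Rightarrow> 'e) \<Rightarrow> bool" where
  "nondegenerate_on X h \<longleftrightarrow> (\<forall>x\<in>X. (\<forall>y\<in>X. h x y = 0) \<longrightarrow> x = 0)"

definition subD :: "('e::field, 'k) datum \<Rightarrow> ('e ^ 3) set" where
  "subD S = {d. \<forall>w\<in>subW S. herm S d w = 0}"

definition global_setting :: "('e::field_char_0, 'k) datum \<Rightarrow> bool" where
  "global_setting S \<longleftrightarrow> cm_extension S \<and>
     hermitian_form (conj S) (herm S) \<and> nondegenerate_on UNIV (herm S) \<and>
     vec.subspace (subW S) \<and> vec.dim (subW S) = 2 \<and> nondegenerate_on (subW S) (herm S) \<and>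
     eD S \<in> subD S \<and> herm S (eD S) (eD S) = 1"


section \<open>The place and the local objects\<close>

definition nonarch_absolute_value :: "('k::field \<Rightarrow> real) \<Rightarrow> bool" where
  "nonarch_absolute_value v \<longleftrightarrow> (\<forall>x. 0 \<le> v x) \<and> (\<forall>x. v x = 0 \<longleftrightarrow> x = 0) \<and>
     (\<forall>x y. v (x * y) = v x * v y) \<and> (\<forall>x y. v (x + y) \<le> max (v x) (v y))"

definition F_tau :: "('e, 'k::topological_space) datum \<Rightarrow> 'k set" where
  "F_tau S = closure (emb S ` base S)"

definition completion_at_finite_place ::
    "('e::field, 'k::{field, complete_space}) datum \<Rightarrow> bool" where
  "completion_at_finite_place S \<longleftrightarrow>
     nonarch_absolute_value (absv S) \<and> (\<forall>x y. dist x y = absv S (x - y)) \<and>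
     field_hom_on UNIV (emb S) \<and> closure (range (emb S)) = UNIV \<and>
     (\<exists>x\<in>base S. x \<noteq> 0 \<and> absv S (emb S x) < 1)"

text \<open>
  If \<open>\<tau>\<close> splits, the completion of \<open>E\<close> at a place above \<open>\<tau>\<close> is \<open>F\<^sub>\<tau>\<close>; otherwise there is only one place
  above \<open>\<tau>\<close> and \<open>E\<^sub>\<tau> = E \<otimes>\<^sub>F F\<^sub>\<tau>\<close> is a quadratic extension of \<open>F\<^sub>\<tau>\<close>. So \<open>\<tau>\<close> is inert iff it is non-split and the
  value groups agree, i.e. \<open>e = 1\<close>.
\<close>
definition inert :: "('e, 'k::topological_space) datum \<Rightarrow> bool" where
  "inert S \<longleftrightarrow> F_tau S \<noteq> UNIV \<and> absv S ` F_tau S = range (absv S)"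

definition uniformizer :: "('e, 'k::{field, topological_space}) datum \<Rightarrow> 'k \<Rightarrow> bool" where
  "uniformizer S p \<longleftrightarrow> p \<in> F_tau S \<and> p \<noteq> 0 \<and> absv S p < 1 \<and>
     (\<forall>x\<in>F_tau S. absv S x < 1 \<longrightarrow> absv S x \<le> absv S p)"

definition place_setting :: "('e::field, 'k::{field, complete_space}) datum \<Rightarrow> bool" where
  "place_setting S \<longleftrightarrow> completion_at_finite_place S \<and> inert S \<and>
     absv S 2 = 1 \<comment> \<open>odd residue characteristic: \<open>2\<close> is a unit\<close> \<and>
     continuous_on UNIV (conjt S) \<and> (\<forall>x. conjt S (emb S x) = emb S (conj S x)) \<and>
     uniformizer S (unif S)"

definition vec_emb :: "('e, 'k) datum \<Rightarrow> 'e ^ 3 \<Rightarrow> 'k ^ 3" where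
  "vec_emb S x = (\<chi> i. emb S (x $ i))"

definition herm_tau :: "('e::field, 'k::field) datum \<Rightarrow> 'k ^ 3 \<Rightarrow> 'k ^ 3 \<Rightarrow> 'k" where
  "herm_tau S x y =
     (\<Sum>i\<in>UNIV. \<Sum>j\<in>UNIV. x $ i * conjt S (y $ j) * emb S (herm S (axis i 1) (axis j 1)))"

definition W_tau :: "('e, 'k::field) datum \<Rightarrow> ('k ^ 3) set" where
  "W_tau S = vec.span (vec_emb S ` subW S)"

definition eD_tau :: "('e, 'k) datum \<Rightarrow> 'k ^ 3" where
  "eD_tau S = vec_emb S (eD S)"


section \<open>Unitary groups\<close>

text \<open>The local points of \<open>U(X)\<close>, for a subspace \<open>X\<close> of \<open>V\<^sub>\<tau>\<close>, under composition.\<close>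
definition unitary :: "('e::field, 'k::field) datum \<Rightarrow> ('k ^ 3) set \<Rightarrow> ('k ^ 3 \<Rightarrow> 'k ^ 3) monoid" where
  "unitary S X = (BijGroup X)\<lparr>carrier := {g \<in> Bij X.
     (\<forall>x\<in>X. \<forall>y\<in>X. g (x + y) = g x + g y) \<and> (\<forall>c. \<forall>x\<in>X. g (c *s x) = c *s g x) \<and>
     (\<forall>x\<in>X. \<forall>y\<in>X. herm_tau S (g x) (g y) = herm_tau S x y)}\<rparr>"

abbreviation G_V where "G_V S \<equiv> unitary S UNIV"
abbreviation G_W where "G_W S \<equiv> unitary S (W_tau S)"
abbreviation G_tau where "G_tau S \<equiv> G_V S \<times>\<times> G_W S"

text \<open>Extension of an isometry of \<open>W\<^sub>\<tau>\<close> by the identity on \<open>D\<^sub>\<tau>\<close>; the \<open>D\<^sub>\<tau>\<close>-component of \<open>v\<close> is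
  \<open>\<langle>v, e\<^sub>D\<rangle> e\<^sub>D\<close> since \<open>\<langle>e\<^sub>D, e\<^sub>D\<rangle> = 1\<close>.\<close>
definition extend :: "('e::field, 'k::field) datum \<Rightarrow> ('k ^ 3 \<Rightarrow> 'k ^ 3) \<Rightarrow> 'k ^ 3 \<Rightarrow> 'k ^ 3" where
  "extend S g v = (let d = herm_tau S v (eD_tau S) *s eD_tau S in g (v - d) + d)"

definition H_tau :: "('e::field, 'k::field) datum \<Rightarrow> _ monoid" where
  "H_tau S = (G_tau S)\<lparr>carrier := (\<lambda>g. (extend S g, g)) ` carrier (G_W S)\<rparr>"

text \<open>The determinant of \<open>g\<close> on \<open>W\<^sub>\<tau>\<close> is that of its extension by the identity on the line \<open>D\<^sub>\<tau>\<close>.\<close>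
definition det_H :: "('k::field ^ 3 \<Rightarrow> 'k ^ 3) \<times> ('k ^ 3 \<Rightarrow> 'k ^ 3) \<Rightarrow> 'k" where
  "det_H h = det (matrix (fst h))"

text \<open>A unitary group \<open>U(X)\<close> is quasi-split iff \<open>X\<close> has the maximal possible Witt index.\<close>
definition quasi_split :: "('e::field, 'k::field) datum \<Rightarrow> ('k ^ 3) set \<Rightarrow> bool" where
  "quasi_split S X \<longleftrightarrow> (\<exists>I. vec.subspace I \<and> I \<subseteq> X \<and> (\<forall>x\<in>I. \<forall>y\<in>I. herm_tau S x y = 0) \<and>
     vec.dim I = vec.dim X div 2)"


section \<open>Lattices\<close>

definition lattice_in :: "('e, 'k::field) datum \<Rightarrow> ('k ^ 3) set \<Rightarrow> ('k ^ 3) set \<Rightarrow> bool" where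
  "lattice_in S X L \<longleftrightarrow> (\<exists>B. finite B \<and> vec.span B = X \<and>
     L = {\<Sum>b\<in>B. c b *s b | c. \<forall>b. absv S (c b) \<le> 1})"

definition dual_in :: "('e::field, 'k::field) datum \<Rightarrow> ('k ^ 3) set \<Rightarrow> ('k ^ 3) set \<Rightarrow> ('k ^ 3) set" where
  "dual_in S X L = {x\<in>X. \<forall>y\<in>L. absv S (herm_tau S x y) \<le> 1}"

definition self_dual :: "('e::field, 'k::field) datum \<Rightarrow> ('k ^ 3) set \<Rightarrow> ('k ^ 3) set \<Rightarrow> bool" where
  "self_dual S X L \<longleftrightarrow> lattice_in S X L \<and> dual_in S X L = L"

definition almost_self_dual :: "('e::field, 'k::field) datum \<Rightarrow> ('k ^ 3) set \<Rightarrow> bool" where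
  "almost_self_dual S L \<longleftrightarrow> lattice_in S UNIV L \<and>
     (\<lambda>x. unif S *s x) ` dual_in S UNIV L \<subset> L \<and> L \<subset> dual_in S UNIV L"

text \<open>\<open>L \<oplus> O e\<^sub>D\<close>\<close>
definition add_eD :: "('e, 'k::field) datum \<Rightarrow> ('k ^ 3) set \<Rightarrow> ('k ^ 3) set" where
  "add_eD S L = {x + c *s eD_tau S | x c. x \<in> L \<and> absv S c \<le> 1}"

text \<open>
  Stabilizers of the vertices given by self-dual lattices. The lattices \<open>L\<close> of \<open>W\<^sub>\<tau>\<close> with \<open>L\<^sup>\<or> = \<varpi>\<^sup>-\<^sup>1 L\<close>, which
  are not hyperspecial in the tree of \<open>V\<^sub>\<tau>\<close>, are not counted: a group \<open>K\<^sub>W = G\<^sub>W \<inter> K\<^sub>V\<close> with \<open>K\<^sub>V\<close> hyperspecial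
  is never the stabilizer of such a lattice, as it fixes the self-dual lattice \<open>pr\<^sub>W(L\<^sub>V)\<close>.
\<close>
definition hyperspecial :: "('e::field, 'k::field) datum \<Rightarrow> ('k ^ 3) set \<Rightarrow> ('k ^ 3 \<Rightarrow> 'k ^ 3) set \<Rightarrow> bool" where
  "hyperspecial S X K \<longleftrightarrow> (\<exists>L. self_dual S X L \<and> K = {g \<in> carrier (unitary S X). g ` L = L})"

definition allowable_inert_place ::
    "('e::field, 'k::{field, complete_space}) datum \<Rightarrow> ('k ^ 3 \<Rightarrow> 'k ^ 3) set \<Rightarrow> ('k ^ 3 \<Rightarrow> 'k ^ 3) set \<Rightarrow> bool" where
  "allowable_inert_place S KV KW \<longleftrightarrow> place_setting S \<and>
     quasi_split S UNIV \<and> quasi_split S (W_tau S) \<and>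
     hyperspecial S UNIV KV \<and> hyperspecial S (W_tau S) KW \<and>
     KW = {g \<in> carrier (G_W S). extend S g \<in> KV}"

definition lattice_pairs :: "('e::field, 'k::field) datum \<Rightarrow> (('k ^ 3) set \<times> ('k ^ 3) set) set" where
  "lattice_pairs S = {(LV, LW). self_dual S UNIV LV \<and> self_dual S (W_tau S) LW}"

definition act :: "('v \<Rightarrow> 'v) \<times> ('v \<Rightarrow> 'v) \<Rightarrow> 'v set \<times> 'v set \<Rightarrow> 'v set \<times> 'v set" where
  "act g P = (fst g ` fst P, snd g ` snd P)"


section \<open>The Bruhat-Tits tree of \<open>U(V\<^sub>\<tau>)\<close>\<close>

definition bt_vertex :: "('e::field, 'k::field) datum \<Rightarrow> ('k ^ 3) set \<Rightarrow> bool" where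
  "bt_vertex S L \<longleftrightarrow> self_dual S UNIV L \<or> almost_self_dual S L"

text \<open>An almost self-dual \<open>M\<close> is adjacent to the self-dual \<open>L\<close> with \<open>M \<subset> L \<subset> M\<^sup>\<or>\<close>. On the apartment of a
  Witt basis this joins the lattices \<open>\<langle>\<varpi>\<^sup>a e\<^sub>+, e\<^sub>0, \<varpi>\<^sup>b e\<^sub>-\<rangle>\<close> with \<open>a + b = 1\<close> to the two lattices with
  \<open>a + b = 0\<close> that contain them.\<close>
definition bt_edges :: "('e::field, 'k::field) datum \<Rightarrow> (('k ^ 3) set \<times> ('k ^ 3) set) set" where
  "bt_edges S = {(L, M). bt_vertex S L \<and> bt_vertex S M \<and>
     (almost_self_dual S L \<and> self_dual S UNIV M \<and> L \<subseteq> M \<or>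
      almost_self_dual S M \<and> self_dual S UNIV L \<and> M \<subseteq> L)}"

text \<open>The path metric on the vertices, with edges of length \<open>1/2\<close>.\<close>
definition vdist :: "('e::field, 'k::field) datum \<Rightarrow> ('k ^ 3) set \<Rightarrow> ('k ^ 3) set \<Rightarrow> real" where
  "vdist S L M = real (LEAST n. (L, M) \<in> bt_edges S ^^ n) / 2"

definition bt_simplex :: "('e::field, 'k::field) datum \<Rightarrow> ('k ^ 3) set set \<Rightarrow> bool" where
  "bt_simplex S \<sigma> \<longleftrightarrow> (\<exists>L. bt_vertex S L \<and> \<sigma> = {L}) \<or> (\<exists>L M. (L, M) \<in> bt_edges S \<and> \<sigma> = {L, M})"

text \<open>Points of the geometric realization are given by their barycentric coordinates.\<close>
abbreviation supp :: "('l \<Rightarrow> real) \<Rightarrow> 'l set" where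
  "supp x \<equiv> {L. x L \<noteq> 0}"

definition building_V :: "('e::field, 'k::field) datum \<Rightarrow> (('k ^ 3) set \<Rightarrow> real) set" where
  "building_V S = {x. (\<forall>L. 0 \<le> x L) \<and> bt_simplex S (supp x) \<and> (\<Sum>L\<in>supp x. x L) = 1}"

definition building_W :: "('e::field, 'k::field) datum \<Rightarrow> (('k ^ 3) set \<Rightarrow> real) set" where
  "building_W S = {x \<in> building_V S. \<forall>L\<in>supp x. \<exists>M. lattice_in S (W_tau S) M \<and> L = add_eD S M}"

definition vertex_point :: "'l \<Rightarrow> 'l \<Rightarrow> real" where
  "vertex_point L = (\<lambda>M. if M = L then 1 else 0)"

text \<open>Path metric of the tree: on a closed edge, barycentric coordinates scaled to length \<open>1/2\<close>; otherwise
  the shortest path leaves through endpoints of the edges carrying the two points, the point \<open>x\<close>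
  being at distance \<open>(1 - x L) / 2\<close> from its endpoint \<open>L\<close>.\<close>
definition bt_dist ::
    "('e::field, 'k::field) datum \<Rightarrow> (('k ^ 3) set \<Rightarrow> real) \<Rightarrow> (('k ^ 3) set \<Rightarrow> real) \<Rightarrow> real" where
  "bt_dist S x y =
     (if bt_simplex S (supp x \<union> supp y) then (\<Sum>L\<in>supp x \<union> supp y. \<bar>x L - y L\<bar>) / 4
      else Min ((\<lambda>(L, M). (1 - x L) / 2 + vdist S L M + (1 - y M) / 2) ` (supp x \<times> supp y)))"

definition pr_W ::
    "('e::field, 'k::field) datum \<Rightarrow> (('k ^ 3) set \<Rightarrow> real) \<Rightarrow> (('k ^ 3) set \<Rightarrow> real)" where
  "pr_W S x = (THE y. y \<in> building_W S \<and> (\<forall>z\<in>building_W S. bt_dist S x y \<le> bt_dist S x z))"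

definition inv_tau :: "('e::field, 'k::field) datum \<Rightarrow> ('k ^ 3) set \<times> ('k ^ 3) set \<Rightarrow> real \<times> real" where
  "inv_tau S = (\<lambda>(LV, LW).
     (bt_dist S (vertex_point LV) (pr_W S (vertex_point LV)),
      bt_dist S (pr_W S (vertex_point LV)) (vertex_point (add_eD S LW))))"

definition Inv_tau :: "(real \<times> real) set" where
  "Inv_tau = {(real a, real b) | a b :: nat. True}"


section \<open>Orbits and the local conductor\<close>

text \<open>\<open>f\<close> is constant on each class in \<open>Q\<close>, and the induced map \<open>Q \<rightarrow> B\<close> is a bijection.\<close>
definition induces_bij :: "('a \<Rightarrow> 'b) \<Rightarrow> 'a set set \<Rightarrow> 'b set \<Rightarrow> bool" where
  "induces_bij f Q B \<longleftrightarrow> (\<forall>C\<in>Q. \<exists>b. f ` C = {b}) \<and> bij_betw (\<lambda>C. the_elem (f ` C)) Q B"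

text \<open>The map \<open>G\<^sub>\<tau>/K\<^sub>\<tau> \<rightarrow> \<L>\<^sub>\<tau>\<close>, \<open>g K\<^sub>\<tau> \<mapsto> g P\<close>, for a base point \<open>P\<close> with stabilizer \<open>K\<^sub>\<tau>\<close>.\<close>
definition coset_to_pair ::
    "'v set \<times> 'v set \<Rightarrow> (('v \<Rightarrow> 'v) \<times> ('v \<Rightarrow> 'v)) set \<Rightarrow> 'v set \<times> 'v set" where
  "coset_to_pair P C = the_elem ((\<lambda>g. act g P) ` C)"

definition order_c :: "('e, 'k::{field, topological_space}) datum \<Rightarrow> nat \<Rightarrow> 'k set" where
  "order_c S c = {a + unif S ^ c * b | a b. a \<in> F_tau S \<and> absv S a \<le> 1 \<and> absv S b \<le> 1}"

definition order_c_units :: "('e, 'k::{field, topological_space}) datum \<Rightarrow> nat \<Rightarrow> 'k set" where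
  "order_c_units S c = {s \<in> order_c S c. \<exists>t\<in>order_c S c. s * t = 1}"

definition r_tau :: "('e, 'k::field) datum \<Rightarrow> 'k \<Rightarrow> 'k" where
  "r_tau S s = conjt S s / s"

definition has_conductor_exponent ::
    "('e::field, 'k::{field, topological_space}) datum \<Rightarrow> (('k ^ 3) set \<times> ('k ^ 3) set) set \<Rightarrow> nat \<Rightarrow> bool" where
  "has_conductor_exponent S C c \<longleftrightarrow>
     (\<forall>P\<in>C. det_H ` stabilizer (H_tau S) act P = r_tau S ` order_c_units S c)"

definition local_conductor ::
    "('e::field, 'k::{field, topological_space}) datum \<Rightarrow> (('k ^ 3) set \<times> ('k ^ 3) set) set \<Rightarrow> 'k" where
  "local_conductor S C = unif S ^ (THE c. has_conductor_exponent S C c)"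

end

theory Submission
  imports Defs
begin

text \<open>
  A self-dual lattice of \<open>V\<^sub>\<tau>\<close> is \<open>\<langle>p, r, q\<rangle>\<close> for a Witt basis, and an inclusion of self-dual lattices is an
  equality. Let \<open>a\<close> be minimal with \<open>\<varpi>\<^sup>a e\<^sub>D \<in> L\<^sub>V\<close>. Completing \<open>\<varpi>\<^sup>a e\<^sub>D\<close> to a hyperbolic plane in \<open>L\<^sub>V\<close> and
  extracting a square root of a principal unit gives \<open>w \<in> W\<^sub>\<tau>\<close> of norm \<open>-1\<close> such that \<open>L\<^sub>V\<close> is
  \<open>\<langle>\<varpi>\<^sup>a (e\<^sub>D + w), z, \<varpi>\<^sup>-\<^sup>a (e\<^sub>D - w)\<rangle>\<close> for every \<open>z \<in> W\<^sub>\<tau>\<close> of norm \<open>1\<close> orthogonal to \<open>w\<close>. The relative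
  position of \<open>L\<^sub>W\<close> and \<open>\<langle>w, z\<rangle>\<close> is given by an isotropic line, and \<open>z\<close> can be rescaled so that this line is
  spanned by \<open>z + w\<close>; then \<open>L\<^sub>W = \<langle>\<varpi>\<^sup>-\<^sup>b (z + w), \<varpi>\<^sup>b (z - w)\<rangle>\<close>. Since \<open>U(W\<^sub>\<tau>)\<close> acts simply transitively
  on the pairs \<open>(w, z)\<close>, the orbits are classified by \<open>(a, b)\<close>. A path of length \<open>m\<close> between self-dual lattices
  \<open>L\<close> and \<open>M\<close> forces \<open>\<varpi>\<^sup>m L \<subseteq> M\<close>; hence \<open>a\<close> is the distance of \<open>L\<^sub>V\<close> to the subtree of \<open>W\<^sub>\<tau>\<close>, attained
  only at \<open>\<langle>w, z, e\<^sub>D\<rangle>\<close>, and \<open>b\<close> is the distance from there to \<open>L\<^sub>W\<close>. The determinants of the stabilizer are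
  read off from the matrices of isometries in the basis \<open>(w, z)\<close>.
\<close>

section \<open>Points of the tree\<close>

text \<open>A lattice of W enters as its sum with O e_D, so one notion of Witt triple serves both
  trees: the middle vector is z for \<open>lat_V\<close> and e_D for \<open>lat_W\<close>.
  Uniqueness of the nearest point of the subtree comes from the equality case of the inclusion that
  bounds distances below. The asymmetry of min(a, 2b) has the following origin. L_W arises from the
  lattice of w, z by rescaling an isotropic line of W by \<pi>^b; an isometry of W keeps it under a
  single congruence modulo \<pi>^(2b). L_V is rescaled along e_D + w, outside W; keeping it costs
  modulus \<pi>^(2a) for the diagonal coefficient p, but only \<pi>^a for the off-diagonal
  coefficient q, which pairs a rescaled vector with the unscaled z. The condition on the determinant
  involves only p - q, which is therefore known to be 1 just modulo \<pi>^a. Inertness makes \<pi> a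
  uniformizer of E and lets scalars be normalized by elements of F. Odd residue characteristic makes
  2 a unit, so that norms can be halved and principal units have square roots.\<close>

lemma supp_vertex_point [simp]: "supp (vertex_point L) = {L}"
  by (auto simp: vertex_point_def)

lemma bt_simplex_finite: "bt_simplex S \<sigma> \<Longrightarrow> finite \<sigma> \<and> \<sigma> \<noteq> {}"
  by (auto simp: bt_simplex_def)

lemma bt_simplex_vertex: "bt_simplex S \<sigma> \<Longrightarrow> L \<in> \<sigma> \<Longrightarrow> bt_vertex S L"
  by (auto simp: bt_simplex_def bt_edges_def)

text \<open>The coordinates are nonnegative with sum 1, so a coordinate equal to 1 leaves nothing
  for the others.\<close>

lemma building_V_le_1:
  assumes "y \<in> building_V S" shows "y L \<le> 1" "y L = 1 \<Longrightarrow> y = vertex_point L"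
proof -
  have y: "\<And>L. 0 \<le> y L" "finite (supp y)" "(\<Sum>L\<in>supp y. y L) = 1"
    using assms bt_simplex_finite by (auto simp: building_V_def)
  show "y L \<le> 1"
  proof (cases "L \<in> supp y")
    case True
    from member_le_sum[OF this, of y] y show ?thesis by simp
  qed simp
  assume 1: "y L = 1"
  hence "L \<in> supp y" by simp
  hence "(\<Sum>M\<in>supp y - {L}. y M) = 0" using sum.remove[OF y(2), of L y] y(3) 1 by simp
  hence "\<forall>M\<in>supp y - {L}. y M = 0" using y by (subst (asm) sum_nonneg_eq_0_iff) auto
  thus "y = vertex_point L" using 1 by (force simp: vertex_point_def fun_eq_iff)
qed

section \<open>Orbits and cosets\<close>

text \<open>The axioms do not ask \<open>\<alpha> g\<close> to be extensional on \<open>E\<close>,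
  as \<open>group_action\<close> would: \<open>act g\<close> is defined on all pairs of
  sets.\<close>

locale set_action = group G for G (structure) +
  fixes E :: "'b set" and \<alpha> :: "'a \<Rightarrow> 'b \<Rightarrow> 'b"
  assumes action_closed: "g \<in> carrier G \<Longrightarrow> x \<in> E \<Longrightarrow> \<alpha> g x \<in> E"
    and action_mult: "g \<in> carrier G \<Longrightarrow> k \<in> carrier G \<Longrightarrow> x \<in> E \<Longrightarrow> \<alpha> (g \<otimes> k) x = \<alpha> g (\<alpha> k x)"
    and action_one: "x \<in> E \<Longrightarrow> \<alpha> \<one> x = x"
begin

lemma image_lcoset:
  assumes "x \<in> E" "g \<in> carrier G"
  shows "(\<lambda>k. \<alpha> k x) ` (g <# stabilizer G \<alpha> x) = {\<alpha> g x}"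
proof -
  have "\<one> \<in> stabilizer G \<alpha> x" using action_one assms by (simp add: stabilizer_def)
  moreover have "\<alpha> (g \<otimes> k) x = \<alpha> g x" if "k \<in> stabilizer G \<alpha> x" for k
    using that assms by (simp add: stabilizer_def action_mult)
  ultimately show ?thesis by (auto simp: l_coset_def image_iff)
qed

text \<open>If s fixes x and g x = k x, then k^-1 g s fixes x. Equality of the cosets follows by
  exchanging g and k.\<close>

lemma lcoset_subset:
  assumes "x \<in> E" "g \<in> carrier G" "k \<in> carrier G" "\<alpha> g x = \<alpha> k x"
  shows "g <# stabilizer G \<alpha> x \<subseteq> k <# stabilizer G \<alpha> x"
proof
  fix u assume "u \<in> g <# stabilizer G \<alpha> x"
  then obtain s where s: "s \<in> carrier G" "\<alpha> s x = x" "u = g \<otimes> s" by (auto simp: l_coset_def stabilizer_def)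
  have "\<alpha> (inv k \<otimes> (g \<otimes> s)) x = \<alpha> (inv k) (\<alpha> k x)"
    using assms s by (simp add: action_mult)
  also have "\<dots> = \<alpha> (inv k \<otimes> k) x" using assms by (subst action_mult) simp_all
  finally have "inv k \<otimes> u \<in> stabilizer G \<alpha> x" using assms s by (simp add: stabilizer_def action_one)
  moreover have "u = k \<otimes> (inv k \<otimes> u)" using assms s by (simp flip: m_assoc)
  ultimately show "u \<in> k <# stabilizer G \<alpha> x" unfolding l_coset_def by blast
qed

text \<open>Orbit-stabilizer. By \<open>image_lcoset\<close> each coset moves x to a single point,
  so \<open>the_elem\<close> is meaningful.\<close>

lemma bij_betw_lcosets:
  assumes x: "x \<in> E" and trans: "orbit G \<alpha> x = E"
  shows "bij_betw (\<lambda>C. the_elem ((\<lambda>g. \<alpha> g x) ` C)) (lcosets (stabilizer G \<alpha> x)) E"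
proof (rule bij_betw_imageI)
  show "inj_on (\<lambda>C. the_elem ((\<lambda>g. \<alpha> g x) ` C)) (lcosets (stabilizer G \<alpha> x))"
  proof (rule inj_onI)
    fix C D assume "C \<in> lcosets (stabilizer G \<alpha> x)" "D \<in> lcosets (stabilizer G \<alpha> x)"
      and eq: "the_elem ((\<lambda>g. \<alpha> g x) ` C) = the_elem ((\<lambda>g. \<alpha> g x) ` D)"
    then obtain g k where g: "g \<in> carrier G" "C = g <# stabilizer G \<alpha> x"
      and k: "k \<in> carrier G" "D = k <# stabilizer G \<alpha> x" by (auto simp: LCOSETS_def)
    have "\<alpha> g x = \<alpha> k x" using eq by (simp add: g k image_lcoset x)
    thus "C = D" using lcoset_subset[OF x g(1) k(1)] lcoset_subset[OF x k(1) g(1)] g k by simp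
  qed
  have "(\<lambda>C. the_elem ((\<lambda>g. \<alpha> g x) ` C)) ` (lcosets (stabilizer G \<alpha> x)) = orbit G \<alpha> x"
    by (force simp: LCOSETS_def orbit_def image_iff image_lcoset x)
  thus "(\<lambda>C. the_elem ((\<lambda>g. \<alpha> g x) ` C)) ` (lcosets (stabilizer G \<alpha> x)) = E" using trans by simp
qed

text \<open>Turns left translation of cosets into the action on \<open>E\<close>, which later
  matches the orbits of H on both sides.\<close>

lemma lcoset_equivariant:
  assumes "x \<in> E" "k \<in> carrier G" "C \<in> lcosets (stabilizer G \<alpha> x)"
  shows "k <# C \<in> lcosets (stabilizer G \<alpha> x)"
    "the_elem ((\<lambda>g. \<alpha> g x) ` (k <# C)) = \<alpha> k (the_elem ((\<lambda>g. \<alpha> g x) ` C))"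
proof -
  obtain g where g: "g \<in> carrier G" "C = g <# stabilizer G \<alpha> x" using assms by (auto simp: LCOSETS_def)
  have "stabilizer G \<alpha> x \<subseteq> carrier G" by (auto simp: stabilizer_def)
  hence kC: "k <# C = (k \<otimes> g) <# stabilizer G \<alpha> x" using assms g by (simp add: lcos_m_assoc)
  thus "k <# C \<in> lcosets (stabilizer G \<alpha> x)" using assms g by (auto simp: LCOSETS_def)
  show "the_elem ((\<lambda>g. \<alpha> g x) ` (k <# C)) = \<alpha> k (the_elem ((\<lambda>g. \<alpha> g x) ` C))"
    unfolding kC unfolding g(2) using assms g by (simp add: image_lcoset action_mult)
qed

end

text \<open>Injectivity of \<phi> on the invariant set A makes taking images a bijection of the
  orbit sets, and the values on an orbit agree with the values of f on its image.\<close>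

lemma induces_bij_transfer:
  assumes bij: "bij_betw \<phi> A B"
    and closed: "\<And>x. x \<in> A \<Longrightarrow> orbit H \<alpha> x \<subseteq> A"
    and equiv: "\<And>x. x \<in> A \<Longrightarrow> \<phi> ` orbit H \<alpha> x = orbit H \<beta> (\<phi> x)"
    and ind: "induces_bij f (orbits H B \<beta>) I"
  shows "induces_bij (\<lambda>x. f (\<phi> x)) (orbits H A \<alpha>) I"
proof -
  have im: "(\<lambda>x. f (\<phi> x)) ` Q = f ` (\<phi> ` Q)" for Q by auto
  have B: "B = \<phi> ` A" using bij by (simp add: bij_betw_def)
  have b1: "bij_betw ((`) \<phi>) (orbits H A \<alpha>) (orbits H B \<beta>)"
  proof (rule bij_betw_imageI)
    show "inj_on ((`) \<phi>) (orbits H A \<alpha>)"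
    proof (rule inj_onI)
      fix Q R assume QR: "Q \<in> orbits H A \<alpha>" "R \<in> orbits H A \<alpha>" and eq: "\<phi> ` Q = \<phi> ` R"
      have "Q \<subseteq> A" "R \<subseteq> A" using QR closed unfolding orbits_def by blast+
      thus "Q = R" using eq inj_on_image_eq_iff[OF bij_betw_imp_inj_on[OF bij]] by blast
    qed
    have "(`) \<phi> ` orbits H A \<alpha> = {\<phi> ` orbit H \<alpha> x | x. x \<in> A}" unfolding orbits_def by blast
    also have "\<dots> = {orbit H \<beta> (\<phi> x) | x. x \<in> A}" using equiv by metis
    also have "\<dots> = orbits H B \<beta>" unfolding orbits_def B by blast
    finally show "(`) \<phi> ` orbits H A \<alpha> = orbits H B \<beta>" .
  qed
  have b2: "bij_betw (\<lambda>C. the_elem (f ` C)) (orbits H B \<beta>) I"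
    and one: "\<forall>C\<in>orbits H B \<beta>. \<exists>b. f ` C = {b}" using ind unfolding induces_bij_def by blast+
  from b1 b2 have "bij_betw ((\<lambda>C. the_elem (f ` C)) \<circ> (`) \<phi>) (orbits H A \<alpha>) I"
    by (rule bij_betw_trans)
  moreover have "\<exists>b. f ` (\<phi> ` Q) = {b}" if Q: "Q \<in> orbits H A \<alpha>" for Q
  proof -
    obtain x where x: "x \<in> A" "Q = orbit H \<alpha> x" using Q unfolding orbits_def by blast
    have "\<phi> ` Q \<in> orbits H B \<beta>" unfolding x(2) equiv[OF x(1)] using x(1) B unfolding orbits_def by blast
    thus ?thesis using one by blast
  qed
  ultimately show ?thesis unfolding induces_bij_def im o_def by blast
qed

lemma orbit_eq_image: "orbit G \<phi> x = (\<lambda>g. \<phi> g x) ` carrier G"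
  by (auto simp: orbit_def)

section \<open>The local field\<close>

locale unitary_place =
  fixes S :: "('e::field_char_0, 'k::{field_char_0, complete_space}) datum"
  assumes glob: "global_setting S" and place: "place_setting S" and qsW: "quasi_split S (W_tau S)"
begin

abbreviation v :: "'k \<Rightarrow> real" where "v \<equiv> absv S"
abbreviation cj :: "'k \<Rightarrow> 'k" where "cj \<equiv> conjt S"
abbreviation h :: "'k ^ 3 \<Rightarrow> 'k ^ 3 \<Rightarrow> 'k" where "h \<equiv> herm_tau S"
abbreviation \<pi> :: 'k where "\<pi> \<equiv> unif S"
abbreviation e :: "'k ^ 3" where "e \<equiv> eD_tau S"
abbreviation W :: "('k ^ 3) set" where "W \<equiv> W_tau S"
abbreviation F :: "'k set" where "F \<equiv> F_tau S"

lemma completion: "completion_at_finite_place S" and inert: "inert S"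
  and cont_cj: "continuous_on UNIV cj" and cj_emb: "cj (emb S x) = emb S (conj S x)"
  and unif: "uniformizer S \<pi>"
  using place by (auto simp: place_setting_def)

lemma v_ge_0 [simp]: "0 \<le> v x" and v_eq_0 [simp]: "v x = 0 \<longleftrightarrow> x = 0"
  and v_mult [simp]: "v (x * y) = v x * v y" and v_add_max: "v (x + y) \<le> max (v x) (v y)"
  using completion by (auto simp: completion_at_finite_place_def nonarch_absolute_value_def)

lemma dist_v: "dist x y = v (x - y)"
  using completion by (auto simp: completion_at_finite_place_def)

lemma v_0 [simp]: "v 0 = 0" by simp

lemma v_1 [simp]: "v 1 = 1"
  using v_mult[of 1 1] v_eq_0[of 1] by (simp del: v_mult v_eq_0)

lemma v_power [simp]: "v (x ^ n) = v x ^ n"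
  by (induction n) auto

lemma v_minus [simp]: "v (- x) = v x"
proof -
  have "v (-1) * v (-1) = 1"
    by (metis mult_minus1 minus_minus v_1 v_mult)
  hence "v (-1) = 1" using v_ge_0[of "-1"]
    by (metis abs_of_nonneg real_sqrt_abs2 real_sqrt_one)
  thus ?thesis by (metis mult_1 mult_minus1 v_mult)
qed

lemma v_inverse [simp]: "v (inverse x) = inverse (v x)"
proof (cases "x = 0")
  case False
  hence "v x * v (inverse x) = 1" by (simp flip: v_mult)
  thus ?thesis by (metis inverse_unique)
qed simp

lemma v_divide [simp]: "v (x / y) = v x / v y"
  by (simp add: divide_inverse)

lemma v_triangle: "v (x + y) \<le> v x + v y"
  using v_add_max[of x y] v_ge_0[of x] v_ge_0[of y] by linarith

lemma v_diff_max: "v (x - y) \<le> max (v x) (v y)"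
  using v_add_max[of x "- y"] by simp

lemma v_add_le: "v x \<le> B \<Longrightarrow> v y \<le> B \<Longrightarrow> v (x + y) \<le> B"
  using v_add_max[of x y] by simp

lemma v_diff_le: "v x \<le> B \<Longrightarrow> v y \<le> B \<Longrightarrow> v (x - y) \<le> B"
  using v_diff_max[of x y] by simp

lemma v_mult_le: "v x \<le> 1 \<Longrightarrow> v y \<le> B \<Longrightarrow> v (x * y) \<le> B"
  by (metis mult_left_le_one_le mult_mono' order.trans v_ge_0 v_mult)

lemma v_add_eq_max: "v x < v y \<Longrightarrow> v (x + y) = v y"
  using v_add_max[of x y] v_diff_max[of "x + y" x] by (auto simp: max_def split: if_splits)

lemma v_one_add: "v x < 1 \<Longrightarrow> v (1 + x) = 1"
  using v_add_eq_max[of x 1] by (simp add: add.commute)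

lemma v_2 [simp]: "v 2 = 1"
  using place by (auto simp: place_setting_def)

lemma v_two_ne [simp]: "(2::'k) \<noteq> 0" by simp

section \<open>The global quadratic extension E/F\<close>

lemma emb_add [simp]: "emb S (x + y) = emb S x + emb S y" 
  and emb_mult [simp]: "emb S (x * y) = emb S x * emb S y" and emb_1 [simp]: "emb S 1 = 1"
  using completion by (auto simp: completion_at_finite_place_def field_hom_on_def)

lemma emb_0 [simp]: "emb S 0 = 0"
  using emb_add[of 0 0] by (simp del: emb_add)

lemma cm: "cm_extension S"
  using glob by (auto simp: global_setting_def)

lemma conj_add [simp]: "conj S (x + y) = conj S x + conj S y"
  and conj_mult [simp]: "conj S (x * y) = conj S x * conj S y" and conj_1 [simp]: "conj S 1 = 1"
  using cm by (auto simp: cm_extension_def field_hom_on_def)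

lemma conj_base: "x \<in> base S \<Longrightarrow> conj S x = x"
  using cm by (auto simp: cm_extension_def)

lemma base_subfield: "subfield_of (base S)"
  using cm by (auto simp: cm_extension_def number_field_def)

lemma base_closed: 
  shows "0 \<in> base S" "1 \<in> base S" "\<And>x y. x \<in> base S \<Longrightarrow> y \<in> base S \<Longrightarrow> x - y \<in> base S"
    "\<And>x y. x \<in> base S \<Longrightarrow> y \<in> base S \<Longrightarrow> x + y \<in> base S"
    "\<And>x y. x \<in> base S \<Longrightarrow> y \<in> base S \<Longrightarrow> x * y \<in> base S"
    "\<And>x y. x \<in> base S \<Longrightarrow> y \<in> base S \<Longrightarrow> x / y \<in> base S"
proof -
  show "0 \<in> base S" "1 \<in> base S" and m: "\<And>x y. x \<in> base S \<Longrightarrow> y \<in> base S \<Longrightarrow> x - y \<in> base S"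
    "\<And>x y. x \<in> base S \<Longrightarrow> y \<in> base S \<Longrightarrow> x * y \<in> base S"
    "\<And>x y. x \<in> base S \<Longrightarrow> y \<in> base S \<Longrightarrow> x / y \<in> base S"
    using base_subfield by (auto simp: subfield_of_def divide_inverse)
  show "x + y \<in> base S" if "x \<in> base S" "y \<in> base S" for x y
    using m(1)[OF that(1) m(1)[OF \<open>0 \<in> base S\<close> that(2)]] by simp
qed

text \<open>Conjugation is given as a nontrivial field endomorphism that fixes F. It sends the
  generator \<delta> to the other root b - \<delta> of its quadratic equation X^2 = a + b X, hence
  is an involution with traces in F.\<close>

lemma
  shows conj_conj [simp]: "conj S (conj S x) = x" and half_trace_base: "(x + conj S x) / 2 \<in> base S"
proof -
  from cm obtain \<delta> where d: "\<delta> \<notin> base S" "\<And>x. \<exists>a\<in>base S. \<exists>b\<in>base S. x = a + b * \<delta>"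
    and nid: "conj S \<noteq> id" unfolding cm_extension_def by blast
  obtain a b where ab: "a \<in> base S" "b \<in> base S" "\<delta> * \<delta> = a + b * \<delta>" using d(2) by blast
  have "conj S \<delta> * conj S \<delta> = a + b * conj S \<delta>"
    using arg_cong[OF ab(3), of "conj S"] ab(1,2) by (simp add: conj_base)
  with ab(3) have "(conj S \<delta> - \<delta>) * (conj S \<delta> - (b - \<delta>)) = 0"
    by (simp add: algebra_simps)
  moreover have "conj S \<delta> \<noteq> \<delta>"
  proof
    assume "conj S \<delta> = \<delta>"
    have "conj S x = x" for x
    proof -
      obtain p q where "p \<in> base S" "q \<in> base S" "x = p + q * \<delta>" using d(2) by blast
      thus ?thesis using \<open>conj S \<delta> = \<delta>\<close> by (simp add: conj_base)
    qed
    hence "conj S = id" by (simp add: fun_eq_iff)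
    with nid show False by simp
  qed
  ultimately have cd: "conj S \<delta> = b - \<delta>" by simp
  have b: "b = \<delta> + conj S \<delta>" using cd by simp
  have cc: "conj S (conj S \<delta>) = \<delta>"
  proof -
    have "conj S b = conj S \<delta> + conj S (conj S \<delta>)" by (subst b) simp
    hence "b = conj S \<delta> + conj S (conj S \<delta>)" using ab(2) by (simp only: conj_base)
    with b show ?thesis by simp
  qed
  obtain p q where x: "x = p + q * \<delta>" "p \<in> base S" "q \<in> base S" using d(2) by blast
  show "conj S (conj S x) = x" using x by (simp add: conj_base cc)
  have two: "2 \<in> base S" using base_closed(4)[OF base_closed(2) base_closed(2)] by simp
  have "x + conj S x = p + p + q * b" using x(2,3) unfolding x(1) conj_add conj_mult cd by (simp add: conj_base algebra_simps)
  moreover have "(p + p + q * b) / 2 \<in> base S"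
    by (intro base_closed x(2,3) ab(2) two)
  ultimately show "(x + conj S x) / 2 \<in> base S" by simp
qed

section \<open>Conjugation and the fixed field\<close>

text \<open>The type \<open>'k\<close> is a field with a complete metric; continuity of its
  operations has to be derived from \<open>dist_v\<close>.\<close>

lemma tendsto_v:
  fixes x :: 'k shows "(X \<longlonglongrightarrow> x) \<longleftrightarrow> (\<lambda>n. v (X n - x)) \<longlonglongrightarrow> 0"
  unfolding dist_v[symmetric] by (rule tendsto_dist_iff)

lemma tendsto_add_v:
  fixes x y :: 'k
  assumes "X \<longlonglongrightarrow> x" "Y \<longlonglongrightarrow> y" shows "(\<lambda>n. X n + Y n) \<longlonglongrightarrow> x + y"
  unfolding tendsto_v
proof (rule tendsto_sandwich[OF always_eventually always_eventually tendsto_const])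
  show "\<forall>n. v (X n + Y n - (x + y)) \<le> v (X n - x) + v (Y n - y)"
    unfolding add_diff_add by (intro allI v_triangle)
  show "(\<lambda>n. v (X n - x) + v (Y n - y)) \<longlonglongrightarrow> 0"
    using tendsto_add[OF assms[unfolded tendsto_v]] by simp
qed simp

lemma tendsto_v_norm:
  fixes x :: 'k assumes "X \<longlonglongrightarrow> x" shows "(\<lambda>n. v (X n)) \<longlonglongrightarrow> v x"
proof -
  have "(\<lambda>n. dist (X n) 0) \<longlonglongrightarrow> dist x 0" by (intro tendsto_intros assms)
  thus ?thesis by (simp add: dist_v)
qed

lemma tendsto_mult_v:
  fixes x y :: 'k
  assumes "X \<longlonglongrightarrow> x" "Y \<longlonglongrightarrow> y" shows "(\<lambda>n. X n * Y n) \<longlonglongrightarrow> x * y"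
  unfolding tendsto_v
proof (rule tendsto_sandwich[OF always_eventually always_eventually tendsto_const])
  have eq: "X n * Y n - x * y = (X n - x) * Y n + x * (Y n - y)" for n by (simp add: algebra_simps)
  show "\<forall>n. v (X n * Y n - x * y) \<le> v (X n - x) * v (Y n) + v x * v (Y n - y)"
    unfolding eq v_mult[symmetric] by (intro allI v_triangle)
  have "(\<lambda>n. v (X n - x) * v (Y n) + v x * v (Y n - y)) \<longlonglongrightarrow> 0 * v y + v x * 0"
    by (intro tendsto_intros tendsto_v_norm assms assms[unfolded tendsto_v])
  thus "(\<lambda>n. v (X n - x) * v (Y n) + v x * v (Y n - y)) \<longlonglongrightarrow> 0" by simp
qed simp

lemma tendsto_cj: "X \<longlonglongrightarrow> x \<Longrightarrow> (\<lambda>n. cj (X n)) \<longlonglongrightarrow> cj x"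
  using cont_cj by (rule continuous_on_tendsto_compose) auto

lemma dense:
  fixes x :: 'k shows "\<exists>X. (\<lambda>n. emb S (X n)) \<longlonglongrightarrow> x"
proof -
  have "x \<in> closure (range (emb S))" using completion by (auto simp: completion_at_finite_place_def)
  then obtain Y where Y: "\<And>n. Y n \<in> range (emb S)" "Y \<longlonglongrightarrow> x"
    unfolding closure_sequential by blast
  hence "\<forall>n. \<exists>z. Y n = emb S z" by blast
  then obtain X where X: "\<And>n. Y n = emb S (X n)" by metis
  have "Y = (\<lambda>n. emb S (X n))" using X by auto
  with Y(2) show ?thesis by auto
qed

text \<open>Both identities hold on the dense image of E and pass to limits, as do the involution
  property and others below.\<close>

lemma cj_add [simp]: "cj (x + y) = cj x + cj y" and cj_mult [simp]: "cj (x * y) = cj x * cj y"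
proof -
  obtain X Y where X: "(\<lambda>n. emb S (X n)) \<longlonglongrightarrow> x" and Y: "(\<lambda>n. emb S (Y n)) \<longlonglongrightarrow> y"
    using dense by meson
  have "(\<lambda>n. emb S (conj S (X n)) + emb S (conj S (Y n))) \<longlonglongrightarrow> cj (x + y)"
    using tendsto_cj[OF tendsto_add_v[OF X Y]] by (simp add: cj_emb flip: emb_add)
  moreover have "(\<lambda>n. emb S (conj S (X n)) + emb S (conj S (Y n))) \<longlonglongrightarrow> cj x + cj y"
    using tendsto_add_v[OF tendsto_cj[OF X] tendsto_cj[OF Y]] by (simp add: cj_emb)
  ultimately show "cj (x + y) = cj x + cj y" by (rule LIMSEQ_unique)
  have "(\<lambda>n. emb S (conj S (X n)) * emb S (conj S (Y n))) \<longlonglongrightarrow> cj (x * y)"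
    using tendsto_cj[OF tendsto_mult_v[OF X Y]] by (simp add: cj_emb flip: emb_mult)
  moreover have "(\<lambda>n. emb S (conj S (X n)) * emb S (conj S (Y n))) \<longlonglongrightarrow> cj x * cj y"
    using tendsto_mult_v[OF tendsto_cj[OF X] tendsto_cj[OF Y]] by (simp add: cj_emb)
  ultimately show "cj (x * y) = cj x * cj y" by (rule LIMSEQ_unique)
qed

lemma cj_cj [simp]: "cj (cj x) = x"
proof -
  obtain X where X: "(\<lambda>n. emb S (X n)) \<longlonglongrightarrow> x" using dense by meson
  from tendsto_cj[OF tendsto_cj[OF X]] have "(\<lambda>n. emb S (X n)) \<longlonglongrightarrow> cj (cj x)" by (simp add: cj_emb)
  with X show ?thesis by (metis LIMSEQ_unique)
qed

lemma cj_0 [simp]: "cj 0 = 0" using cj_add[of 0 0] by (simp del: cj_add)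
lemma cj_eq_0 [simp]: "cj x = 0 \<longleftrightarrow> x = 0" by (metis cj_0 cj_cj)
lemma cj_1 [simp]: "cj 1 = 1"
  using cj_emb[of 1] by simp
lemma cj_minus [simp]: "cj (- x) = - cj x"
  using cj_add[of x "- x"] by (simp del: cj_add add: eq_neg_iff_add_eq_0 add.commute)
lemma cj_diff [simp]: "cj (x - y) = cj x - cj y" using cj_add[of x "- y"] by simp
lemma cj_inverse [simp]: "cj (inverse x) = inverse (cj x)"
proof (cases "x = 0")
  case False
  hence "cj x * cj (inverse x) = 1" by (simp flip: cj_mult)
  thus ?thesis by (metis inverse_unique)
qed simp
lemma cj_divide [simp]: "cj (x / y) = cj x / cj y" by (simp add: divide_inverse)
lemma cj_power [simp]: "cj (x ^ n) = cj x ^ n" by (induction n) auto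
lemma cj_2 [simp]: "cj 2 = 2" using cj_add[of 1 1] by (simp del: cj_add)
text \<open>The fixed set of conjugation is closed and contains the image of F. Conversely, a fixed
  x is the limit of the half traces of elements of E that approximate it, and these lie in
  F.\<close>

lemma F_iff: "x \<in> F \<longleftrightarrow> cj x = x"
proof
  assume x: "x \<in> F"
  have "closed {x. cj x = x}" by (intro closed_Collect_eq cont_cj continuous_on_id)
  moreover have "emb S ` base S \<subseteq> {x. cj x = x}" by (auto simp: cj_emb conj_base)
  ultimately have "F \<subseteq> {x. cj x = x}" unfolding F_tau_def by (rule closure_minimal[rotated])
  with x show "cj x = x" by auto
next
  assume x: "cj x = x"
  obtain X where X: "(\<lambda>n. emb S (X n)) \<longlonglongrightarrow> x" using dense by meson
  have "(\<lambda>n. inverse 2 * (emb S (X n) + cj (emb S (X n)))) \<longlonglongrightarrow> inverse 2 * (x + cj x)"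
    by (intro tendsto_mult_v tendsto_add_v tendsto_cj X tendsto_const)
  moreover have "inverse 2 * (emb S (y) + cj (emb S y)) = emb S ((y + conj S y) / 2)" for y
  proof -
    have half: "(y + conj S y) / 2 * 2 = y + conj S y" by simp
    have "emb S ((y + conj S y) / 2) * emb S 2 = emb S (y + conj S y)"
      unfolding emb_mult[symmetric] half ..
    moreover have "emb S 2 = 2" using emb_add[of 1 1] by simp
    ultimately have eq: "emb S (y + conj S y) = 2 * emb S ((y + conj S y) / 2)"
      by (simp only: mult.commute)
    show ?thesis unfolding cj_emb emb_add[symmetric] by (subst eq) simp
  qed
  ultimately have "(\<lambda>n. emb S ((X n + conj S (X n)) / 2)) \<longlonglongrightarrow> x" using x by simp
  moreover have "\<forall>n. emb S ((X n + conj S (X n)) / 2) \<in> emb S ` base S" using half_trace_base by blast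
  ultimately show "x \<in> F" unfolding F_tau_def closure_sequential
    by (intro exI[of _ "\<lambda>n. emb S ((X n + conj S (X n)) / 2)"] conjI)
qed

text \<open>If conjugation shrank x, then z = cj x / x would have z^n tending to 0, while its
  conjugate z^(-n) keeps absolute value at least 1. This contradicts continuity.\<close>

lemma v_cj [simp]: "v (cj x) = v x"
proof -
  have no: "\<not> v (cj x) < v x" for x
  proof
    assume less: "v (cj x) < v x"
    define z where "z = cj x / x"
    have x: "x \<noteq> 0" using less by force
    have "0 < v x" using x by (simp add: less_le)
    hence vz: "v z < 1" using less by (simp add: z_def divide_less_eq)
    have cz: "cj z = inverse z" using x by (simp add: z_def)
    have "(\<lambda>n. z ^ n) \<longlonglongrightarrow> 0" unfolding tendsto_v using vz by (simp add: LIMSEQ_realpow_zero)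
    from tendsto_v_norm[OF tendsto_cj[OF this]] have l: "(\<lambda>n. inverse (v z) ^ n) \<longlonglongrightarrow> 0" 
      by (simp add: cz power_inverse)
    have "1 \<le> inverse (v z) ^ n" for n
    proof -
      have "0 < v z" using x by (simp add: z_def zero_less_divide_iff less_le)
      hence "1 \<le> inverse (v z)" using vz by (simp add: one_le_inverse)
      thus ?thesis by (rule one_le_power)
    qed
    with l have "(1::real) \<le> 0" by (intro LIMSEQ_le_const) auto
    thus False by simp
  qed
  show ?thesis using no[of x] no[of "cj x"] by simp
qed

section \<open>Uniformizer, value group and principal units\<close>

lemma pi_F [simp]: "cj \<pi> = \<pi>" and pi_ne [simp]: "\<pi> \<noteq> 0" and v_pi_less: "v \<pi> < 1"
  using unif by (auto simp: uniformizer_def F_iff)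

lemma v_pi_pos: "0 < v \<pi>" by (simp add: less_le)

text \<open>The form in which e = 1 is used: a scalar can be made a unit by dividing by a
  conjugation-invariant element.\<close>

lemma F_value: "\<exists>y. cj y = y \<and> v y = v x"
proof -
  have "v ` F = range v" using inert by (simp add: inert_def)
  then obtain y where "y \<in> F" "v y = v x" by (metis rangeI imageE)
  thus ?thesis by (auto simp: F_iff)
qed

lemma v_le_pi: "v x < 1 \<Longrightarrow> v x \<le> v \<pi>"
proof -
  assume x: "v x < 1"
  obtain y where y: "cj y = y" "v y = v x" using F_value by blast
  have "y \<in> F" using y F_iff by simp
  hence "v y \<le> v \<pi>" using unif x y(2) unfolding uniformizer_def by metis
  thus ?thesis using y by simp
qed

lemma v_gt_pi: "v \<pi> < v x \<Longrightarrow> 1 \<le> v x"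
  using v_le_pi[of x] by linarith

lemma v_pi_power_pos: "0 < v \<pi> ^ n" using v_pi_pos by simp

lemma v_pi_power_le: "v \<pi> ^ n \<le> 1"
  using v_pi_less by (simp add: power_le_one)

lemma v_pi_power_le_iff: "v \<pi> ^ m \<le> v \<pi> ^ n \<longleftrightarrow> n \<le> m"
  using v_pi_less v_pi_pos by (simp add: power_decreasing_iff)

lemma v_pi_power_small: "0 < B \<Longrightarrow> \<exists>n. v \<pi> ^ n * c < B"
proof (cases "c \<le> 0")
  case True
  assume "0 < B" thus ?thesis using True by (intro exI[of _ 0]) simp
next
  case False
  assume "0 < B" 
  then obtain n where "v \<pi> ^ n < B / c" using real_arch_pow_inv[of "B / c" "v \<pi>"] v_pi_less False by auto
  thus ?thesis using False by (auto simp: field_simps)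
qed

text \<open>Some y - cj y is nonzero and changes sign under conjugation; division by an element of F
  of equal absolute value makes it a unit.\<close>

lemma anti_unit: "\<exists>\<delta>. cj \<delta> = - \<delta> \<and> v \<delta> = 1"
proof -
  obtain y where "y \<notin> F" using inert by (auto simp: inert_def)
  hence y: "y - cj y \<noteq> 0" by (auto simp: F_iff)
  obtain c where c: "cj c = c" "v c = v (y - cj y)" using F_value by blast
  have "v ((y - cj y) / c) = 1" using c y by (metis v_divide v_eq_0 divide_self)
  moreover have "cj ((y - cj y) / c) = - ((y - cj y) / c)" using c minus_divide_left[of "y - cj y" c] by simp
  ultimately show ?thesis by blast
qed

text \<open>The map x \<mapsto> (m - x^2)/2 contracts the ball of radius \<open>v m\<close> in F by
  the factor \<open>v m\<close>. Its fixed point satisfies x^2 + 2x = m, so 1 + x is the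
  root.\<close>

lemma sqrt_one_add:
  assumes m: "cj m = m" "v m < 1"
  shows "\<exists>t. cj t = t \<and> t * t = 1 + m \<and> v (t - 1) \<le> v m"
proof -
  define A where "A = {x. cj x = x \<and> v x \<le> v m}"
  have "A = {x. cj x = x} \<inter> cball 0 (v m)" by (auto simp: A_def dist_v)
  moreover have "closed {x. cj x = x}" by (intro closed_Collect_eq cont_cj continuous_on_id)
  ultimately have "complete A" by (simp add: closed_Int complete_eq_closed)
  moreover have "(m - x * x) / 2 \<in> A" if "x \<in> A" for x
    using that m v_mult_le[of x x "v m"] v_diff_le[of m "v m" "x * x"] by (auto simp: A_def)
  moreover have "dist ((m - x * x) / 2) ((m - y * y) / 2) \<le> v m * dist x y" if "x \<in> A" "y \<in> A" for x y
  proof -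
    have eq: "(m - x * x) / 2 - (m - y * y) / 2 = (x + y) * (y - x) / 2" by (simp add: field_simps)
    moreover have "v (x + y) \<le> v m" using that by (intro v_add_le) (auto simp: A_def)
    moreover have "v (y - x) = v (x - y)" by (metis minus_diff_eq v_minus)
    ultimately show ?thesis unfolding dist_v eq by (simp add: mult_right_mono)
  qed
  moreover have "0 \<in> A" by (simp add: A_def)
  ultimately have "\<exists>!x\<in>A. (m - x * x) / 2 = x"
    using m by (intro Banach_fix[of _ "v m" "\<lambda>x. (m - x * x) / 2"]) auto
  then obtain x where "x \<in> A" "(m - x * x) / 2 = x" by blast
  hence "2 * x = m - x * x" by (metis nonzero_mult_div_cancel_left times_divide_eq_right v_two_ne)
  with \<open>x \<in> A\<close> show ?thesis by (intro exI[of _ "1 + x"]) (auto simp: A_def algebra_simps)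
qed

lemma half_sum_le: "v x \<le> B \<Longrightarrow> v ((x + cj x) / 2) \<le> B"
  by (simp add: v_add_le)

section \<open>The Hermitian space\<close>

lemma herm_add_left [simp]: "herm S (x + y) z = herm S x z + herm S y z"
  and herm_scale_left [simp]: "herm S (c *s x) y = c * herm S x y"
  and herm_sym: "herm S y x = conj S (herm S x y)"
  using glob unfolding global_setting_def hermitian_form_def by blast+

lemma cj_eq_1 [simp]: "cj x = 1 \<longleftrightarrow> x = 1"
  by (metis cj_1 cj_cj)

lemma herm_add_right [simp]: "herm S x (y + z) = herm S x y + herm S x z"
  and herm_scale_right [simp]: "herm S x (c *s y) = conj S c * herm S x y"
proof -
  have "herm S x (y + z) = conj S (herm S (y + z) x)" by (rule herm_sym)
  also have "\<dots> = conj S (herm S y x) + conj S (herm S z x)" by simp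
  finally show "herm S x (y + z) = herm S x y + herm S x z" by (simp flip: herm_sym)
  have "herm S x (c *s y) = conj S (herm S (c *s y) x)" by (rule herm_sym)
  also have "\<dots> = conj S c * conj S (herm S y x)" by simp
  finally show "herm S x (c *s y) = conj S c * herm S x y" by (simp flip: herm_sym)
qed

lemma vec3_expand:
  fixes x :: "'a::field ^ 3"
  shows "x = x $ 1 *s axis 1 1 + x $ 2 *s axis 2 1 + x $ 3 *s axis 3 1"
  by (simp add: vec_eq_iff axis_def forall_3)

lemma h_add_left [simp]: "h (x + y) z = h x z + h y z"
  and h_scale_left [simp]: "h (c *s x) y = c * h x y"
  and h_add_right [simp]: "h x (y + z) = h x y + h x z"
  and h_scale_right [simp]: "h x (c *s y) = cj c * h x y"
  by (simp_all add: herm_tau_def sum_3 algebra_simps)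

lemma h_sym: "h y x = cj (h x y)"
  unfolding herm_tau_def sum_3
  by (simp add: cj_emb algebra_simps flip: herm_sym)

lemma h_minus_left [simp]: "h (- x) y = - h x y" 
  and h_minus_right [simp]: "h x (- y) = - h x y"
  using h_scale_left[of "-1" x y] h_scale_right[of x "-1" y] by simp_all

lemma h_diff_left [simp]: "h (x - y) z = h x z - h y z"
  and h_diff_right [simp]: "h x (y - z) = h x y - h x z"
  using h_add_left[of x "- y" z] h_add_right[of x y "- z"] by simp_all

lemma h_zero [simp]: "h 0 x = 0" "h x 0 = 0"
  using h_scale_left[of 0 x x] h_scale_right[of x 0 x] by simp_all

lemma cj_h_self [simp]: "cj (h x x) = h x x"
  using h_sym[of x x] by simp

lemma vec_emb_add: "vec_emb S (x + y) = vec_emb S x + vec_emb S y"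
  and vec_emb_scale: "vec_emb S (c *s x) = emb S c *s vec_emb S x"
  and vec_emb_axis: "vec_emb S (axis i 1) = axis i 1"
  by (simp_all add: vec_emb_def vec_eq_iff axis_def)

lemma h_emb: "h (vec_emb S x) (vec_emb S y) = emb S (herm S x y)"
proof -
  have "herm S x y = herm S (x $ 1 *s axis 1 1 + x $ 2 *s axis 2 1 + x $ 3 *s axis 3 1)
    (y $ 1 *s axis 1 1 + y $ 2 *s axis 2 1 + y $ 3 *s axis 3 1)"
    by (rule arg_cong2[where f = "herm S"]; rule vec3_expand)
  thus ?thesis by (simp add: herm_tau_def sum_3 vec_emb_def cj_emb algebra_simps)
qed

lemma e_norm [simp]: "h e e = 1"
proof -
  have "herm S (eD S) (eD S) = 1" using glob unfolding global_setting_def by blast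
  thus ?thesis by (simp add: eD_tau_def h_emb)
qed

lemma herm_eD: "w \<in> subW S \<Longrightarrow> herm S w (eD S) = 0"
proof -
  assume "w \<in> subW S"
  moreover have "eD S \<in> subD S" using glob unfolding global_setting_def by blast
  ultimately have "herm S (eD S) w = 0" unfolding subD_def by blast
  moreover have "conj S 0 = 0" using conj_add[of 0 0] by (simp del: conj_add)
  ultimately show ?thesis using herm_sym[of w "eD S"] by (simp del: conj_conj)
qed

lemma subW_decomp: "\<exists>w\<in>subW S. \<exists>c. x = w + c *s eD S"
proof -
  have sub: "vec.subspace (subW S)" "vec.dim (subW S) = 2" and ee: "herm S (eD S) (eD S) = 1"
    using glob unfolding global_setting_def by blast+
  have "eD S \<notin> vec.span (subW S)" using herm_eD[of "eD S"] ee sub by (auto simp: vec.span_eq_iff[THEN iffD2])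
  hence "vec.dim (insert (eD S) (subW S)) = 3" using sub by (simp add: vec.dim_insert)
  hence "vec.span (insert (eD S) (subW S)) = UNIV"
    by (subst vec.dim_eq_full[symmetric]) (simp add: vec.dimension_def card_cart_basis)
  hence "\<exists>k. x - k *s eD S \<in> vec.span (subW S)" using vec.span_breakdown_eq by blast
  then obtain k where "x - k *s eD S \<in> subW S" using sub by (auto simp: vec.span_eq_iff[THEN iffD2])
  thus ?thesis by (intro bexI[of _ "x - k *s eD S"] exI[of _ k]) auto
qed

lemma subspace_W: "vec.subspace W"
  by (simp add: W_tau_def)

lemma span_W: "vec.span W = W"
  using subspace_W by (simp add: vec.span_eq_iff)

lemma W_closed: "0 \<in> W" "x \<in> W \<Longrightarrow> y \<in> W \<Longrightarrow> x + y \<in> W" "x \<in> W \<Longrightarrow> c *s x \<in> W"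
  "x \<in> W \<Longrightarrow> y \<in> W \<Longrightarrow> x - y \<in> W"
  using subspace_W by (auto simp: vec.subspace_def vec.subspace_diff)

lemma h_W_e: assumes "x \<in> W" shows "h x e = 0"
proof -
  have "vec.subspace {x. h x e = 0}" by (simp add: vec.subspace_def)
  moreover have "vec_emb S ` subW S \<subseteq> {x. h x e = 0}" by (auto simp: eD_tau_def h_emb herm_eD)
  ultimately have "W \<subseteq> {x. h x e = 0}" unfolding W_tau_def by (simp add: vec.span_minimal)
  thus ?thesis using assms by auto
qed

lemma e_notin_W: "e \<notin> W" using h_W_e[of e] by auto

lemma span_insert_e: "vec.span (insert e W) = UNIV"
proof -
  let ?U = "vec.span (insert e W)"
  have ax: "axis i 1 \<in> ?U" for i
  proof -
    obtain w c where w: "w \<in> subW S" "axis i 1 = w + c *s eD S" using subW_decomp by blast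
    have "vec_emb S w \<in> ?U" using w by (auto simp: W_tau_def intro!: vec.span_base)
    moreover have "emb S c *s e \<in> ?U" by (intro vec.span_scale vec.span_base) simp
    ultimately have "vec_emb S w + emb S c *s e \<in> ?U" by (rule vec.span_add)
    moreover have "axis i 1 = vec_emb S w + emb S c *s e"
      using arg_cong[OF w(2), of "vec_emb S"] by (simp add: vec_emb_axis vec_emb_add vec_emb_scale eD_tau_def)
    ultimately show ?thesis by simp
  qed
  have "x \<in> ?U" for x
    by (subst vec3_expand) (intro vec.span_add vec.span_scale ax)
  thus ?thesis by auto
qed

text \<open>Turns membership in W into one linear equation: modulo W every vector is a multiple of
  e, and h e e = 1.\<close>

lemma W_iff: "x \<in> W \<longleftrightarrow> h x e = 0"
proof
  assume x: "h x e = 0"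
  obtain k where "x - k *s e \<in> vec.span W" using span_insert_e vec.span_breakdown_eq[of x e W] by auto
  hence xk: "x - k *s e \<in> W" by (simp add: span_W)
  hence "k = 0" using h_W_e[OF xk] x by simp
  with xk show "x \<in> W" by simp
qed (rule h_W_e)

lemma dim_W: "vec.dim W = 2"
proof -
  have "vec.dim (insert e W) = 3"
    using span_insert_e vec.dim_eq_full[of "insert e W"] by (simp add: vec.dimension_def card_cart_basis)
  thus ?thesis using e_notin_W by (simp add: vec.dim_insert span_W)
qed

text \<open>Nondegeneracy descends from E: the map \<open>T\<close> over E is injective, hence onto,
  so for each i some d over E pairs with the standard basis like a dual vector. Pairing x with the
  image of d reads off the coordinate x_i.\<close>

lemma h_nondegenerate: assumes "\<And>y. h x y = 0" shows "x = 0"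
proof -
  define T where "T x = (\<chi> j. herm S x (axis j 1))" for x
  have lin: "Vector_Spaces.linear (*s) (*s) T"
    by unfold_locales (simp_all add: T_def vec_eq_iff)
  have "inj T"
  proof (subst vec.linear_inj_iff_eq_0[OF lin], intro allI impI)
    fix x assume "T x = 0"
    hence "herm S x (axis j 1) = 0" for j by (simp add: T_def vec_eq_iff)
    hence "herm S x y = 0" for y by (subst vec3_expand[of y]) simp
    thus "x = 0" using glob unfolding global_setting_def nondegenerate_on_def by blast
  qed
  hence "surj T" using vec.linear_inj_imp_surj[OF lin] by blast
  have "x $ i = 0" for i
  proof -
    obtain d where d: "T d = axis i 1" using \<open>surj T\<close> by (metis surjD)
    have hd: "h (vec_emb S d) (axis j 1) = (if j = i then 1 else 0)" for j
    proof -
      have "herm S d (axis j 1) = axis i 1 $ j" unfolding d[symmetric] by (simp add: T_def)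
      hence "herm S d (axis j 1) = (if j = i then 1 else 0)" by (simp add: axis_def)
      thus ?thesis using h_emb[of d "axis j 1"] by (simp add: vec_emb_axis)
    qed
    have "h (vec_emb S d) x = cj (x $ i)"
      using exhaust_3[of i] by (subst vec3_expand[of x]) (auto simp: hd)
    thus ?thesis using h_sym[of "vec_emb S d" x] assms by simp
  qed
  thus ?thesis by (simp add: vec_eq_iff)
qed

text \<open>The middle argument is the anisotropic vector: it is e for lattices that come from W and
  z for \<open>lat_V\<close>.\<close>

definition witt :: "'k ^ 3 \<Rightarrow> 'k ^ 3 \<Rightarrow> 'k ^ 3 \<Rightarrow> bool" where
  "witt p r q \<longleftrightarrow> h p p = 0 \<and> h q q = 0 \<and> h p q = 1 \<and> h r r = 1 \<and> h p r = 0 \<and> h q r = 0"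

lemma wittD:
  assumes "witt p r q"
  shows "h p p = 0" "h q q = 0" "h p q = 1" "h q p = 1" "h r r = 1" "h p r = 0" "h r p = 0"
    "h q r = 0" "h r q = 0"
  using assms by (simp_all add: witt_def h_sym[of p q] h_sym[of p r] h_sym[of q r])

text \<open>Pairing with q, p, r recovers the coefficients of a combination, so the combination map
  is injective and, by dimension, onto.\<close>

lemma witt_expand:
  assumes "witt p r q"
  shows "x = h x q *s p + h x p *s q + h x r *s r"
proof -
  note w = wittD[OF assms]
  define T where "T c = c $ 1 *s p + c $ 2 *s q + c $ 3 *s r" for c :: "'k ^ 3"
  have hT: "h (T c) q = c $ 1" "h (T c) p = c $ 2" "h (T c) r = c $ 3" for c
    by (simp_all add: T_def w)
  have lin: "Vector_Spaces.linear (*s) (*s) T"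
    by unfold_locales (simp_all add: T_def vec.scale_left_distrib vec.scale_right_distrib)
  have "inj T"
    by (subst vec.linear_inj_iff_eq_0[OF lin]) (metis hT h_zero(1) vec_eq_iff exhaust_3 zero_index)
  hence "surj T" using vec.linear_inj_imp_surj[OF lin] by blast
  then obtain c where "x = T c" by (metis surjD)
  thus ?thesis using hT[of c] by (simp add: T_def)
qed

text \<open>An isotropic p in W is completed by a vector with p-pairing 1, made orthogonal to e.
  Subtracting half its norm times p makes it isotropic without changing that pairing; this
  correction recurs below.\<close>

lemma witt_exists: "\<exists>p q. witt p e q \<and> p \<in> W \<and> q \<in> W"
proof -
  obtain I where I: "I \<subseteq> W" "\<forall>x\<in>I. \<forall>y\<in>I. h x y = 0" "vec.dim I = 1"
    using qsW dim_W by (auto simp: quasi_split_def)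
  have "\<not> I \<subseteq> {0}" using I(3) vec.dim_subset[of I "{0}"] by auto
  then obtain p where p: "p \<in> I" "p \<noteq> 0" by blast
  have pp: "h p p = 0" and pW: "p \<in> W" using I p by auto
  obtain y where y: "h p y \<noteq> 0" using h_nondegenerate p(2) by blast
  define y1 where "y1 = inverse (cj (h p y)) *s (y - h y e *s e)"
  have y1: "h p y1 = 1" "h y1 e = 0" using y h_W_e[OF pW] by (simp_all add: y1_def)
  define q where "q = y1 - (h y1 y1 / 2) *s p"
  have pe: "h p e = 0" using pW by (rule h_W_e)
  have y1p: "h y1 p = 1" using y1 h_sym[of p y1] by simp
  have "h q e = 0" "h p q = 1" "h q q = 0" using y1 pp pe y1p by (simp_all add: q_def)
  thus ?thesis using pp pe pW by (intro exI[of _ p] exI[of _ q]) (auto simp: witt_def W_iff)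
qed

section \<open>Self-dual lattices\<close>

lemma witt_scale:
  assumes "witt p r q" "cj c = c" "c \<noteq> 0"
  shows "witt (c *s p) r (inverse c *s q)"
  using assms wittD[OF assms(1)] by (simp add: witt_def)

text \<open>Written as a dual, so that membership is three inequalities; \<open>wlat_span\<close>
  identifies it with the O-span of p, q, r.\<close>

definition wlat :: "'k ^ 3 \<Rightarrow> 'k ^ 3 \<Rightarrow> 'k ^ 3 \<Rightarrow> ('k ^ 3) set" where
  "wlat p r q = {x. v (h x p) \<le> 1 \<and> v (h x q) \<le> 1 \<and> v (h x r) \<le> 1}"

text \<open>A common description, without generators, of self-dual lattices, almost self-dual
  lattices and sums of a self-dual lattice of W with O e.\<close>

definition integral_lattice :: "('k ^ 3) set \<Rightarrow> bool" where
  "integral_lattice X \<longleftrightarrow> (\<forall>x\<in>X. \<forall>y\<in>X. x + y \<in> X) \<and> (\<forall>c. \<forall>x\<in>X. v c \<le> 1 \<longrightarrow> c *s x \<in> X) \<and>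
     (\<forall>x. \<exists>k. \<pi> ^ k *s x \<in> X) \<and> (\<forall>x\<in>X. \<forall>y\<in>X. v (h x y) \<le> 1)"

lemma integral_latticeD:
  assumes "integral_lattice X"
  shows "x \<in> X \<Longrightarrow> y \<in> X \<Longrightarrow> x + y \<in> X" "x \<in> X \<Longrightarrow> v c \<le> 1 \<Longrightarrow> c *s x \<in> X"
    "\<exists>k. \<pi> ^ k *s x \<in> X" "x \<in> X \<Longrightarrow> y \<in> X \<Longrightarrow> v (h x y) \<le> 1"
    "x \<in> X \<Longrightarrow> y \<in> X \<Longrightarrow> x - y \<in> X"
proof -
  show a: "x \<in> X \<Longrightarrow> y \<in> X \<Longrightarrow> x + y \<in> X" "x \<in> X \<Longrightarrow> v c \<le> 1 \<Longrightarrow> c *s x \<in> X"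
    "\<exists>k. \<pi> ^ k *s x \<in> X" "x \<in> X \<Longrightarrow> y \<in> X \<Longrightarrow> v (h x y) \<le> 1" for x y c
    using assms by (auto simp: integral_lattice_def)
  show "x - y \<in> X" if "x \<in> X" "y \<in> X"
    using a(1)[OF that(1) a(2)[OF that(2), of "-1"]] by simp
qed

lemma lattice_in_closed:
  assumes "lattice_in S Y L"
  shows "x \<in> L \<Longrightarrow> y \<in> L \<Longrightarrow> x + y \<in> L" "x \<in> L \<Longrightarrow> v c \<le> 1 \<Longrightarrow> c *s x \<in> L"
    "x \<in> Y \<Longrightarrow> \<exists>k. \<pi> ^ k *s x \<in> L"
proof -
  obtain B where B: "finite B" "vec.span B = Y" "L = {\<Sum>b\<in>B. c b *s b | c. \<forall>b. v (c b) \<le> 1}"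
    using assms by (auto simp: lattice_in_def)
  show "x + y \<in> L" if "x \<in> L" "y \<in> L"
  proof -
    from that B(3) obtain c d where "\<forall>b. v (c b) \<le> 1" "\<forall>b. v (d b) \<le> 1"
      "x = (\<Sum>b\<in>B. c b *s b)" "y = (\<Sum>b\<in>B. d b *s b)" by auto
    thus ?thesis unfolding B(3)
      by (auto simp: v_add_le vec.scale_left_distrib sum.distrib intro!: exI[of _ "\<lambda>b. c b + d b"])
  qed
  show "c *s x \<in> L" if "x \<in> L" "v c \<le> 1"
  proof -
    from that B(3) obtain d where "\<forall>b. v (d b) \<le> 1" "x = (\<Sum>b\<in>B. d b *s b)" by auto
    thus ?thesis unfolding B(3) using that(2)
      by (auto simp: mult_le_one vec.scale_sum_right intro!: exI[of _ "\<lambda>b. c * d b"])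
  qed
  show "\<exists>k. \<pi> ^ k *s x \<in> L" if "x \<in> Y"
  proof -
    have "x \<in> range (\<lambda>u. \<Sum>b\<in>B. u b *s b)" using that B(1,2) vec.span_finite by blast
    then obtain u where u: "x = (\<Sum>b\<in>B. u b *s b)" by blast
    obtain k where k: "v \<pi> ^ k * (\<Sum>b\<in>B. v (u b)) < 1" using v_pi_power_small[of 1] by auto
    have "v (\<pi> ^ k * u b) \<le> 1" if "b \<in> B" for b
    proof -
      have "v (u b) \<le> (\<Sum>b\<in>B. v (u b))" using that B(1) by (intro member_le_sum) auto
      hence "v \<pi> ^ k * v (u b) \<le> v \<pi> ^ k * (\<Sum>b\<in>B. v (u b))" by (intro mult_left_mono) auto
      with k show ?thesis by simp
    qed
    hence "\<forall>b. v (if b \<in> B then \<pi> ^ k * u b else 0) \<le> 1" by auto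
    moreover have "\<pi> ^ k *s x = (\<Sum>b\<in>B. (if b \<in> B then \<pi> ^ k * u b else 0) *s b)"
      by (simp add: u vec.scale_sum_right cong: sum.cong)
    ultimately have "\<exists>c. \<pi> ^ k *s x = (\<Sum>b\<in>B. c b *s b) \<and> (\<forall>b. v (c b) \<le> 1)"
      by (intro exI[of _ "\<lambda>b. if b \<in> B then \<pi> ^ k * u b else 0"]) simp
    thus ?thesis unfolding B(3) by blast
  qed
qed

lemma integral_latticeI:
  assumes "lattice_in S UNIV L" "L \<subseteq> dual_in S UNIV L"
  shows "integral_lattice L"
  unfolding integral_lattice_def using lattice_in_closed[OF assms(1)] assms(2) by (auto simp: dual_in_def)

lemma self_dual_integral: "self_dual S UNIV L \<Longrightarrow> integral_lattice L"
  by (rule integral_latticeI) (auto simp: self_dual_def)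

lemma self_dual_dual:
  assumes "self_dual S UNIV L" "\<And>y. y \<in> L \<Longrightarrow> v (h x y) \<le> 1"
  shows "x \<in> L"
proof -
  have "x \<in> dual_in S UNIV L" using assms(2) by (simp add: dual_in_def)
  thus ?thesis using assms(1) by (simp add: self_dual_def)
qed

text \<open>M pairs integrally with itself, hence with L, so it lies in the dual of L, which is
  L.\<close>

lemma self_dual_eqI:
  assumes "self_dual S UNIV L" "integral_lattice M" "L \<subseteq> M"
  shows "L = M"
  using self_dual_dual[OF assms(1)] integral_latticeD(4)[OF assms(2)] assms(3) by blast

lemma wlat_span:
  assumes "witt p r q"
  shows "wlat p r q = {a *s p + b *s q + c *s r | a b c. v a \<le> 1 \<and> v b \<le> 1 \<and> v c \<le> 1}"
proof (intro equalityI subsetI)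
  fix x assume "x \<in> wlat p r q"
  thus "x \<in> {a *s p + b *s q + c *s r | a b c. v a \<le> 1 \<and> v b \<le> 1 \<and> v c \<le> 1}"
    using witt_expand[OF assms, of x] unfolding wlat_def by blast
qed (auto simp: wlat_def wittD[OF assms])

lemma witt_distinct:
  assumes "witt p r q" shows "p \<noteq> q" "p \<noteq> r" "q \<noteq> r"
  using wittD[OF assms] by auto

lemma lattice_in_triple:
  assumes "p \<noteq> q" "p \<noteq> r" "q \<noteq> r" "\<And>x. \<exists>a b c. x = a *s p + b *s q + c *s r"
    "L = {a *s p + b *s q + c *s r | a b c. v a \<le> 1 \<and> v b \<le> 1 \<and> v c \<le> 1}"
  shows "lattice_in S UNIV L"
  unfolding lattice_in_def
proof (intro exI[of _ "{p, q, r}"] conjI)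
  have "a *s p + b *s q + c *s r \<in> vec.span {p, q, r}" for a b c
    by (intro vec.span_add vec.span_scale vec.span_base) auto
  thus "vec.span {p, q, r} = UNIV" using assms(4) by (metis UNIV_eq_I)
  have sum: "(\<Sum>x\<in>{p, q, r}. c x *s x) = c p *s p + c q *s q + c r *s r" for c
    using assms by (simp add: add.assoc)
  show "L = {\<Sum>x\<in>{p, q, r}. c x *s x | c. \<forall>b. v (c b) \<le> 1}"
  proof (intro equalityI subsetI)
    fix x assume "x \<in> L"
    then obtain a b c where "x = a *s p + b *s q + c *s r" "v a \<le> 1" "v b \<le> 1" "v c \<le> 1" 
      using assms(5) by blast
    thus "x \<in> {\<Sum>x\<in>{p, q, r}. c x *s x | c. \<forall>b. v (c b) \<le> 1}" unfolding sum using assms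
      by (intro CollectI exI[of _ "(\<lambda>_. 0)(p := a, q := b, r := c)"]) auto
  qed (use assms(5) in \<open>auto simp: sum\<close>)
qed auto

lemma lattice_wlat:
  assumes "witt p r q" shows "lattice_in S UNIV (wlat p r q)"
  using witt_distinct[OF assms] _ wlat_span[OF assms]
  by (rule lattice_in_triple) (use witt_expand[OF assms] in blast)

lemma v_h_le:
  assumes "witt p r q" "v (h x p) \<le> 1" "v (h x q) \<le> 1" "v (h x r) \<le> 1" "y \<in> wlat p r q"
  shows "v (h x y) \<le> 1"
proof -
  have "h x y = h x (h y q *s p + h y p *s q + h y r *s r)"
    using witt_expand[OF assms(1), of y] by simp
  also have "\<dots> = cj (h y q) * h x p + cj (h y p) * h x q + cj (h y r) * h x r" by simp
  also have "v \<dots> \<le> 1" using assms by (intro v_add_le v_mult_le) (auto simp: wlat_def)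
  finally show ?thesis .
qed

lemma wlat_gens:
  assumes "witt p r q" shows "p \<in> wlat p r q" "q \<in> wlat p r q" "r \<in> wlat p r q"
  by (simp_all add: wlat_def wittD[OF assms])

lemma self_dual_wlat:
  assumes "witt p r q" shows "self_dual S UNIV (wlat p r q)"
  unfolding self_dual_def dual_in_def
  using lattice_wlat[OF assms] wlat_gens[OF assms] v_h_le[OF assms]
  by (auto simp: wlat_def[of p r q])

lemma v_h_sym: "v (h x y) = v (h y x)"
  by (subst h_sym) simp

text \<open>The hyperbolic pair alone determines L: for x in L the r-component is x minus elements
  of L, so it lies in L, and integrality of its norm bounds its coefficient.\<close>

lemma self_dual_eq_wlat:
  assumes "self_dual S UNIV L" "witt p r q" "p \<in> L" "q \<in> L"
  shows "L = wlat p r q"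
proof (rule self_dual_eqI[OF assms(1) self_dual_integral[OF self_dual_wlat[OF assms(2)]]], rule subsetI)
  note L = integral_latticeD[OF self_dual_integral[OF assms(1)]]
  fix x assume x: "x \<in> L"
  have "h x r *s r = x - h x q *s p - h x p *s q" 
    using witt_expand[OF assms(2), of x] by (simp add: algebra_simps)
  hence "h x r *s r \<in> L" using x assms by (auto intro!: L)
  from L(4)[OF this this] have "v (h x r) * v (h x r) \<le> 1" by (simp add: wittD[OF assms(2)])
  hence "v (h x r) \<le> 1" by (metis power2_eq_square power2_le_iff_abs_le abs_of_nonneg one_power2 v_ge_0 zero_le_one)
  thus "x \<in> wlat p r q" using x assms by (auto simp: wlat_def L(4))
qed

text \<open>Take x as the multiple of an isotropic vector that just pairs integrally with X. Some y
  in X pairs with it to a unit, and y yields the partner q. The vector x itself need not lie in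
  X.\<close>

lemma integral_subset_wlat:
  assumes X: "integral_lattice X" and eX: "e \<in> X"
  obtains p q where "witt p e q" "X \<subseteq> wlat p e q"
proof -
  note XD = integral_latticeD[OF X]
  obtain i j where ij: "witt i e j" using witt_exists by blast
  note ijD = wittD[OF ij]
  obtain k m where k: "\<pi> ^ k *s j \<in> X" and m: "\<pi> ^ m *s i \<in> X" using XD(3) by meson
  \<comment> \<open>The shift by -(k+1) makes P 0 fail: the vector \<pi>^k j of X pairs with
    \<pi>^(-k-1) i to \<pi>^(-1).\<close>
  define P where "P n \<longleftrightarrow> (\<forall>y\<in>X. v (h ((\<pi> ^ n / \<pi> ^ Suc k) *s i) y) \<le> 1)" for n
  have "\<not> P 0" unfolding P_def using k v_pi_less v_pi_pos
    by (intro bexI[of _ "\<pi> ^ k *s j"] notI) (auto dest!: bspec simp: ijD field_simps)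
  moreover have "P (m + Suc k)" using XD(4)[OF m] by (simp add: P_def power_add)
  moreover have "P j \<Longrightarrow> P 0" if "\<And>n. P (Suc n) \<Longrightarrow> P n" for j using that by (induction j) auto
  ultimately have "\<exists>n. \<not> P n \<and> P (Suc n)" by blast
  then obtain n where n: "\<not> P n" "P (Suc n)" by blast
  define x where "x = (\<pi> ^ Suc n / \<pi> ^ Suc k) *s i"
  have x: "h x x = 0" "h x e = 0" by (simp_all add: x_def ijD)
  have xX: "v (h x y) \<le> 1" if "y \<in> X" for y using n(2) that by (simp add: P_def x_def)
  from n(1) obtain y where y: "y \<in> X" "\<not> v (h ((\<pi> ^ n / \<pi> ^ Suc k) *s i) y) \<le> 1"
    by (auto simp: P_def)
  have "h x y = \<pi> * h ((\<pi> ^ n / \<pi> ^ Suc k) *s i) y" by (simp add: x_def)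
  \<comment> \<open>The pairing of y with x / \<pi> is not integral, so by discreteness of the
    valuation the integral number h x y is a unit.\<close>
  hence "v \<pi> < v (h x y)" using y(2) v_pi_pos by (simp del: h_scale_left)
  hence vxy: "v (h x y) = 1" using v_gt_pi xX[OF y(1)] by force
  define z where "z = inverse (cj (h x y)) *s (y - h y e *s e)"
  have hxy: "h x y \<noteq> 0" using vxy by auto
  have zX: "z \<in> X" unfolding z_def by (intro XD y eX) (simp add: vxy)
  have hz: "h x z = 1" "h z e = 0" using hxy x by (simp_all add: z_def)
  hence hzx: "h z x = 1" using h_sym[of x z] by simp
  define q where "q = z - (h z z / 2) *s x"
  have "witt x e q" using x hz hzx by (simp add: witt_def q_def)
  moreover have "w \<in> wlat x e q" if w: "w \<in> X" for w
  proof -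
    have wx: "v (h w x) \<le> 1" using xX[OF w] v_h_sym[of w x] by simp
    have "v (h w q) \<le> 1" unfolding q_def h_diff_right h_scale_right
      using XD(4)[OF zX zX] by (intro v_diff_le v_mult_le XD(4) w zX wx) simp
    thus ?thesis using wx XD(4)[OF w eX] by (simp add: wlat_def)
  qed
  ultimately show ?thesis using that by blast
qed

lemma self_dual_eD:
  assumes "self_dual S UNIV L" "e \<in> L"
  obtains p q where "witt p e q" "L = wlat p e q"
  using integral_subset_wlat[OF self_dual_integral[OF assms(1)] assms(2)]
    self_dual_eqI[OF assms(1)] self_dual_integral self_dual_wlat by metis

text \<open>Relative position of two self-dual lattices of \<open>W\<^sub>\<tau>\<close>. With \<open>k\<close> minimal such that \<open>\<varpi>\<^sup>k N \<subseteq> N'\<close>, a pair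
  \<open>n \<in> N\<close>, \<open>m \<in> N'\<close> violating minimality gives \<open>\<varpi>\<^sup>k m \<in> N\<close>, a vector with norm divisible by \<open>\<varpi>\<^sup>2\<^sup>k\<close>
  and unit pairing with \<open>n\<close>, which is corrected to an isotropic one by solving a quadratic equation.\<close>

lemma relative_position:
  assumes N: "self_dual S UNIV N" "e \<in> N" and N': "self_dual S UNIV N'" "e \<in> N'"
  obtains f g k where "witt f e g" "N = wlat f e g"
    "N' = wlat (inverse (\<pi> ^ k) *s f) e (\<pi> ^ k *s g)"
proof -
  note result = that
  note ND = integral_latticeD[OF self_dual_integral[OF N(1)]]
  note ND' = integral_latticeD[OF self_dual_integral[OF N'(1)]]
  define P where "P k \<longleftrightarrow> (\<forall>x\<in>N. \<pi> ^ k *s x \<in> N')" for k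
  obtain p q where pq: "witt p e q" "N = wlat p e q" using self_dual_eD[OF N] by blast
  have "\<exists>k. P k"
  proof -
    obtain k1 k2 where k: "\<pi> ^ k1 *s p \<in> N'" "\<pi> ^ k2 *s q \<in> N'" using ND'(3) by meson
    have "P (k1 + k2)" unfolding P_def
    proof
      fix x assume x: "x \<in> N"
      have "\<pi> ^ (k1 + k2) *s x = (\<pi> ^ k2 * h x q) *s (\<pi> ^ k1 *s p) +
          (\<pi> ^ k1 * h x p) *s (\<pi> ^ k2 *s q) + (\<pi> ^ (k1 + k2) * h x e) *s e"
        by (subst witt_expand[OF pq(1), of x])
          (simp add: vec.scale_right_distrib power_add mult_ac)
      also have "\<dots> \<in> N'"
        using x by (intro ND'(1) ND'(2)[OF k(1)] ND'(2)[OF k(2)] ND'(2)[OF N'(2)])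
          (auto intro!: mult_le_one simp: v_pi_power_le pq(2) wlat_def)
      finally show "\<pi> ^ (k1 + k2) *s x \<in> N'" .
    qed
    thus ?thesis ..
  qed
  define k where "k = (LEAST k. P k)"
  have k: "P k" unfolding k_def using \<open>\<exists>k. P k\<close> by (rule LeastI_ex)
  \<comment> \<open>It remains to find a hyperbolic pair in N with \<pi>^(-k) f in N'; the partner
    \<pi>^k g lies in N' by the choice of k.\<close>
  have wit: thesis if fg: "witt f e g" "f \<in> N" "g \<in> N" "inverse (\<pi> ^ k) *s f \<in> N'" for f g
  proof -
    have w: "witt (inverse (\<pi> ^ k) *s f) e (\<pi> ^ k *s g)"
      using witt_scale[OF fg(1), of "inverse (\<pi> ^ k)"] by simp
    have "\<pi> ^ k *s g \<in> N'" using k fg(3) by (simp add: P_def)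
    thus ?thesis using result self_dual_eq_wlat[OF N(1) fg(1-3)] self_dual_eq_wlat[OF N'(1) w fg(4)] fg(1) by blast
  qed
  show thesis
  proof (cases k)
    case 0
    hence "p \<in> N'" using k wlat_gens[OF pq(1)] pq(2) by (auto simp: P_def)
    thus ?thesis using wit[OF pq(1)] wlat_gens[OF pq(1)] pq(2) 0 by simp
  next
    case (Suc l)
    have "\<not> P l" using not_less_Least[of l P] Suc k_def by simp
    then obtain n' m' where nm': "n' \<in> N" "m' \<in> N'" "\<not> v (h (\<pi> ^ l *s n') m') \<le> 1"
      using self_dual_dual[OF N'(1)] by (metis P_def)
    define n where "n = n' - h n' e *s e"
    define m where "m = m' - h m' e *s e"
    have n: "n \<in> N" "h n e = 0" unfolding n_def using nm' N by (auto intro!: ND)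
    have m: "m \<in> N'" "h m e = 0" unfolding m_def using nm' N' by (auto intro!: ND')
    have "h e m = 0" using m(2) h_sym[of m e] by simp
    hence split: "h (\<pi> ^ l *s n') m' = h (\<pi> ^ l *s n) m + \<pi> ^ l * (h n' e * cj (h m' e))"
      using n(2) by (simp add: n_def m_def algebra_simps)
    have "v (\<pi> ^ l * (h n' e * cj (h m' e))) \<le> 1"
      using ND(4)[OF nm'(1) N(2)] ND'(4)[OF nm'(2) N'(2)]
      by (intro v_mult_le) (auto simp: v_pi_power_le)
    with split nm'(3) have nm: "\<not> v (h (\<pi> ^ l *s n) m) \<le> 1" by (metis v_add_le)
    \<comment> \<open>x lies in N because pairing it with y in N equals pairing m with \<pi>^k y,
      both in N'.\<close>
    define x where "x = \<pi> ^ k *s m"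
    have x_N: "x \<in> N"
    proof (rule self_dual_dual[OF N(1)])
      fix y assume y: "y \<in> N"
      have "h x y = h m (\<pi> ^ k *s y)" by (simp add: x_def)
      also have "v \<dots> \<le> 1" using k y ND'(4)[OF m(1)] by (simp only: P_def)
      finally show "v (h x y) \<le> 1" .
    qed
    have xe: "h x e = 0" using m by (simp add: x_def)
    have "h n x = \<pi> * h (\<pi> ^ l *s n) m" by (simp add: x_def Suc)
    hence "v \<pi> < v (h n x)" using nm v_pi_pos by (simp del: h_scale_left)
    hence "v (h n x) = 1" using v_gt_pi ND(4)[OF n(1) x_N] by force
    hence vxn: "v (h x n) = 1" using v_h_sym by metis
    hence hxn: "h x n \<noteq> 0" by auto
    define y where "y = inverse (cj (h x n)) *s n"
    have y: "y \<in> N" "h x y = 1" "h y e = 0"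
      unfolding y_def using hxn n by (auto intro!: ND simp: vxn)
    have hyx: "h y x = 1" using y(2) h_sym[of x y] by simp
    define c where "c = h x x"
    define d where "d = h y y"
    have cj: "cj c = c" "cj d = d" by (simp_all add: c_def d_def)
    have vd: "v d \<le> 1" unfolding d_def by (intro ND y)
    have "c = \<pi> ^ k * (\<pi> ^ k * h m m)" by (simp add: c_def x_def)
    hence vc: "v c \<le> v \<pi> ^ k * v \<pi> ^ k"
      using ND'(4)[OF m(1) m(1)] by (simp add: mult_left_le mult_left_mono)
    also have "\<dots> \<le> v \<pi> * 1" using Suc v_pi_power_le[of l] v_pi_power_le[of k] v_pi_pos
      by (intro mult_mono) (auto simp: mult_left_le)
    finally have "v c < 1" using v_pi_less by simp
    hence vcd: "v (- (c * d)) < 1" using v_mult_le[OF vd, of c "v c"] by (simp add: mult.commute)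
    from sqrt_one_add[OF _ this] obtain t where t: "cj t = t" "t * t = 1 - c * d" "v (t - 1) \<le> v (- (c * d))"
      using cj by auto
    have vt: "v (1 + t) = 1" using v_add_eq_max[of "t - 1" 2] t(3) vcd by (simp add: add.commute)
    \<comment> \<open>The small root of d s^2 + 2 s + c = 0, which says that x + s y is isotropic.
      This form of the root avoids dividing by d and shows v s = v c.\<close>
    define s where "s = - (c / (1 + t))"
    have t0: "1 + t \<noteq> 0" using vt by auto
    have s: "cj s = s" "v s = v c" using t(1) cj vt by (simp_all add: s_def)
    have quad: "c + 2 * s + s * s * d = 0"
    proof -
      have st: "s * (1 + t) = - c" using t0 by (simp add: s_def)
      have "(c + 2 * s + s * s * d) * ((1 + t) * (1 + t)) =
          c * ((1 + t) * (1 + t)) + 2 * (s * (1 + t)) * (1 + t) + (s * (1 + t)) * (s * (1 + t)) * d"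
        by (simp add: algebra_simps)
      also have "\<dots> = c * (t * t - (1 - c * d))" unfolding st by (simp add: algebra_simps)
      also have "\<dots> = 0" using t(2) by simp
      finally show ?thesis using t0 by simp
    qed
    define f where "f = x + s *s y"
    have f: "h f f = 0" "h f e = 0" 
      using quad s(1) y xe by (simp_all add: f_def hyx flip: c_def d_def add: algebra_simps)
    have vs1: "v s \<le> 1" using s \<open>v c < 1\<close> by simp
    have fN: "f \<in> N" unfolding f_def by (intro ND x_N y vs1)
    \<comment> \<open>The norm c of \<pi>^k m is divisible by \<pi>^(2k), hence so is s: the
      correction stays in N' after division by \<pi>^k.\<close>
    have "inverse (\<pi> ^ k) *s f = m + (s / (\<pi> ^ k * \<pi> ^ k)) *s (\<pi> ^ k *s y)"
      by (simp add: f_def x_def vec.scale_right_distrib divide_inverse mult_ac)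
    moreover have "v (s / (\<pi> ^ k * \<pi> ^ k)) \<le> 1" using s vc v_pi_power_pos[of k] by (simp add: divide_le_eq)
    moreover have "\<pi> ^ k *s y \<in> N'" using k y by (simp add: P_def)
    ultimately have fN': "inverse (\<pi> ^ k) *s f \<in> N'" by (metis ND'(1,2) m(1))
    have "v (s * d) < 1" using v_mult_le[OF vd, of s "v s"] s \<open>v c < 1\<close> by (simp add: mult.commute)
    hence vfy: "v (h f y) = 1" using v_one_add y by (simp add: f_def flip: d_def)
    hence hfy: "h f y \<noteq> 0" by auto
    define z where "z = inverse (cj (h f y)) *s y"
    have z: "z \<in> N" "h f z = 1" "h z e = 0" unfolding z_def using hfy y by (auto intro!: ND simp: vfy)
    have hzf: "h z f = 1" using z h_sym[of f z] by simp
    define g where "g = z - (h z z / 2) *s f"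
    have "g \<in> N" unfolding g_def by (intro ND z fN) (simp add: ND(4) z)
    moreover have "witt f e g" using f z hzf by (simp add: witt_def g_def)
    ultimately show ?thesis using wit fN fN' by blast
  qed
qed

section \<open>Normal form of a pair of lattices\<close>

text \<open>The last two equations place w and z in W. The signs of the norms make e + w, e - w and
  z + w, z - w isotropic.\<close>

definition frame :: "'k ^ 3 \<Rightarrow> 'k ^ 3 \<Rightarrow> bool" where
  "frame w z \<longleftrightarrow> h w w = -1 \<and> h z z = 1 \<and> h w z = 0 \<and> h w e = 0 \<and> h z e = 0"

text \<open>The factor 1/2, here and in \<open>lat_W\<close>, compensates h (e + w) (e - w) = 2 and
  h (z + w) (z - w) = 2.\<close>

definition lat_V :: "'k ^ 3 \<Rightarrow> 'k ^ 3 \<Rightarrow> nat \<Rightarrow> ('k ^ 3) set" where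
  "lat_V w z a = wlat ((\<pi> ^ a / 2) *s (e + w)) z (inverse (\<pi> ^ a) *s (e - w))"

definition lat_W :: "'k ^ 3 \<Rightarrow> 'k ^ 3 \<Rightarrow> nat \<Rightarrow> ('k ^ 3) set" where
  "lat_W w z b = wlat (inverse (\<pi> ^ b) *s (z + w)) e ((\<pi> ^ b / 2) *s (z - w))"

lemma frameD:
  assumes "frame w z"
  shows "h w w = -1" "h z z = 1" "h w z = 0" "h z w = 0" "h w e = 0" "h e w = 0" "h z e = 0" "h e z = 0"
  using assms by (simp_all add: frame_def h_sym[of w z] h_sym[of e z] h_sym[of e w])

lemma frame_witt:
  assumes "frame w z"
  shows "witt ((\<pi> ^ a / 2) *s (e + w)) z (inverse (\<pi> ^ a) *s (e - w))"
    "witt (inverse (\<pi> ^ b) *s (z + w)) e ((\<pi> ^ b / 2) *s (z - w))"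
  by (simp_all add: witt_def frameD[OF assms])

lemma frame_expand:
  assumes "frame w z" shows "x = (- h x w) *s w + h x z *s z + h x e *s e"
proof -
  have "x = h x ((1 / 2) *s (z - w)) *s (z + w) + h x (z + w) *s ((1 / 2) *s (z - w)) + h x e *s e"
    using witt_expand[OF frame_witt(2)[OF assms, of 0], of x] by simp
  also have "\<dots> = (- h x w) *s w + h x z *s z + h x e *s e"
    by (simp add: vec_eq_iff field_simps)
  finally show ?thesis .
qed

text \<open>As 2 is a unit, bounding sum and difference of two scalars is the same as bounding the
  scalars.\<close>

lemma lat_W_0:
  assumes "frame w z"
  shows "x \<in> lat_W w z 0 \<longleftrightarrow> v (h x w) \<le> 1 \<and> v (h x z) \<le> 1 \<and> v (h x e) \<le> 1"
proof
  assume "x \<in> lat_W w z 0"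
  hence "v ((h x z - h x w) / 2) \<le> 1" and x': "v (h x z + h x w) \<le> 1" "v (h x e) \<le> 1"
    by (simp_all add: lat_W_def wlat_def diff_divide_distrib)
  hence x: "v (h x z + h x w) \<le> 1" "v (h x z - h x w) \<le> 1" "v (h x e) \<le> 1"
    by (simp_all only: v_divide v_2 div_by_1)
  have "v (((h x z + h x w) - (h x z - h x w)) / 2) \<le> 1" "v (((h x z + h x w) + (h x z - h x w)) / 2) \<le> 1"
    using v_diff_le[OF x(1,2)] v_add_le[OF x(1,2)] by (simp_all only: v_divide v_2 div_by_1)
  thus "v (h x w) \<le> 1 \<and> v (h x z) \<le> 1 \<and> v (h x e) \<le> 1" using x(3) by simp
qed (simp add: lat_W_def wlat_def v_add_le v_diff_le)

lemma lat_W_0_mem: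
  assumes "frame w z" shows "w \<in> lat_W w z 0" "z \<in> lat_W w z 0" "e \<in> lat_W w z 0"
  by (simp_all add: lat_W_0[OF assms] frameD[OF assms])

lemma wlat_shift:
  assumes "x \<in> wlat f r g" "v (h x r) \<le> 1"
  shows "\<pi> ^ k *s x \<in> wlat (inverse (\<pi> ^ k) *s f) r (\<pi> ^ k *s g)"
  using assms v_pi_power_le[of k] by (simp add: wlat_def mult_le_one flip: mult.assoc)

text \<open>For isotropic i in W and c = h i w, the vector i + c w is orthogonal to w and has norm c
  cj c. If c were 0, then w would be a multiple of i and isotropic.\<close>

lemma frame_exists: 
  assumes "h w w = -1" "h w e = 0" shows "\<exists>z. frame w z"
proof -
  obtain i j where ij: "witt i e j" using witt_exists by blast
  note D = wittD[OF ij]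
  define c where "c = h i w"
  have "c \<noteq> 0"
  proof
    assume "c = 0"
    hence "h w i = 0" using h_sym[of i w] by (simp add: c_def)
    hence "w = h w j *s i" using witt_expand[OF ij, of w] assms by simp
    hence "h w w = h w (h w j *s i)" by simp
    also have "\<dots> = 0" using \<open>h w i = 0\<close> by simp
    finally show False using assms by simp
  qed
  have wi: "h w i = cj c" by (simp add: c_def h_sym[of w i])
  have "frame w (inverse c *s (i + c *s w))"
    using \<open>c \<noteq> 0\<close> by (simp add: frame_def assms D wi algebra_simps flip: c_def)
  thus ?thesis ..
qed

lemma frame_rescale:
  assumes "frame w z" "c * cj c = 1" shows "frame w (c *s z)"
  using assms by (simp add: frame_def frameD[OF assms(1)] mult.commute)

lemma normal_form:
  assumes L: "self_dual S UNIV L" and N': "self_dual S UNIV N'" "e \<in> N'"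
  obtains w z a b where "frame w z" "L = lat_V w z a" "N' = lat_W w z b"
proof -
  note LD = integral_latticeD[OF self_dual_integral[OF L]]
  note result = that
  define P where "P k \<longleftrightarrow> \<pi> ^ k *s e \<in> L" for k
  define a where "a = (LEAST k. P k)"
  have "\<exists>k. P k" using LD(3)[of e] unfolding P_def .
  hence Pa: "P a" unfolding a_def by (rule LeastI_ex)
  show thesis
  proof (cases a)
    \<comment> \<open>Here e lies in L, and m below would not be small enough for a square root; but
      L comes from W, so \<open>relative_position\<close> treats L and N' together.\<close>
    case 0
    hence eL: "e \<in> L" using Pa by (simp add: P_def)
    obtain f g k where fg: "witt f e g" "L = wlat f e g" "N' = wlat (inverse (\<pi> ^ k) *s f) e (\<pi> ^ k *s g)"
      using relative_position[OF L eL N'] by blast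
    note D = wittD[OF fg(1)]
    have fgL: "f \<in> L" "g \<in> L" using wlat_gens[OF fg(1)] fg(2) by auto
    \<comment> \<open>Chosen with z + w = f and z - w = 2 g, to match the generators of
      \<open>lat_W\<close>.\<close>
    define w where "w = (1 / 2) *s f - g"
    define z where "z = (1 / 2) *s f + g"
    have fr: "frame w z" by (simp add: frame_def w_def z_def D)
    have sum: "z + w = f" "z - w = 2 *s g"
      by (simp_all add: w_def z_def vec_eq_iff)
    have "N' = lat_W w z k" by (simp add: lat_W_def sum fg(3))
    moreover have wL: "w \<in> L" unfolding w_def by (intro LD fgL) simp
    hence "L = lat_V w z 0" unfolding lat_V_def
      by (intro self_dual_eq_wlat[OF L frame_witt(1)[OF fr]] LD eL) auto
    ultimately show ?thesis using result fr by blast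
  next
    case (Suc a')
    have "\<not> P a'" using not_less_Least[of a' P] Suc a_def by simp
    then obtain y' where y': "y' \<in> L" "\<not> v (h (\<pi> ^ a' *s e) y') \<le> 1"
      using self_dual_dual[OF L] by (metis P_def)
    define x where "x = \<pi> ^ a *s e"
    have xL: "x \<in> L" using Pa by (simp add: P_def x_def)
    have "h x y' = \<pi> * h (\<pi> ^ a' *s e) y'" by (simp add: x_def Suc)
    hence "v \<pi> < v (h x y')" using y'(2) v_pi_pos by (simp del: h_scale_left)
    hence vxy: "v (h x y') = 1" using v_gt_pi LD(4)[OF xL y'(1)] by force
    hence hxy: "h x y' \<noteq> 0" by auto
    define y where "y = inverse (cj (h x y')) *s y'"
    have y: "y \<in> L" "h x y = 1" unfolding y_def using hxy y' by (auto intro!: LD simp: vxy)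
    have hey: "h e y = inverse (\<pi> ^ a)" using y(2) by (simp add: x_def field_simps)
    hence hye: "h y e = inverse (\<pi> ^ a)" by (subst h_sym) simp
    \<comment> \<open>The vector e - \<pi>^a y is orthogonal to e and has norm -(1 + m); dividing it
      by a root t of 1 + m gives norm -1.\<close>
    define m where "m = - (\<pi> ^ a * \<pi> ^ a * h y y)"
    have "v m \<le> v \<pi> ^ a * v \<pi> ^ a * 1"
      unfolding m_def using LD(4)[OF y(1) y(1)] by (simp add: mult_left_le)
    hence vm: "v m \<le> v \<pi> ^ a * v \<pi> ^ a" by simp
    also have "\<dots> \<le> v \<pi> * 1" using Suc v_pi_power_le[of a'] v_pi_power_le[of a] v_pi_pos
      by (intro mult_mono) (auto simp: mult_left_le)
    finally have "v m < 1" using v_pi_less by simp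
    then obtain t where t: "cj t = t" "t * t = 1 + m" "v (t - 1) \<le> v m"
      using sqrt_one_add[of m] by (auto simp: m_def)
    have vt: "v t = 1" using v_one_add[of "t - 1"] t(3) \<open>v m < 1\<close> by simp
    hence t0: "t \<noteq> 0" by auto
    define w where "w = inverse t *s (e - \<pi> ^ a *s y)"
    have we: "h w e = 0" by (simp add: w_def hye)
    have "h w w = inverse t * inverse t * (1 - 1 - 1 + \<pi> ^ a * \<pi> ^ a * h y y)"
      by (simp add: w_def hye hey t algebra_simps)
    also have "\<dots> = - (inverse t * inverse t * (t * t))" by (simp add: t(2) m_def algebra_simps)
    also have "\<dots> = -1" using t0 by (simp add: field_simps)
    finally have ww: "h w w = -1" .
    from frame_exists[OF ww we] obtain z0 where fr0: "frame w z0" ..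
    define u where "u = (\<pi> ^ a / 2) *s (e + w)"
    have "u = (1 / 2) *s (x + inverse t *s (x - (\<pi> ^ a * \<pi> ^ a) *s y))"
      by (simp add: u_def w_def x_def vec_eq_iff field_simps)
    also have "\<dots> \<in> L" using v_pi_power_le[of a]
      by (intro LD xL y) (auto simp: vt mult_le_one)
    finally have uL: "u \<in> L" .
    define q where "q = inverse (\<pi> ^ a) *s (e - w)"
    \<comment> \<open>The bound v (t - 1) \<le> v m from \<open>sqrt_one_add\<close> is what makes
      the coefficient (t - 1) / \<pi>^(2a) integral.\<close>
    have "q = inverse t *s (y + ((t - 1) / (\<pi> ^ a * \<pi> ^ a)) *s x)"
      using t0 by (simp add: q_def w_def x_def vec_eq_iff field_simps)
    also have "\<dots> \<in> L" using order.trans[OF t(3) vm] v_pi_power_pos[of a]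
      by (intro LD xL y) (auto simp: vt divide_le_eq)
    finally have qL: "q \<in> L" .
    \<comment> \<open>By \<open>self_dual_eq_wlat\<close> only w matters, which leaves z free to be
      adapted to N'.\<close>
    have Leq: "L = lat_V w z a" if "frame w z" for z
      unfolding lat_V_def
      using self_dual_eq_wlat[OF L frame_witt(1)[OF that]] uL qL by (simp add: u_def q_def)
    define N where "N = lat_W w z0 0"
    have N: "self_dual S UNIV N" "e \<in> N"
      using self_dual_wlat[OF frame_witt(2)[OF fr0, of 0]] lat_W_0_mem[OF fr0] by (simp_all add: N_def lat_W_def)
    note ND = integral_latticeD[OF self_dual_integral[OF N(1)]]
    obtain f g k where fg: "witt f e g" "N = wlat f e g" "N' = wlat (inverse (\<pi> ^ k) *s f) e (\<pi> ^ k *s g)"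
      using relative_position[OF N N'] by blast
    note D = wittD[OF fg(1)]
    have fgN: "f \<in> N" "g \<in> N" using wlat_gens[OF fg(1)] fg(2) by auto
    define \<alpha> where "\<alpha> = - h f w"
    define \<beta> where "\<beta> = h f z0"
    have f: "f = \<alpha> *s w + \<beta> *s z0"
      using frame_expand[OF fr0, of f] D by (simp add: \<alpha>_def \<beta>_def)
    \<comment> \<open>Isotropy of f makes \<beta> / \<alpha> a scalar of norm 1, which can be
      absorbed into z0.\<close>
    have iso: "\<beta> * cj \<beta> = \<alpha> * cj \<alpha>" using D(1) by (subst (asm) (1 2) f) (simp add: frameD[OF fr0] algebra_simps)
    have "v (\<beta> * cj \<beta>) = v (\<alpha> * cj \<alpha>)" by (simp only: iso)
    hence vab: "v \<beta> = v \<alpha>" by (metis abs_of_nonneg real_sqrt_abs2 v_cj v_ge_0 v_mult)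
    \<comment> \<open>Otherwise f would be divisible by \<pi> in N and could not pair to 1 with
      g.\<close>
    have "v \<alpha> = 1"
    proof (rule ccontr)
      assume "v \<alpha> \<noteq> 1"
      moreover have "v \<alpha> \<le> 1" using ND(4)[OF fgN(1)] lat_W_0_mem(1)[OF fr0] by (simp add: \<alpha>_def N_def)
      ultimately have "v \<alpha> < 1" by simp
      have "h f g = h w g * \<alpha> + h z0 g * \<beta>" by (subst f) simp
      hence "v (h f g) \<le> v \<alpha>"
        using lat_W_0_mem[OF fr0] vab by (auto intro!: v_add_le v_mult_le ND(4) fgN simp: N_def)
      thus False using D \<open>v \<alpha> < 1\<close> by simp
    qed
    hence "\<alpha> \<noteq> 0" by auto
    define z where "z = (\<beta> / \<alpha>) *s z0"
    have fr: "frame w z" unfolding z_def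
      using iso \<open>\<alpha> \<noteq> 0\<close> by (intro frame_rescale[OF fr0]) simp
    have f': "f = \<alpha> *s (z + w)" using \<open>\<alpha> \<noteq> 0\<close> by (simp add: f z_def vec.scale_right_distrib)
    have zN: "z \<in> N" unfolding z_def
      using lat_W_0_mem[OF fr0] vab \<open>v \<alpha> = 1\<close> by (intro ND) (auto simp: N_def)
    have "(1 / 2) *s (z - w) \<in> N" using lat_W_0_mem[OF fr0] by (intro ND zN) (auto simp: N_def)
    hence "\<pi> ^ k *s ((1 / 2) *s (z - w)) \<in> N'"
      unfolding fg(3) fg(2) by (intro wlat_shift) (auto simp: wlat_def)
    moreover have wN': "witt (inverse (\<pi> ^ k) *s f) e (\<pi> ^ k *s g)"
      using witt_scale[OF fg(1), of "inverse (\<pi> ^ k)"] by simp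
    have "inverse (\<pi> ^ k) *s (z + w) = inverse \<alpha> *s (inverse (\<pi> ^ k) *s f)"
      using \<open>\<alpha> \<noteq> 0\<close> by (simp add: f' vec_eq_iff field_simps)
    hence "inverse (\<pi> ^ k) *s (z + w) \<in> N'"
      using integral_latticeD(2)[OF self_dual_integral[OF N'(1)] wlat_gens(1)[OF wN', folded fg(3)], of "inverse \<alpha>"]
        \<open>v \<alpha> = 1\<close> by simp
    ultimately have "N' = lat_W w z k" unfolding lat_W_def
      by (intro self_dual_eq_wlat[OF N'(1) frame_witt(2)[OF fr]]) simp_all
    thus ?thesis using result fr Leq by blast
  qed
qed

section \<open>Lattices of \<open>W\<^sub>\<tau>\<close>\<close>

text \<open>Dictionary between lattices of W and lattices of V containing e as an orthogonal
  summand: p and q are orthogonal to e, hence in W.\<close>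

lemma lattice_in_W:
  assumes w: "witt p e q" and L: "L = wlat p e q \<inter> W"
  shows "lattice_in S W L" "dual_in S W L = L" "add_eD S L = wlat p e q"
proof -
  note D = wittD[OF w]
  have pqW: "p \<in> W" "q \<in> W" using D by (auto simp: W_iff)
  have expand: "x = h x q *s p + h x p *s q" if "x \<in> W" for x
    using witt_expand[OF w, of x] that by (simp add: W_iff)
  have sum: "(\<Sum>x\<in>{p, q}. c x *s x) = c p *s p + c q *s q" for c
    using witt_distinct[OF w] by simp
  show "lattice_in S W L"
    unfolding lattice_in_def
  proof (intro exI[of _ "{p, q}"] conjI)
    have "vec.span {p, q} \<subseteq> W" using pqW subspace_W by (intro vec.span_minimal) auto
    moreover have "a *s p + b *s q \<in> vec.span {p, q}" for a b
      by (intro vec.span_add vec.span_scale vec.span_base) auto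
    hence "x \<in> vec.span {p, q}" if "x \<in> W" for x using expand[OF that] by metis
    hence "W \<subseteq> vec.span {p, q}" by blast
    ultimately show "vec.span {p, q} = W" by blast
    show "L = {\<Sum>x\<in>{p, q}. c x *s x | c. \<forall>b. v (c b) \<le> 1}"
    proof (intro equalityI subsetI)
      fix x assume x: "x \<in> L"
      define c where "c = (\<lambda>_. 0)(p := h x q, q := h x p)"
      have "c p = h x q" "c q = h x p" using witt_distinct[OF w] by (simp_all add: c_def)
      hence "x = c p *s p + c q *s q" using expand x by (simp only: L Int_iff)
      moreover have "\<forall>b. v (c b) \<le> 1" using x by (simp add: c_def L wlat_def)
      ultimately show "x \<in> {\<Sum>x\<in>{p, q}. c x *s x | c. \<forall>b. v (c b) \<le> 1}"
        unfolding sum by blast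
    next
      fix x assume "x \<in> {\<Sum>x\<in>{p, q}. c x *s x | c. \<forall>b. v (c b) \<le> 1}"
      then obtain c where "x = c p *s p + c q *s q" "\<forall>b. v (c b) \<le> 1" unfolding sum by blast
      thus "x \<in> L" using pqW by (simp add: L wlat_def D W_iff)
    qed
  qed auto
  have "p \<in> L" "q \<in> L" using wlat_gens[OF w] pqW by (auto simp: L)
  moreover have "v (h x y) \<le> 1" if "x \<in> L" "y \<in> L" for x y
    using v_h_le[OF w, of x y] that by (simp add: L wlat_def)
  moreover have "x \<in> L" if "x \<in> W" "v (h x p) \<le> 1" "v (h x q) \<le> 1" for x
    using that by (simp add: L wlat_def W_iff)
  ultimately show "dual_in S W L = L" unfolding dual_in_def using L by blast
  show "add_eD S L = wlat p e q"
  proof (intro equalityI subsetI)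
    fix x assume "x \<in> add_eD S L"
    then obtain y c where "x = y + c *s e" "y \<in> L" "v c \<le> 1" by (auto simp: add_eD_def)
    thus "x \<in> wlat p e q" by (auto simp: L wlat_def D W_iff)
  next
    fix x assume x: "x \<in> wlat p e q"
    have "x - h x e *s e \<in> L" using x by (simp add: L wlat_def D W_iff)
    moreover have "x = (x - h x e *s e) + h x e *s e" by simp
    ultimately show "x \<in> add_eD S L" using x unfolding add_eD_def wlat_def by blast
  qed
qed

lemma eD_in_add_eD: "lattice_in S W N \<Longrightarrow> e \<in> add_eD S N"
proof -
  assume "lattice_in S W N"
  hence "0 \<in> N" using lattice_in_closed(3)[OF _ W_closed(1)] by auto
  thus "e \<in> add_eD S N" unfolding add_eD_def by (intro CollectI exI[of _ 0] exI[of _ 1]) auto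
qed

text \<open>N + O e is integral, so it embeds in some \<open>wlat p e q\<close>. The part of the
  latter in W pairs integrally with N and therefore lies in the dual N.\<close>

lemma self_dual_W:
  assumes "self_dual S W N"
  obtains p q where "witt p e q" "N = wlat p e q \<inter> W" "add_eD S N = wlat p e q"
proof -
  have lat: "lattice_in S W N" and dual: "dual_in S W N = N" using assms by (auto simp: self_dual_def)
  have NW: "N \<subseteq> W" using dual by (auto simp: dual_in_def)
  note ND = lattice_in_closed[OF lat]
  have int: "integral_lattice (add_eD S N)" unfolding integral_lattice_def
  proof (intro conjI ballI allI impI)
    fix x y assume "x \<in> add_eD S N" "y \<in> add_eD S N"
    then obtain x' y' c d where xy: "x = x' + c *s e" "y = y' + d *s e" "x' \<in> N" "y' \<in> N" "v c \<le> 1" "v d \<le> 1"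
      by (auto simp: add_eD_def)
    have "x + y = (x' + y') + (c + d) *s e" using xy by (simp add: vec.scale_left_distrib)
    thus "x + y \<in> add_eD S N" using xy ND(1) v_add_le unfolding add_eD_def by blast
    have "h x' e = 0" "h e y' = 0" using xy NW by (auto simp: W_iff h_sym[of e y'])
    hence hxy: "h x y = h x' y' + c * cj d" using xy by simp
    have "v (h x' y') \<le> 1" using dual xy(3,4) by (auto simp: dual_in_def)
    thus "v (h x y) \<le> 1" unfolding hxy using xy(5,6) by (simp add: v_add_le mult_le_one)
  next
    fix x c assume x: "x \<in> add_eD S N" "v c \<le> 1"
    then obtain x' d where xy: "x = x' + d *s e" "x' \<in> N" "v d \<le> 1" by (auto simp: add_eD_def)
    have "c *s x = c *s x' + (c * d) *s e" using xy by (simp add: vec.scale_right_distrib)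
    thus "c *s x \<in> add_eD S N" using xy ND(2) x v_mult_le unfolding add_eD_def by blast
  next
    fix x
    have "x - h x e *s e \<in> W" by (simp add: W_iff)
    then obtain k where k: "\<pi> ^ k *s (x - h x e *s e) \<in> N" using ND(3) by blast
    obtain m where m: "v \<pi> ^ m * v (h x e) < 1" using v_pi_power_small[of 1] by auto
    have "\<pi> ^ (m + k) *s x = \<pi> ^ m *s (\<pi> ^ k *s (x - h x e *s e)) + (\<pi> ^ k * (\<pi> ^ m * h x e)) *s e"
      by (simp add: vec_eq_iff power_add algebra_simps)
    moreover have "v (\<pi> ^ k * (\<pi> ^ m * h x e)) \<le> 1" 
      using v_mult_le[of "\<pi> ^ k" "\<pi> ^ m * h x e" 1] m v_pi_power_le[of k] by simp
    moreover have "\<pi> ^ m *s (\<pi> ^ k *s (x - h x e *s e)) \<in> N" by (intro ND k) (simp add: v_pi_power_le)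
    ultimately show "\<exists>k. \<pi> ^ k *s x \<in> add_eD S N" unfolding add_eD_def by blast
  qed
  obtain p q where pq: "witt p e q" "add_eD S N \<subseteq> wlat p e q"
    using integral_subset_wlat[OF int eD_in_add_eD[OF lat]] by blast
  have "N \<subseteq> add_eD S N" unfolding add_eD_def by (force intro: exI[of _ 0])
  hence sub: "N \<subseteq> wlat p e q \<inter> W" using pq NW by blast
  have "v (h x y) \<le> 1" if "x \<in> wlat p e q" "y \<in> N" for x y
    using v_h_le[OF pq(1), of x y] that sub by (auto simp: wlat_def[of p e q])
  hence "wlat p e q \<inter> W \<subseteq> dual_in S W N" unfolding dual_in_def by blast
  hence "N = wlat p e q \<inter> W" using sub dual by blast
  thus ?thesis using that pq(1) lattice_in_W(3)[OF pq(1)] by blast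
qed

lemma self_dual_add_eD:
  assumes "self_dual S W N"
  shows "self_dual S UNIV (add_eD S N)" "e \<in> add_eD S N" "N = add_eD S N \<inter> W"
  using self_dual_W[OF assms] self_dual_wlat wlat_gens by metis+

section \<open>Paths in the tree\<close>

lemma almost_self_dual_not_self_dual: "almost_self_dual S X \<Longrightarrow> \<not> self_dual S UNIV X"
  by (auto simp: almost_self_dual_def self_dual_def)

lemma almost_self_dual_integral: "almost_self_dual S X \<Longrightarrow> integral_lattice X"
  by (rule integral_latticeI) (auto simp: almost_self_dual_def)

text \<open>The midpoint X is the span of p, r, \<pi> q, the intersection of the two self-dual
  lattices.\<close>

lemma almost_self_dual_adjacent:
  assumes w: "witt p r q"
  shows "\<exists>X. almost_self_dual S X \<and> X \<subseteq> wlat p r q \<and> X \<subseteq> wlat (inverse \<pi> *s p) r (\<pi> *s q)"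
proof -
  note D = wittD[OF w]
  define X where "X = {x. v (h x p) \<le> v \<pi> \<and> v (h x q) \<le> 1 \<and> v (h x r) \<le> 1}"
  have lat: "lattice_in S UNIV X"
  proof (rule lattice_in_triple[of p "\<pi> *s q" r])
    show "p \<noteq> \<pi> *s q" "p \<noteq> r" "\<pi> *s q \<noteq> r" using D h_scale_left[of \<pi> q p] h_scale_left[of \<pi> q r]
      by (auto simp: witt_distinct[OF w])
    have ex: "x = h x q *s p + (h x p / \<pi>) *s (\<pi> *s q) + h x r *s r" for x
      using witt_expand[OF w, of x] by simp
    thus "\<exists>a b c. x = a *s p + b *s (\<pi> *s q) + c *s r" for x by blast
    show "X = {a *s p + b *s (\<pi> *s q) + c *s r | a b c. v a \<le> 1 \<and> v b \<le> 1 \<and> v c \<le> 1}"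
    proof (intro equalityI subsetI)
      fix x assume "x \<in> X"
      hence "v (h x q) \<le> 1 \<and> v (h x p / \<pi>) \<le> 1 \<and> v (h x r) \<le> 1"
        using v_pi_pos by (simp add: X_def divide_le_eq)
      thus "x \<in> {a *s p + b *s (\<pi> *s q) + c *s r | a b c. v a \<le> 1 \<and> v b \<le> 1 \<and> v c \<le> 1}"
        using ex[of x] by blast
    qed (auto simp: X_def D mult_left_le_one_le)
  qed
  have dual: "dual_in S UNIV X = {x. v (h x p) \<le> 1 \<and> v \<pi> * v (h x q) \<le> 1 \<and> v (h x r) \<le> 1}" (is "_ = ?D")
  proof (intro equalityI subsetI)
    fix x assume x: "x \<in> dual_in S UNIV X"
    have "p \<in> X" "\<pi> *s q \<in> X" "r \<in> X" using v_pi_less by (simp_all add: X_def D)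
    hence "v (h x p) \<le> 1" "v (h x (\<pi> *s q)) \<le> 1" "v (h x r) \<le> 1"
      using x unfolding dual_in_def by blast+
    thus "x \<in> ?D" by simp
  next
    fix x assume x: "x \<in> ?D"
    have "v (h x y) \<le> 1" if y: "y \<in> X" for y
    proof -
      have "h x y = h x (h y q *s p + h y p *s q + h y r *s r)"
        using witt_expand[OF w, of y] by simp
      also have "\<dots> = cj (h y q) * h x p + cj (h y p) * h x q + cj (h y r) * h x r" by simp
      also have "v \<dots> \<le> 1" 
      proof (intro v_add_le)
        have "v (h y p) * v (h x q) \<le> v \<pi> * v (h x q)" using y by (intro mult_right_mono) (auto simp: X_def)
        thus "v (cj (h y p) * h x q) \<le> 1" using x by simp
      qed (use x y in \<open>auto simp: X_def mult_le_one\<close>)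
      finally show ?thesis .
    qed
    thus "x \<in> dual_in S UNIV X" by (simp add: dual_in_def)
  qed
  have "(\<lambda>x. \<pi> *s x) ` ?D \<subseteq> X" using v_pi_less by (auto simp: X_def mult_left_le mult_le_one)
  \<comment> \<open>r shows that \<pi> X^dual is a proper subset of X, and \<pi>^(-1) p shows that X
    is a proper subset of its dual.\<close>
  moreover have "r \<in> X" "r \<notin> (\<lambda>x. \<pi> *s x) ` ?D"
  proof -
    show "r \<in> X" by (simp add: X_def D)
    show "r \<notin> (\<lambda>x. \<pi> *s x) ` ?D"
    proof
      assume "r \<in> (\<lambda>x. \<pi> *s x) ` ?D"
      then obtain x where x: "r = \<pi> *s x" "v (h x r) \<le> 1" by auto
      have "h r r = \<pi> * h x r" by (subst (1) x(1)) simp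
      hence "1 = v \<pi> * v (h x r)" using D by (metis v_1 v_mult)
      also have "\<dots> \<le> v \<pi>" using x(2) by (simp add: mult_left_le)
      finally show False using v_pi_less by simp
    qed
  qed
  moreover have "X \<subseteq> ?D" using v_pi_less by (auto simp: X_def mult_le_one)
  moreover have "inverse \<pi> *s p \<in> ?D" "inverse \<pi> *s p \<notin> X"
    using v_pi_less v_pi_pos by (auto simp: X_def D field_simps)
  ultimately have "almost_self_dual S X"
    unfolding almost_self_dual_def dual using lat by blast
  moreover have "X \<subseteq> wlat p r q" using v_pi_less by (auto simp: X_def wlat_def)
  moreover have "X \<subseteq> wlat (inverse \<pi> *s p) r (\<pi> *s q)"
    using v_pi_less v_pi_pos by (auto simp: X_def wlat_def field_simps mult_le_one)
  ultimately show ?thesis by blast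
qed

lemma path_apartment:
  assumes "witt p r q"
  shows "(wlat p r q, wlat (inverse (\<pi> ^ k) *s p) r (\<pi> ^ k *s q)) \<in> bt_edges S ^^ (2 * k)"
proof (induction k)
  case (Suc k)
  let ?L = "wlat (inverse (\<pi> ^ k) *s p) r (\<pi> ^ k *s q)"
  let ?M = "wlat (inverse (\<pi> ^ Suc k) *s p) r (\<pi> ^ Suc k *s q)"
  have L: "witt (inverse (\<pi> ^ k) *s p) r (\<pi> ^ k *s q)"
    using witt_scale[OF assms, of "inverse (\<pi> ^ k)"] by simp
  have M: "witt (inverse (\<pi> ^ Suc k) *s p) r (\<pi> ^ Suc k *s q)"
    using witt_scale[OF assms, of "inverse (\<pi> ^ Suc k)"] by simp
  obtain X where "almost_self_dual S X" "X \<subseteq> ?L" "X \<subseteq> ?M"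
    using almost_self_dual_adjacent[OF L] by auto
  hence "(?L, X) \<in> bt_edges S" "(X, ?M) \<in> bt_edges S"
    using self_dual_wlat[OF L] self_dual_wlat[OF M] by (auto simp: bt_edges_def bt_vertex_def)
  hence "(wlat p r q, ?M) \<in> bt_edges S ^^ Suc (Suc (2 * k))"
    using Suc.IH by (intro relpow_Suc_I)
  thus ?case by simp
qed simp

text \<open>A path alternates between the two vertex types. Passing through an almost self-dual Z
  from Y to X costs one factor \<pi>, since \<pi> Y lies in \<pi> Z^dual, hence in Z and in X. At
  odd times Y records the bound reached so far.\<close>

lemma path_invariant:
  assumes L: "self_dual S UNIV L" and "(L, X) \<in> bt_edges S ^^ n"
  shows "if even n then self_dual S UNIV X \<and> (\<forall>x\<in>L. \<pi> ^ (n div 2) *s x \<in> X)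
    else almost_self_dual S X \<and> (\<exists>Y. self_dual S UNIV Y \<and> X \<subseteq> Y \<and> (\<forall>x\<in>L. \<pi> ^ (n div 2) *s x \<in> Y))"
  using assms(2)
proof (induction n arbitrary: X)
  case 0
  thus ?case using L by simp
next
  case (Suc n)
  obtain Z where Z: "(L, Z) \<in> bt_edges S ^^ n" "(Z, X) \<in> bt_edges S"
    using Suc.prems by (auto elim: relpow_Suc_E)
  note IH = Suc.IH[OF Z(1)]
  show ?case
  proof (cases "even n")
    case True
    hence "self_dual S UNIV Z" using IH by simp
    hence "almost_self_dual S X" "X \<subseteq> Z"
      using Z(2) almost_self_dual_not_self_dual by (auto simp: bt_edges_def)
    thus ?thesis using True IH by auto
  next
    case False
    with IH obtain Y where Y: "almost_self_dual S Z" "self_dual S UNIV Y" "Z \<subseteq> Y"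
      "\<forall>x\<in>L. \<pi> ^ (n div 2) *s x \<in> Y" by auto
    hence X: "self_dual S UNIV X" "Z \<subseteq> X"
      using Z(2) almost_self_dual_not_self_dual by (auto simp: bt_edges_def)
    have "Y \<subseteq> dual_in S UNIV Z"
      using integral_latticeD(4)[OF self_dual_integral[OF Y(2)]] Y(3) by (auto simp: dual_in_def)
    hence piY: "\<pi> *s y \<in> X" if "y \<in> Y" for y
      using that Y(1) X(2) by (auto simp: almost_self_dual_def)
    have "\<pi> ^ (Suc n div 2) *s x \<in> X" if "x \<in> L" for x
    proof -
      have "Suc n div 2 = Suc (n div 2)" using False by (auto elim: oddE)
      moreover have "\<pi> *s (\<pi> ^ (n div 2) *s x) \<in> X" using Y(4) that piY by blast
      ultimately show ?thesis by simp
    qed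
    thus ?thesis using X False by simp
  qed
qed

lemma vdist_self_dual:
  assumes L: "self_dual S UNIV L" and M: "self_dual S UNIV M" and path: "(L, M) \<in> bt_edges S ^^ (2 * k)"
    and low: "\<And>m. (\<forall>x\<in>L. \<pi> ^ m *s x \<in> M) \<Longrightarrow> k \<le> m"
  shows "vdist S L M = real k"
proof -
  have "(LEAST n. (L, M) \<in> bt_edges S ^^ n) = 2 * k"
  proof (rule Least_equality[where P = "\<lambda>n. (L, M) \<in> bt_edges S ^^ n", OF path])
    fix n assume n: "(L, M) \<in> bt_edges S ^^ n"
    have "even n" using path_invariant[OF L n] M almost_self_dual_not_self_dual by (auto split: if_splits)
    thus "2 * k \<le> n" using path_invariant[OF L n] low[of "n div 2"] by auto
  qed
  thus ?thesis by (simp add: vdist_def)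
qed

text \<open>The existence of some path is what makes the \<open>LEAST\<close> in
  \<open>vdist\<close> an attained length.\<close>

lemma vdist_path:
  assumes "(L, X) \<in> bt_edges S ^^ n"
  obtains m where "(L, X) \<in> bt_edges S ^^ m" "vdist S L X = real m / 2"
  using LeastI[of "\<lambda>n. (L, X) \<in> bt_edges S ^^ n", OF assms] by (simp add: vdist_def)

lemma vdist_refl [simp]: "vdist S L L = 0"
  by (simp add: vdist_def Least_eq_0)

lemma vdist_edge: 
  assumes "(L, X) \<in> bt_edges S" "L \<noteq> X" shows "vdist S L X = 1 / 2"
proof -
  have "(LEAST n. (L, X) \<in> bt_edges S ^^ n) = 1"
    using assms by (intro Least_equality) (auto simp: Suc_le_eq intro!: gr0I)
  thus ?thesis by (simp add: vdist_def)
qed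

section \<open>Distances between points and the projection to the subtree of W\<close>

lemma bt_dist_self_dual:
  assumes L: "self_dual S UNIV L" and M: "self_dual S UNIV M"
  shows "bt_dist S (vertex_point L) (vertex_point M) = vdist S L M"
proof (cases "L = M")
  case True
  thus ?thesis using L by (simp add: bt_dist_def bt_simplex_def bt_vertex_def)
next
  case False
  have "\<not> bt_simplex S {L, M}"
    using L M False almost_self_dual_not_self_dual by (auto simp: bt_simplex_def bt_edges_def doubleton_eq_iff)
  moreover from this have "\<not> bt_simplex S {M, L}" by (simp add: insert_commute)
  ultimately show ?thesis by (simp add: bt_dist_def insert_is_Un[symmetric]) (simp add: vertex_point_def)
qed

text \<open>It suffices to compare vertices: the distance to an interior point of an edge is the distance to an
  endpoint plus a positive amount.\<close>

lemma pr_W_vertex: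
  assumes L: "self_dual S UNIV L" and M: "self_dual S UNIV M" "vertex_point M \<in> building_W S" "e \<in> M"
    and far: "\<And>X. bt_vertex S X \<Longrightarrow> e \<in> X \<Longrightarrow> X \<noteq> M \<Longrightarrow> vdist S L M < vdist S L X"
  shows "pr_W S (vertex_point L) = vertex_point M"
proof -
  let ?d = "\<lambda>y. bt_dist S (vertex_point L) y"
  have more: "vdist S L M < ?d y" if y: "y \<in> building_W S" "y \<noteq> vertex_point M" for y
  proof -
    have yV: "y \<in> building_V S" using y by (simp add: building_W_def)
    hence y0: "0 \<le> y X" and sm: "bt_simplex S (supp y)" and s1: "(\<Sum>X\<in>supp y. y X) = 1" for X
      by (auto simp: building_V_def)
    have fin: "finite (supp y)" "supp y \<noteq> {}" using bt_simplex_finite[OF sm] by auto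
    have ver: "bt_vertex S X" "e \<in> X" if "X \<in> supp y" for X
    proof -
      show "bt_vertex S X" using bt_simplex_vertex[OF sm that] .
      show "e \<in> X" using y(1) that eD_in_add_eD by (auto simp: building_W_def)
    qed
    have far': "vdist S L M < vdist S L X + (1 - y X) / 2" if X: "X \<in> supp y" for X
    proof (cases "X = M")
      case True
      have "y M \<noteq> 1" "y M \<le> 1" using building_V_le_1[OF yV] y(2) by auto
      thus ?thesis using True by simp
    next
      case False
      with far[OF ver[OF X]] building_V_le_1(1)[OF yV, of X] show ?thesis by argo
    qed
    show ?thesis
    proof (cases "bt_simplex S (insert L (supp y))")
      case True
      hence d: "?d y = (\<Sum>X\<in>insert L (supp y). \<bar>vertex_point L X - y X\<bar>) / 4"
        by (simp add: bt_dist_def)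
      show ?thesis
      proof (cases "L \<in> supp y")
        \<comment> \<open>Now e lies in L, so \<open>far\<close> bounds the left side by vdist S L L
          = 0, and positivity of the distance suffices.\<close>
        case L_in: True
        have "vdist S L M \<le> 0" using far[of L] ver[OF L_in] by force
        moreover have "0 < ?d y"
        proof -
          have "y L \<noteq> 1"
          proof
            assume "y L = 1"
            hence "y = vertex_point L" using building_V_le_1[OF yV] by blast
            moreover have "L = M" using far[of L] ver[OF L_in] by (force simp: vdist_def)
            ultimately show False using y by simp
          qed
          hence "0 < \<bar>vertex_point L L - y L\<bar>" by (simp add: vertex_point_def)
          also have "\<dots> \<le> (\<Sum>X\<in>insert L (supp y). \<bar>vertex_point L X - y X\<bar>)"
            using fin by (intro member_le_sum) auto
          finally show ?thesis by (simp add: d)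
        qed
        ultimately show ?thesis by simp
      next
        case L_notin: False
        \<comment> \<open>The simplex is an edge at L, and L carries no mass, so y is the vertex at
          the other end.\<close>
        obtain X where X: "supp y = {X}" "(L, X) \<in> bt_edges S" "X \<noteq> L"
        proof -
          obtain X where X: "X \<in> supp y" using fin by blast
          hence XL: "X \<noteq> L" using L_notin by blast
          have "\<not> (\<exists>K. insert L (supp y) = {K})" using X XL by blast
          then obtain A B where AB: "(A, B) \<in> bt_edges S" "insert L (supp y) = {A, B}"
            using True unfolding bt_simplex_def by blast
          have BA: "(B, A) \<in> bt_edges S" using AB(1) unfolding bt_edges_def by blast
          have mem: "L \<in> {A, B}" "X \<in> {A, B}" "supp y \<subseteq> {A, B}" using AB(2) X by blast+
          hence "L = A \<and> X = B \<or> L = B \<and> X = A" using XL by blast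
          moreover from this have "supp y = {X}" using mem(3) L_notin X by blast
          ultimately show ?thesis using that AB(1) BA XL by blast
        qed
        have "y X = 1" using s1 X(1) by simp
        hence "X \<noteq> M" using building_V_le_1(2)[OF yV] y by blast
        moreover have "y L = 0" using L_notin by simp
        hence "?d y = 1 / 2" unfolding d X(1) using X(3) \<open>y X = 1\<close> by (simp add: vertex_point_def)
        ultimately show ?thesis using far[OF ver[of X]] vdist_edge[OF X(2)] X by simp
      qed
    next
      case False
      have "?d y = Min ((\<lambda>(A, B). (1 - vertex_point L A) / 2 + vdist S A B + (1 - y B) / 2) ` ({L} \<times> supp y))"
        using False by (simp add: bt_dist_def)
      also have "vdist S L M < \<dots>"
        using fin far' by (subst Min_gr_iff) (auto simp: vertex_point_def)
      finally show ?thesis .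
    qed
  qed
  have dM: "?d (vertex_point M) = vdist S L M" by (rule bt_dist_self_dual[OF L M(1)])
  show ?thesis unfolding pr_W_def
  proof (rule the_equality)
    show "vertex_point M \<in> building_W S \<and> (\<forall>z\<in>building_W S. ?d (vertex_point M) \<le> ?d z)"
      using M(2) more dM by (metis less_imp_le order_refl)
    show "y = vertex_point M" if "y \<in> building_W S \<and> (\<forall>z\<in>building_W S. ?d y \<le> ?d z)" for y
      using that more[of y] M(2) dM by force
  qed
qed

lemma lat_V_0: assumes "frame w z" shows "lat_V w z 0 = lat_W w z 0"
proof -
  have M: "self_dual S UNIV (lat_W w z 0)"
    unfolding lat_W_def by (intro self_dual_wlat frame_witt assms)
  note D = integral_latticeD[OF self_dual_integral[OF M]]
  show ?thesis unfolding lat_V_def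
    by (intro self_dual_eq_wlat[OF M frame_witt(1)[OF assms], symmetric] D lat_W_0_mem assms) auto
qed

lemma self_dual_lat:
  assumes "frame w z"
  shows "self_dual S UNIV (lat_V w z a)" "self_dual S UNIV (lat_W w z b)" "e \<in> lat_W w z b"
  using self_dual_wlat[OF frame_witt(1)[OF assms]] self_dual_wlat[OF frame_witt(2)[OF assms]]
    wlat_gens(3)[OF frame_witt(2)[OF assms]]
  by (auto simp: lat_V_def lat_W_def)

text \<open>The generator \<pi>^(-a) (e - w) pairs with e to \<pi>^(-a), so \<pi>^m must cancel it.
  If m = a, then e - w and hence w lie in X, and X contains a hyperbolic pair of the lattice of w,
  z, e.\<close>

lemma lat_V_depth:
  assumes fr: "frame w z" and X: "integral_lattice X" "e \<in> X"
    and sub: "\<forall>x\<in>lat_V w z a. \<pi> ^ m *s x \<in> X"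
  shows "a \<le> m" and "self_dual S UNIV X \<Longrightarrow> m = a \<Longrightarrow> X = lat_W w z 0"
proof -
  note XD = integral_latticeD[OF X(1)]
  have q: "\<pi> ^ m *s (inverse (\<pi> ^ a) *s (e - w)) \<in> X"
    by (rule bspec[OF sub[unfolded lat_V_def] wlat_gens(2)[OF frame_witt(1)[OF fr, of a]]])
  have "v (h (\<pi> ^ m *s (inverse (\<pi> ^ a) *s (e - w))) e) \<le> 1" by (rule XD(4)[OF q X(2)])
  hence "v \<pi> ^ m \<le> v \<pi> ^ a" using v_pi_power_pos[of a] by (simp add: frameD[OF fr] field_simps)
  thus "a \<le> m" by (simp add: v_pi_power_le_iff)
  assume "self_dual S UNIV X" "m = a"
  hence "e - w \<in> X" using q by simp
  from XD(5)[OF X(2) this] have "w \<in> X" by simp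
  hence "X = lat_V w z 0" unfolding lat_V_def
    by (intro self_dual_eq_wlat[OF \<open>self_dual S UNIV X\<close> frame_witt(1)[OF fr]] XD X) auto
  thus "X = lat_W w z 0" by (simp add: lat_V_0[OF fr])
qed

lemma inv_tau_normal_form:
  assumes fr: "frame w z" and N: "add_eD S N = lat_W w z b"
  shows "inv_tau S (lat_V w z a, N) = (real a, real b)"
proof -
  let ?L = "lat_V w z a" and ?M = "lat_W w z 0"
  note sd = self_dual_lat[OF fr]
  have LM: "(?L, ?M) \<in> bt_edges S ^^ (2 * a)"
    using path_apartment[OF frame_witt(1)[OF fr, of a], of a]
    by (simp add: lat_V_0[OF fr, symmetric]) (simp add: lat_V_def)
  have dLM: "vdist S ?L ?M = real a"
    using lat_V_depth(1)[OF fr self_dual_integral[OF sd(2)] sd(3)]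
    by (intro vdist_self_dual[OF sd(1,2) LM])
  have dMN: "vdist S ?M (lat_W w z b) = real b"
  proof (rule vdist_self_dual[OF sd(2) sd(2)])
    show "(?M, lat_W w z b) \<in> bt_edges S ^^ (2 * b)"
      using path_apartment[OF frame_witt(2)[OF fr, of 0], of b] by (simp add: lat_W_def)
    fix m assume m: "\<forall>x\<in>?M. \<pi> ^ m *s x \<in> lat_W w z b"
    have "(1 / 2) *s (z - w) \<in> ?M" using wlat_gens(2)[OF frame_witt(2)[OF fr, of 0]] by (simp add: lat_W_def)
    hence "\<pi> ^ m *s ((1 / 2) *s (z - w)) \<in> lat_W w z b" using m by blast
    hence "v \<pi> ^ m \<le> v \<pi> ^ b" using v_pi_power_pos[of b]
      by (simp add: lat_W_def wlat_def frameD[OF fr] field_simps)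
    thus "b \<le> m" by (simp add: v_pi_power_le_iff)
  qed
  have "vertex_point ?M \<in> building_W S"
  proof -
    have w: "witt (z + w) e ((1 / 2) *s (z - w))" using frame_witt(2)[OF fr, of 0] by simp
    have "?M = add_eD S (?M \<inter> W)" "lattice_in S W (?M \<inter> W)"
      using lattice_in_W[OF w refl] by (simp_all add: lat_W_def)
    hence "\<forall>L\<in>supp (vertex_point ?M). \<exists>M. lattice_in S W M \<and> L = add_eD S M"
      unfolding supp_vertex_point by blast
    moreover have "vertex_point ?M \<in> building_V S"
      using sd(2)[of 0] by (simp add: building_V_def bt_simplex_def bt_vertex_def) (simp add: vertex_point_def)
    ultimately show ?thesis unfolding building_W_def by blast
  qed
  moreover have "vdist S ?L ?M < vdist S ?L X" if X: "bt_vertex S X" "e \<in> X" "X \<noteq> ?M" for X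
  proof (cases "self_dual S UNIV X")
    case True
    obtain f g k where fg: "witt f e g" "?M = wlat f e g" "X = wlat (inverse (\<pi> ^ k) *s f) e (\<pi> ^ k *s g)"
      using relative_position[OF sd(2,3) True X(2)] by blast
    \<comment> \<open>This path through ?M shows that X is reachable; the strict bound is proved for
      a shortest path.\<close>
    have "(?L, X) \<in> bt_edges S ^^ (2 * a + 2 * k)"
      using LM path_apartment[OF fg(1), of k] fg(2,3) by (auto simp: relpow_add)
    then obtain n where n: "(?L, X) \<in> bt_edges S ^^ n" "vdist S ?L X = real n / 2" by (rule vdist_path)
    have inv: "even n" "\<forall>x\<in>?L. \<pi> ^ (n div 2) *s x \<in> X"
      using path_invariant[OF sd(1) n(1)] True almost_self_dual_not_self_dual by (auto split: if_splits)
    note depth = lat_V_depth[OF fr self_dual_integral[OF True] X(2) inv(2)]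
    \<comment> \<open>The equality case of \<open>lat_V_depth\<close> would give X = ?M.\<close>
    hence "a < n div 2" using True X(3) by (metis le_neq_implies_less)
    thus ?thesis using n(2) dLM inv(1) by auto
  next
    case False
    hence X_almost: "almost_self_dual S X" using X(1) by (simp add: bt_vertex_def)
    obtain p q where pq: "witt p e q" "X \<subseteq> wlat p e q"
      using integral_subset_wlat[OF almost_self_dual_integral[OF X_almost] X(2)] by blast
    have Y: "self_dual S UNIV (wlat p e q)" "e \<in> wlat p e q" using self_dual_wlat wlat_gens pq by auto
    obtain f g k where fg: "witt f e g" "?M = wlat f e g" "wlat p e q = wlat (inverse (\<pi> ^ k) *s f) e (\<pi> ^ k *s g)"
      using relative_position[OF sd(2,3) Y] by blast
    have "(wlat p e q, X) \<in> bt_edges S" using Y X_almost pq(2) by (auto simp: bt_edges_def bt_vertex_def)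
    moreover have "(?L, wlat p e q) \<in> bt_edges S ^^ (2 * a + 2 * k)"
      using LM path_apartment[OF fg(1), of k] fg(2,3) by (auto simp: relpow_add)
    ultimately have "(?L, X) \<in> bt_edges S ^^ Suc (2 * a + 2 * k)" by (intro relpow_Suc_I)
    then obtain n where n: "(?L, X) \<in> bt_edges S ^^ n" "vdist S ?L X = real n / 2" by (rule vdist_path)
    obtain Z where Z: "odd n" "self_dual S UNIV Z" "X \<subseteq> Z" "\<forall>x\<in>?L. \<pi> ^ (n div 2) *s x \<in> Z"
      using path_invariant[OF sd(1) n(1)] False by (auto split: if_splits)
    have "a \<le> n div 2" using lat_V_depth(1)[OF fr self_dual_integral[OF Z(2)] _ Z(4)] Z(3) X(2) by blast
    \<comment> \<open>Strictness comes from parity: n is odd and a \<le> n div 2, so n / 2 is at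
      least a + 1/2.\<close>
    thus ?thesis using n(2) dLM Z(1) by (auto elim!: oddE)
  qed
  ultimately have "pr_W S (vertex_point ?L) = vertex_point ?M" using pr_W_vertex sd by blast
  thus ?thesis
    by (simp add: inv_tau_def bt_dist_self_dual sd N dLM dMN)
qed

section \<open>Unitary groups\<close>

lemma unitary_iff:
  "g \<in> carrier (unitary S X) \<longleftrightarrow> g \<in> extensional X \<and> bij_betw g X X \<and>
     (\<forall>x\<in>X. \<forall>y\<in>X. g (x + y) = g x + g y) \<and> (\<forall>c. \<forall>x\<in>X. g (c *s x) = c *s g x) \<and>
     (\<forall>x\<in>X. \<forall>y\<in>X. h (g x) (g y) = h x y)"
  by (auto simp: unitary_def Bij_def)

lemma unitaryD:
  assumes "g \<in> carrier (unitary S X)"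
  shows "g \<in> extensional X" "bij_betw g X X" "x \<in> X \<Longrightarrow> y \<in> X \<Longrightarrow> g (x + y) = g x + g y"
    "x \<in> X \<Longrightarrow> g (c *s x) = c *s g x" "x \<in> X \<Longrightarrow> y \<in> X \<Longrightarrow> h (g x) (g y) = h x y" "x \<in> X \<Longrightarrow> g x \<in> X"
    "g ` X = X"
  using assms by (auto simp: unitary_iff bij_betw_def)

lemma mult_unitary:
  "f \<in> carrier (unitary S X) \<Longrightarrow> g \<in> carrier (unitary S X) \<Longrightarrow> f \<otimes>\<^bsub>unitary S X\<^esub> g = compose X f g"
  by (simp add: unitary_def BijGroup_def)

lemma one_unitary: "\<one>\<^bsub>unitary S X\<^esub> = (\<lambda>x\<in>X. x)"
  by (simp add: unitary_def BijGroup_def)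

lemma group_unitary:
  assumes X: "vec.subspace X" shows "group (unitary S X)"
proof -
  let ?B = "BijGroup X"
  have XD: "x \<in> X \<Longrightarrow> y \<in> X \<Longrightarrow> x + y \<in> X" "x \<in> X \<Longrightarrow> c *s x \<in> X" for x y c
    using X by (auto simp: vec.subspace_def)
  have Bij: "g \<in> Bij X" if "g \<in> carrier (unitary S X)" for g using that by (simp add: unitary_def)
  have "subgroup (carrier (unitary S X)) ?B"
  proof (rule group.subgroupI[OF group_BijGroup])
    show "carrier (unitary S X) \<subseteq> carrier ?B" by (auto simp: unitary_def BijGroup_def)
    have "(\<lambda>x\<in>X. x) \<in> carrier (unitary S X)"
      using XD id_Bij[of X] by (simp add: unitary_iff Bij_def)
    thus "carrier (unitary S X) \<noteq> {}" by blast
    fix g assume g: "g \<in> carrier (unitary S X)"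
    define k where "k = inv_into X g"
    note gD = unitaryD[OF g]
    have k: "k x \<in> X" "g (k x) = x" if "x \<in> X" for x
      using that gD(7) inv_into_into[of x g X] f_inv_into_f[of x g X] by (auto simp: k_def)
    have kg: "k (g x) = x" if "x \<in> X" for x
      using that gD(2) by (simp add: k_def bij_betw_def)
    have "inv\<^bsub>?B\<^esub> g = (\<lambda>x\<in>X. k x)" using inv_BijGroup[OF Bij[OF g]] by (simp add: k_def)
    moreover have "(\<lambda>x\<in>X. k x) \<in> carrier (unitary S X)"
      unfolding unitary_iff
    proof (intro conjI ballI allI)
      show "bij_betw (\<lambda>x\<in>X. k x) X X"
        using restrict_inv_into_Bij[OF Bij[OF g]] by (simp add: Bij_def k_def)
      fix x y assume xy: "x \<in> X" "y \<in> X"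
      have "k (x + y) = k (g (k x + k y))" using xy k gD(3) by simp
      also have "\<dots> = k x + k y" using xy k XD by (intro kg) auto
      finally show "(\<lambda>x\<in>X. k x) (x + y) = (\<lambda>x\<in>X. k x) x + (\<lambda>x\<in>X. k x) y" using xy XD by simp
      have "h (k x) (k y) = h (g (k x)) (g (k y))" using gD(5)[of "k x" "k y"] k xy by metis
      thus "h ((\<lambda>x\<in>X. k x) x) ((\<lambda>x\<in>X. k x) y) = h x y" using xy k by simp
    next
      fix c x assume x: "x \<in> X"
      have "k (c *s x) = k (g (c *s k x))" using x k gD(4) by simp
      also have "\<dots> = c *s k x" using x k XD by (intro kg) auto
      finally show "(\<lambda>x\<in>X. k x) (c *s x) = c *s (\<lambda>x\<in>X. k x) x" using x XD by simp
    qed simp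
    ultimately show "inv\<^bsub>?B\<^esub> g \<in> carrier (unitary S X)" by simp
  next
    fix f g assume fg: "f \<in> carrier (unitary S X)" "g \<in> carrier (unitary S X)"
    note fD = unitaryD[OF fg(1)] and gD = unitaryD[OF fg(2)]
    have "compose X f g \<in> carrier (unitary S X)"
      unfolding unitary_iff using compose_Bij[OF Bij[OF fg(1)] Bij[OF fg(2)]] fD gD XD
      by (auto simp: compose_def Bij_def)
    thus "f \<otimes>\<^bsub>?B\<^esub> g \<in> carrier (unitary S X)" using Bij[OF fg(1)] Bij[OF fg(2)] by (simp add: BijGroup_def)
  qed
  from group.subgroup_imp_group[OF group_BijGroup this]
  show ?thesis by (simp add: unitary_def)
qed

section \<open>Extension of isometries from W to V and transport of Witt bases\<close>

lemma linear_eD_decomp: "x - h x e *s e \<in> W"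
  by (simp add: W_iff)

lemma G_V_D:
  assumes "g \<in> carrier (G_V S)"
  shows "g (x + y) = g x + g y" "g (c *s x) = c *s g x" "h (g x) (g y) = h x y" "bij g"
    "g (x - y) = g x - g y"
proof -
  show *: "g (x + y) = g x + g y" "g (c *s x) = c *s g x" "h (g x) (g y) = h x y" "bij g" for x y c
    using unitaryD[OF assms] by auto
  show "g (x - y) = g x - g y" using *(1)[of "x - y" y] by simp
qed

lemma extend_W: "x \<in> W \<Longrightarrow> extend S g x = g x"
  by (simp add: extend_def W_iff)

lemma G_W_zero: "g \<in> carrier (G_W S) \<Longrightarrow> g 0 = 0"
  using unitaryD(4)[of g W 0 0] W_closed(1) by simp

lemma extend_e: "g \<in> carrier (G_W S) \<Longrightarrow> extend S g e = e"
  by (simp add: extend_def G_W_zero)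

lemma extend_unitary:
  assumes g: "g \<in> carrier (G_W S)" shows "extend S g \<in> carrier (G_V S)"
proof -
  note gD = unitaryD[OF g]
  let ?p = "\<lambda>x. x - h x e *s e"
  have ex: "extend S g x = g (?p x) + h x e *s e" for x by (simp add: extend_def Let_def)
  have gW: "g x \<in> W" "h (g x) e = 0" "h e (g x) = 0" if "x \<in> W" for x
    using gD(6)[OF that] h_sym[of e "g x"] by (auto simp: W_iff)
  have pW: "?p x \<in> W" for x by (rule linear_eD_decomp)
  have exe: "h (extend S g x) e = h x e" for x using gW[OF pW] by (simp add: ex)
  have "inj (extend S g)"
  proof (rule injI)
    fix x y assume eq: "extend S g x = extend S g y"
    hence he: "h x e = h y e" using exe by metis
    hence "g (?p x) = g (?p y)" using eq by (simp add: ex)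
    hence "?p x = ?p y" using inj_onD[OF bij_betw_imp_inj_on[OF gD(2)]] pW by blast
    thus "x = y" using he by simp
  qed
  moreover have "y \<in> range (extend S g)" for y
  proof -
    obtain x where x: "x \<in> W" "g x = ?p y" using gD(7) pW[of y] by (metis imageE)
    have "extend S g (x + h y e *s e) = g x + h y e *s e"
      using x(1) by (simp add: ex W_iff)
    also have "\<dots> = y" using x by simp
    finally show ?thesis by (metis rangeI)
  qed
  ultimately have "bij (extend S g)" by (auto simp: bij_def)
  moreover have "extend S g (x + y) = extend S g x + extend S g y" for x y
  proof -
    have "?p (x + y) = ?p x + ?p y" by (simp add: vec.scale_left_distrib)
    hence "g (?p (x + y)) = g (?p x) + g (?p y)" using gD(3)[OF pW pW] by metis
    thus ?thesis by (simp add: ex vec.scale_left_distrib)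
  qed
  moreover have "extend S g (c *s x) = c *s extend S g x" for c x
  proof -
    have "?p (c *s x) = c *s ?p x" by (simp add: vec.scale_right_diff_distrib)
    hence "g (?p (c *s x)) = c *s g (?p x)" using gD(4)[OF pW] by metis
    thus ?thesis by (simp add: ex vec.scale_right_distrib)
  qed
  moreover have "h (extend S g x) (extend S g y) = h x y" for x y
  proof -
    have "h (g (?p x)) (g (?p y)) = h (?p x) (?p y)" using gD(5)[OF pW pW] .
    hence "h (extend S g x) (extend S g y) = h (?p x) (?p y) + h x e * cj (h y e)"
      using gW[OF pW[of x]] gW[OF pW[of y]] by (simp only: ex h_add_left h_add_right h_scale_left h_scale_right e_norm) simp
    also have "\<dots> = h x y" by (simp add: h_sym[of e y] algebra_simps)
    finally show ?thesis .
  qed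
  ultimately show ?thesis by (simp add: unitary_iff)
qed

lemma restrict_unitary:
  assumes T: "T \<in> carrier (G_V S)" "T e = e" shows "restrict T W \<in> carrier (G_W S)"
proof -
  note D = G_V_D[OF T(1)]
  have iff: "T x \<in> W \<longleftrightarrow> x \<in> W" for x using D(3)[of x e] T(2) by (simp add: W_iff)
  have "bij_betw T W W"
  proof (rule bij_betw_imageI)
    show "inj_on T W" using D(4) by (meson bij_is_inj inj_on_subset subset_UNIV)
    show "T ` W = W" using iff D(4) by (auto simp: image_iff) (metis bij_pointE)
  qed
  thus ?thesis using D W_closed by (simp add: unitary_iff)
qed

lemma witt_map:
  assumes pq: "witt p r q" and pq': "witt p' r' q'"
  obtains T where "T \<in> carrier (G_V S)" "T p = p'" "T r = r'" "T q = q'"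
proof -
  define M :: "'k ^ 3 \<Rightarrow> 'k ^ 3 \<Rightarrow> 'k ^ 3 \<Rightarrow> 'k ^ 3 \<Rightarrow> 'k ^ 3 \<Rightarrow> 'k ^ 3 \<Rightarrow> 'k ^ 3 \<Rightarrow> 'k ^ 3"
    where "M p r q p' r' q' x = h x q *s p' + h x p *s q' + h x r *s r'" for p r q p' r' q' x
  have inv: "M p' r' q' p r q (M p r q p' r' q' x) = x" if "witt p r q" "witt p' r' q'" for p r q p' r' q' x
    using witt_expand[OF that(1), of x] by (simp add: M_def wittD[OF that(2)])
  let ?T = "M p r q p' r' q'"
  have "bij ?T" by (rule o_bij[of "M p' r' q' p r q"]) (auto simp: inv pq pq')
  moreover have "h (?T x) (?T y) = h x y" for x y
  proof -
    have "h x y = h x (h y q *s p + h y p *s q + h y r *s r)" using witt_expand[OF pq, of y] by simp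
    also have "\<dots> = h (?T x) (?T y)" by (simp add: M_def wittD[OF pq'] algebra_simps)
    finally show ?thesis ..
  qed
  moreover have "?T (x + y) = ?T x + ?T y" "?T (c *s x) = c *s ?T x" for x y c
    by (simp_all add: M_def vec.scale_left_distrib vec.scale_right_distrib)
  ultimately have "?T \<in> carrier (G_V S)" by (simp add: unitary_iff)
  moreover have "?T p = p'" "?T r = r'" "?T q = q'" by (simp_all add: M_def wittD[OF pq])
  ultimately show thesis using that by blast
qed

lemma image_wlat:
  assumes "T \<in> carrier (G_V S)" shows "T ` wlat p r q = wlat (T p) (T r) (T q)"
proof (intro equalityI subsetI)
  fix y assume y: "y \<in> wlat (T p) (T r) (T q)"
  obtain x where x: "y = T x" using G_V_D(4)[OF assms] by (meson bij_pointE)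
  thus "y \<in> T ` wlat p r q" using y by (simp add: wlat_def G_V_D(3)[OF assms])
qed (auto simp: wlat_def G_V_D(3)[OF assms])

lemma image_lat:
  assumes "T \<in> carrier (G_V S)" "T e = e"
  shows "T ` lat_V w z a = lat_V (T w) (T z) a" "T ` lat_W w z b = lat_W (T w) (T z) b"
  unfolding lat_V_def lat_W_def image_wlat[OF assms(1)]
  by (simp_all only: G_V_D(1,2,5)[OF assms(1)] assms(2))

text \<open>Lets the action on lattices of W be computed with \<open>image_lat\<close> on lattices
  of V.\<close>

lemma image_Int_W:
  assumes g: "g \<in> carrier (G_W S)"
  shows "g ` (X \<inter> W) = extend S g ` X \<inter> W"
proof -
  note D = G_V_D[OF extend_unitary[OF g]]
  have iff: "extend S g x \<in> W \<longleftrightarrow> x \<in> W" for x using D(3)[of x e] extend_e[OF g] by (simp add: W_iff)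
  have "g ` (X \<inter> W) = extend S g ` (X \<inter> W)" by (intro image_cong) (auto simp: extend_W)
  also have "\<dots> = extend S g ` X \<inter> W" using iff by auto
  finally show ?thesis .
qed

section \<open>Classification of the orbits of H on pairs\<close>

definition std_pair :: "'k ^ 3 \<Rightarrow> 'k ^ 3 \<Rightarrow> nat \<Rightarrow> nat \<Rightarrow> ('k ^ 3) set \<times> ('k ^ 3) set" where
  "std_pair w z a b = (lat_V w z a, lat_W w z b \<inter> W)"

lemma lat_W_Int_W:
  assumes "frame w z"
  shows "self_dual S W (lat_W w z b \<inter> W)" "add_eD S (lat_W w z b \<inter> W) = lat_W w z b"
  using lattice_in_W[OF frame_witt(2)[OF assms, of b] refl] by (auto simp: lat_W_def self_dual_def)

lemma std_pair_in: "frame w z \<Longrightarrow> std_pair w z a b \<in> lattice_pairs S"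
  by (simp add: std_pair_def lattice_pairs_def lat_W_Int_W self_dual_lat)

lemma lattice_pair_std:
  assumes "P \<in> lattice_pairs S"
  obtains w z a b where "frame w z" "P = std_pair w z a b"
proof -
  obtain L N where P: "P = (L, N)" "self_dual S UNIV L" "self_dual S W N"
    using assms by (auto simp: lattice_pairs_def)
  note N = self_dual_add_eD[OF P(3)]
  obtain w z a b where "frame w z" "L = lat_V w z a" "add_eD S N = lat_W w z b"
    using normal_form[OF P(2) N(1,2)] by blast
  thus ?thesis using that P(1) N(3) by (auto simp: std_pair_def)
qed

lemma inv_tau_std_pair: "frame w z \<Longrightarrow> inv_tau S (std_pair w z a b) = (real a, real b)"
  unfolding std_pair_def by (intro inv_tau_normal_form lat_W_Int_W)

lemma act_std_pair:
  assumes "g \<in> carrier (G_W S)" "frame w z"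
  shows "act (extend S g, g) (std_pair w z a b) = std_pair (g w) (g z) a b"
proof -
  note T = extend_unitary[OF assms(1)] extend_e[OF assms(1)]
  have "w \<in> W" "z \<in> W" using assms(2) by (auto simp: frame_def W_iff)
  thus ?thesis using image_lat[OF T] by (simp add: act_def std_pair_def image_Int_W[OF assms(1)] extend_W)
qed

lemma frame_image:
  assumes "g \<in> carrier (G_W S)" "frame w z" shows "frame (g w) (g z)"
proof -
  have "w \<in> W" "z \<in> W" using assms(2) by (auto simp: frame_def W_iff)
  thus ?thesis using unitaryD(5,6)[OF assms(1)] assms(2) by (auto simp: frame_def W_iff)
qed

text \<open>The Witt basis (z + w, e, (z - w)/2) is carried to its counterpart. Keeping the middle
  vector e fixed is what lets the isometry restrict to W.\<close>

lemma frame_map: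
  assumes "frame w z" "frame w' z'"
  obtains g where "g \<in> carrier (G_W S)" "g w = w'" "g z = z'"
proof -
  have 1: "witt (z + w) e ((1 / 2) *s (z - w))" if "frame w z" for w z using frame_witt(2)[OF that, of 0] by simp
  obtain T where T: "T \<in> carrier (G_V S)" "T (z + w) = z' + w'" "T e = e" "T ((1 / 2) *s (z - w)) = (1 / 2) *s (z' - w')"
    using witt_map[OF 1[OF assms(1)] 1[OF assms(2)]] by blast
  note D = G_V_D[OF T(1)]
  have zw: "(1 / 2) *s (z + w) + (1 / 2) *s (z - w) = z" "(1 / 2) *s (z + w) - (1 / 2) *s (z - w) = w" for z w :: "'k ^ 3"
    by (simp_all add: vec_eq_iff field_simps)
  have "T z = (1 / 2) *s T (z + w) + T ((1 / 2) *s (z - w))" by (metis zw(1) D(1,2))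
  hence Tz: "T z = z'" using T zw by simp
  have "T w = (1 / 2) *s T (z + w) - T ((1 / 2) *s (z - w))" by (metis zw(2) D(5,2))
  hence Tw: "T w = w'" using T zw by simp
  have "w \<in> W" "z \<in> W" using assms(1) by (auto simp: frame_def W_iff)
  thus ?thesis using that[OF restrict_unitary[OF T(1,3)]] Tz Tw by simp
qed

lemma frame_ex: obtains w z where "frame w z"
proof -
  obtain p q where pq: "witt p e q" using witt_exists by blast
  have "frame ((1 / 2) *s p - q) ((1 / 2) *s p + q)" by (simp add: frame_def wittD[OF pq])
  thus ?thesis using that by blast
qed

lemma carrier_H: "carrier (H_tau S) = (\<lambda>g. (extend S g, g)) ` carrier (G_W S)"
  by (simp add: H_tau_def)

lemma orbit_H:
  assumes "frame w z"
  shows "orbit (H_tau S) act (std_pair w z a b) = {std_pair w' z' a b | w' z'. frame w' z'}"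
proof (intro equalityI subsetI)
  fix P assume "P \<in> orbit (H_tau S) act (std_pair w z a b)"
  then obtain g where "g \<in> carrier (G_W S)" "P = act (extend S g, g) (std_pair w z a b)"
    by (auto simp: orbit_def carrier_H)
  thus "P \<in> {std_pair w' z' a b | w' z'. frame w' z'}"
    using act_std_pair[OF _ assms] frame_image[OF _ assms] by blast
next
  fix P assume "P \<in> {std_pair w' z' a b | w' z'. frame w' z'}"
  then obtain w' z' where P: "frame w' z'" "P = std_pair w' z' a b" by blast
  obtain g where g: "g \<in> carrier (G_W S)" "g w = w'" "g z = z'" using frame_map[OF assms P(1)] by blast
  have "P = act (extend S g, g) (std_pair w z a b)" using act_std_pair[OF g(1) assms] g P by simp
  thus "P \<in> orbit (H_tau S) act (std_pair w z a b)" using g(1) by (auto simp: orbit_def carrier_H)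
qed

text \<open>By \<open>normal_form\<close> and \<open>orbit_H\<close> the orbits are the sets
  \<open>Q a b\<close>. They are told apart by \<open>inv_tau\<close> itself, whose constant value
  on \<open>Q a b\<close> is (a, b).\<close>

theorem induces_bij_orbits_H: "induces_bij (inv_tau S) (orbits (H_tau S) (lattice_pairs S) act) Inv_tau"
proof -
  define Q where "Q a b = {std_pair w z a b | w z. frame w z}" for a b
  obtain w0 z0 where fr: "frame w0 z0" by (rule frame_ex)
  have im: "inv_tau S ` Q a b = {(real a, real b)}" for a b
  proof -
    have "inv_tau S ` Q a b = (\<lambda>_. (real a, real b)) ` Q a b"
      by (rule image_cong) (auto simp: Q_def inv_tau_std_pair)
    moreover have "Q a b \<noteq> {}" using fr unfolding Q_def by blast
    ultimately show ?thesis by (simp add: image_constant_conv)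
  qed
  have "orbits (H_tau S) (lattice_pairs S) act = {Q a b | a b. True}"
  proof (intro equalityI subsetI)
    fix C assume "C \<in> orbits (H_tau S) (lattice_pairs S) act"
    then obtain P where "P \<in> lattice_pairs S" "C = orbit (H_tau S) act P" by (auto simp: orbits_def)
    moreover from this obtain w z a b where "frame w z" "P = std_pair w z a b" using lattice_pair_std by blast
    ultimately have "C = Q a b" using orbit_H unfolding Q_def by simp
    thus "C \<in> {Q a b | a b. True}" by blast
  next
    fix C assume "C \<in> {Q a b | a b. True}"
    then obtain a b where "C = Q a b" by blast
    thus "C \<in> orbits (H_tau S) (lattice_pairs S) act"
      using orbit_H[OF fr] std_pair_in[OF fr] unfolding Q_def orbits_def by blast
  qed
  moreover have "bij_betw (\<lambda>C. the_elem (inv_tau S ` C)) {Q a b | a b. True} Inv_tau"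
  proof (rule bij_betw_imageI)
    have "(\<lambda>C. the_elem (inv_tau S ` C)) ` {Q a b | a b. True} = {the_elem (inv_tau S ` Q a b) | a b. True}"
      by blast
    thus "(\<lambda>C. the_elem (inv_tau S ` C)) ` {Q a b | a b. True} = Inv_tau" by (simp add: im Inv_tau_def)
  qed (auto simp: inj_on_def im)
  ultimately show ?thesis unfolding induces_bij_def using im by auto
qed

section \<open>The action of \<open>G\<^sub>\<tau>\<close>\<close>

lemma group_G: "group (G_tau S)"
  by (intro DirProd_group group_unitary subspace_W vec.subspace_UNIV)

lemma act_in_pairs:
  assumes g: "g \<in> carrier (G_tau S)" and P: "P \<in> lattice_pairs S"
  shows "act g P \<in> lattice_pairs S"
proof -
  obtain T k where T: "g = (T, k)" "T \<in> carrier (G_V S)" "k \<in> carrier (G_W S)" using g by auto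
  obtain w z a b where fr: "frame w z" and P': "P = std_pair w z a b" using lattice_pair_std[OF P] by blast
  have "self_dual S UNIV (wlat (T p) (T r) (T q))" if "witt p r q" for p r q
    using that by (intro self_dual_wlat) (simp add: witt_def G_V_D[OF T(2)])
  hence "self_dual S UNIV (T ` lat_V w z a)"
    unfolding lat_V_def image_wlat[OF T(2)] using frame_witt(1)[OF fr] by blast
  moreover have "k ` (lat_W w z b \<inter> W) = lat_W (k w) (k z) b \<inter> W"
    using act_std_pair[OF T(3) fr, of 0 b] by (simp add: act_def std_pair_def)
  hence "self_dual S W (k ` (lat_W w z b \<inter> W))" using lat_W_Int_W(1)[OF frame_image[OF T(3) fr]] by simp
  ultimately show ?thesis by (simp add: act_def T P' std_pair_def lattice_pairs_def)
qed

lemma pair_subset_W: "P \<in> lattice_pairs S \<Longrightarrow> snd P \<subseteq> W"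
  by (auto simp: lattice_pairs_def self_dual_def dual_in_def)

lemma act_G: "set_action (G_tau S) (lattice_pairs S) act"
proof (intro set_action.intro set_action_axioms.intro group_G)
  fix g k P assume gk: "g \<in> carrier (G_tau S)" "k \<in> carrier (G_tau S)" and P: "P \<in> lattice_pairs S"
  show "act (g \<otimes>\<^bsub>G_tau S\<^esub> k) P = act g (act k P)"
    using gk pair_subset_W[OF P]
    by (cases g; cases k) (auto simp: act_def mult_unitary image_image compose_def intro!: image_cong)
next
  fix P assume "P \<in> lattice_pairs S"
  from pair_subset_W[OF this] show "act \<one>\<^bsub>G_tau S\<^esub> P = P"
    by (cases P) (auto simp: act_def one_unitary)
qed (rule act_in_pairs)

text \<open>The two factors of G move the two lattices independently. On the second, the isometry of
  V is chosen to fix e, so it is the extension of one of W.\<close>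

lemma orbit_G:
  assumes P: "P \<in> lattice_pairs S" shows "orbit (G_tau S) act P = lattice_pairs S"
proof (intro equalityI subsetI)
  fix Q assume "Q \<in> orbit (G_tau S) act P"
  thus "Q \<in> lattice_pairs S" using act_in_pairs[OF _ P] unfolding orbit_def by blast
next
  fix Q assume "Q \<in> lattice_pairs S"
  obtain w z a b where fr: "frame w z" and P': "P = std_pair w z a b" using lattice_pair_std[OF P] by blast
  obtain w' z' a' b' where fr': "frame w' z'" and Q': "Q = std_pair w' z' a' b'"
    using lattice_pair_std[OF \<open>Q \<in> lattice_pairs S\<close>] by blast
  obtain T where T: "T \<in> carrier (G_V S)" "T ` lat_V w z a = lat_V w' z' a'"
    using witt_map[OF frame_witt(1)[OF fr, of a] frame_witt(1)[OF fr', of a']]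
    by (metis image_wlat lat_V_def)
  obtain R where R: "R \<in> carrier (G_V S)" "R e = e" "R ` lat_W w z b = lat_W w' z' b'"
    using witt_map[OF frame_witt(2)[OF fr, of b] frame_witt(2)[OF fr', of b']]
    by (metis image_wlat lat_W_def)
  note g = restrict_unitary[OF R(1,2)]
  have "extend S (restrict R W) x = R x" for x
    using G_V_D(1,2,5)[OF R(1)] R(2) linear_eD_decomp[of x] by (simp add: extend_def Let_def)
  hence "extend S (restrict R W) = R" by blast
  hence "restrict R W ` (lat_W w z b \<inter> W) = lat_W w' z' b' \<inter> W"
    using image_Int_W[OF g] R(3) by simp
  hence "Q = act (T, restrict R W) P" using T(2) by (simp add: act_def P' Q' std_pair_def)
  thus "Q \<in> orbit (G_tau S) act P" using T(1) g by (auto simp: orbit_def)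
qed

section \<open>The units of \<open>O\<^sub>c\<close>\<close>

lemma order_c_mem:
  assumes "cj a = a" "v a \<le> 1" "v (x - a) \<le> v \<pi> ^ c" shows "x \<in> order_c S c"
proof -
  have "x = a + \<pi> ^ c * ((x - a) / \<pi> ^ c)" by simp
  moreover have "v ((x - a) / \<pi> ^ c) \<le> 1" using assms(3) v_pi_power_pos[of c] by (simp add: divide_le_eq)
  ultimately show ?thesis using assms(1,2) unfolding order_c_def F_iff by blast
qed

text \<open>In cj x - x the summand from F cancels and only a multiple of \<pi>^c remains.\<close>

lemma order_cD:
  assumes "x \<in> order_c S c" shows "v x \<le> 1" "v (cj x - x) \<le> v \<pi> ^ c"
proof -
  obtain a b where x: "x = a + \<pi> ^ c * b" "cj a = a" "v a \<le> 1" "v b \<le> 1"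
    using assms by (auto simp: order_c_def F_iff)
  show "v x \<le> 1" unfolding x(1) using x v_pi_power_le[of c] by (intro v_add_le v_mult_le) auto
  have "cj x - x = \<pi> ^ c * (cj b - b)" using x by (simp add: algebra_simps)
  moreover have "v (cj b - b) \<le> 1" using x by (intro v_diff_le) auto
  ultimately show "v (cj x - x) \<le> v \<pi> ^ c" by (simp add: mult_left_le)
qed

lemma v_norm_one: assumes "x * cj x = 1" shows "v x = 1"
proof -
  have "v x * v x = 1" using arg_cong[OF assms, of v] by simp
  thus ?thesis by (metis abs_of_nonneg real_sqrt_abs2 real_sqrt_one v_ge_0)
qed

lemma order_c_0: "order_c S 0 = {x. v x \<le> 1}"
  using order_cD(1)[of _ 0] order_c_mem[of 0 _ 0] by auto

text \<open>Hilbert's Theorem 90: \<open>s = 1 + \<lambda>\<^sup>-\<^sup>1\<close> satisfies \<open>r(s) = \<lambda>\<close>, and it is a unit of \<open>O\<^sub>c\<close> if \<open>\<lambda> \<equiv> 1\<close> modulo \<open>\<varpi>\<^sup>c\<close> with \<open>c > 0\<close>.\<close>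

lemma r_tau_units:
  "r_tau S ` order_c_units S c = {x. x * cj x = 1 \<and> v (x - 1) \<le> v \<pi> ^ c}"
proof (intro equalityI subsetI)
  fix x assume "x \<in> r_tau S ` order_c_units S c"
  then obtain s t where st: "s \<in> order_c S c" "t \<in> order_c S c" "s * t = 1" "x = cj s / s"
    by (auto simp: order_c_units_def r_tau_def)
  have "v s \<le> 1" "v t \<le> 1" "v s * v t = 1"
    using order_cD(1)[OF st(1)] order_cD(1)[OF st(2)] arg_cong[OF st(3), of v] by simp_all
  hence vs: "v s = 1" by (metis antisym mult_left_le v_ge_0)
  hence s0: "s \<noteq> 0" by auto
  hence "x - 1 = (cj s - s) / s" using st by (simp add: diff_divide_distrib)
  thus "x \<in> {x. x * cj x = 1 \<and> v (x - 1) \<le> v \<pi> ^ c}"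
    using s0 st(4) vs order_cD(2)[OF st(1)] by simp
next
  fix x assume "x \<in> {x. x * cj x = 1 \<and> v (x - 1) \<le> v \<pi> ^ c}"
  hence x: "x * cj x = 1" "v (x - 1) \<le> v \<pi> ^ c" by auto
  have r: "cj (1 + cj x) = x * (1 + cj x)" using x by (simp add: algebra_simps)
  show "x \<in> r_tau S ` order_c_units S c"
  proof (cases "c = 0")
    \<comment> \<open>Every unit is allowed in O_0, so a unit s with cj s = x s suffices. If 1 + cj
      x is zero, \<delta> serves; otherwise 1 + cj x is rescaled by an element of F.\<close>
    case True
    have unit: "x \<in> r_tau S ` order_c_units S c" if s: "v s = 1" "cj s = x * s" for s
    proof -
      have "s \<noteq> 0" using s(1) by auto
      have "s \<in> order_c_units S c" using s(1) \<open>s \<noteq> 0\<close> unfolding True order_c_units_def order_c_0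
        by (auto intro!: bexI[of _ "inverse s"] exI[of _ "inverse s"])
      moreover have "x = r_tau S s" using s(2) \<open>s \<noteq> 0\<close> by (simp add: r_tau_def)
      ultimately show ?thesis by blast
    qed
    show ?thesis
    proof (cases "1 + cj x = 0")
      case True
      hence "cj x = -1" by (simp add: add_eq_0_iff)
      hence "x = -1" by (metis cj_cj cj_minus cj_1)
      thus ?thesis using anti_unit unit by auto
    next
      case False
      obtain y where y: "cj y = y" "v y = v (1 + cj x)" using F_value by blast
      have "v ((1 + cj x) / y) = 1" using y False by (simp only: v_divide y(2)) simp
      moreover have "cj ((1 + cj x) / y) = x * ((1 + cj x) / y)"
        unfolding cj_divide r y(1) by simp
      ultimately show ?thesis by (rule unit)
    qed
  next
    case False
    define s where "s = 1 + cj x"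
    have "s - 2 = cj (x - 1)" by (simp add: s_def)
    hence s2: "v (s - 2) \<le> v \<pi> ^ c" using x(2) by (simp only: v_cj)
    also have "v \<pi> ^ c < 1" using False v_pi_less v_pi_pos by (simp add: power_less_one_iff)
    finally have vs: "v s = 1" using v_add_eq_max[of "s - 2" 2] by simp
    hence s0: "s \<noteq> 0" by auto
    have s: "s \<in> order_c S c" using s2 by (intro order_c_mem[of 2]) auto
    \<comment> \<open>s is congruent to 2 modulo \<pi>^c, so its inverse is approximated by 1/2, an
      element of F.\<close>
    have "inverse s - 1 / 2 = - ((s - 2) / (2 * s))" using s0 by (simp add: field_simps)
    hence "v (inverse s - 1 / 2) \<le> v \<pi> ^ c" using s2 vs by (simp only: v_minus v_divide v_mult v_2)
    hence "inverse s \<in> order_c S c" by (intro order_c_mem[of "1 / 2"]) auto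
    hence "s \<in> order_c_units S c" using s s0 by (auto simp: order_c_units_def intro!: bexI[of _ "inverse s"])
    moreover have "x = r_tau S s" using r s0 by (simp add: r_tau_def s_def)
    ultimately show ?thesis by blast
  qed
qed

text \<open>Makes the \<open>THE\<close> in \<open>local_conductor\<close> well defined. For s = 1 +
  \<pi>^c \<delta> the difference r(s) - 1 has absolute value exactly \<open>v \<pi> ^ c\<close>, so
  the groups for different exponents differ.\<close>

lemma conductor_unique:
  assumes "r_tau S ` order_c_units S c = r_tau S ` order_c_units S d" shows "c = d"
proof -
  have le: "d \<le> c" if sub: "r_tau S ` order_c_units S c \<subseteq> r_tau S ` order_c_units S d" for c d
  proof -
    obtain \<delta> where \<delta>: "cj \<delta> = - \<delta>" "v \<delta> = 1" using anti_unit by blast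
    define s where "s = 1 + \<pi> ^ c * \<delta>"
    have cs: "cj s = 1 - \<pi> ^ c * \<delta>" by (simp add: s_def \<delta>)
    \<comment> \<open>The half trace of s is 1. This bounds v s from below also for c = 0, where s
      need not be a principal unit.\<close>
    have "v ((s + cj s) / 2) \<le> v s" by (rule half_sum_le) simp
    hence "1 \<le> v s" by (simp add: s_def \<delta>)
    moreover have "v s \<le> 1" unfolding s_def using \<delta> v_pi_power_le[of c] by (intro v_add_le) auto
    ultimately have vs: "v s = 1" by simp
    hence s0: "s \<noteq> 0" by auto
    define x where "x = cj s / s"
    have "x - 1 = (cj s - s) / s" using s0 by (simp add: x_def diff_divide_distrib)
    also have "cj s - s = - (2 * (\<pi> ^ c * \<delta>))" by (simp add: cs s_def \<delta>)
    finally have "x - 1 = - (2 * (\<pi> ^ c * \<delta>)) / s" .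
    hence vx: "v (x - 1) = v \<pi> ^ c" using vs \<delta> by (simp only: v_divide v_minus v_mult v_2 v_power)
    have "x * cj x = 1" using s0 by (simp add: x_def)
    hence "x \<in> r_tau S ` order_c_units S c" using vx by (simp add: r_tau_units)
    hence "x \<in> r_tau S ` order_c_units S d" using sub by blast
    hence "v \<pi> ^ c \<le> v \<pi> ^ d" using vx by (simp add: r_tau_units)
    thus ?thesis by (simp add: v_pi_power_le_iff)
  qed
  show ?thesis using le[of c d] le[of d c] assms by simp
qed

section \<open>Stabilizers\<close>

text \<open>In the basis w, z, e the extension is block diagonal with last entry 1. The base change
  B cancels in the determinant; it is invertible because pairing with w, z, e recovers coordinates
  up to sign.\<close>

lemma det_extend:
  assumes g: "g \<in> carrier (G_W S)" and fr: "frame w z"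
    and gw: "g w = p *s w + q *s z" and gz: "g z = r *s w + s *s z"
  shows "det_H (extend S g, g) = p * s - q * r"
proof -
  define T where "T = extend S g"
  note D = G_V_D[OF extend_unitary[OF g], folded T_def]
  have wzW: "w \<in> W" "z \<in> W" using fr by (auto simp: frame_def W_iff)
  have T: "T w = p *s w + q *s z" "T z = r *s w + s *s z" "T e = e"
    using gw gz wzW extend_e[OF g] by (simp_all add: T_def extend_W)
  have lin: "Vector_Spaces.linear (*s) (*s) T" by unfold_locales (simp_all add: D)
  define B :: "'k ^ 3 ^ 3" where "B = (\<chi> i j. if j = 1 then w $ i else if j = 2 then z $ i else e $ i)"
  define A :: "'k ^ 3 ^ 3" where "A = vector [vector [p, r, 0], vector [q, s, 0], vector [0, 0, 1]]"
  have B: "B *v c = c $ 1 *s w + c $ 2 *s z + c $ 3 *s e" for c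
    by (simp add: vec_eq_iff matrix_vector_mult_def sum_3 B_def mult.commute)
  have "matrix T *v (B *v c) = B *v (A *v c)" for c
  proof -
    have "matrix T *v (B *v c) = T (B *v c)" by (rule matrix_works[OF lin])
    also have "\<dots> = c $ 1 *s (p *s w + q *s z) + c $ 2 *s (r *s w + s *s z) + c $ 3 *s e"
      by (simp only: B D T)
    also have "\<dots> = B *v (A *v c)"
      by (simp only: B) (simp add: matrix_vector_mult_def sum_3 A_def vec_eq_iff algebra_simps)
    finally show ?thesis .
  qed
  hence "matrix T ** B = B ** A" by (simp add: matrix_eq matrix_vector_mul_assoc)
  hence "det (matrix T) * det B = det B * det A" by (metis det_mul)
  moreover have "det B \<noteq> 0"
  proof -
    have "c = 0" if "B *v c = 0" for c
    proof -
      have "h (B *v c) w = - c $ 1" "h (B *v c) z = c $ 2" "h (B *v c) e = c $ 3"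
        by (simp_all add: B frameD[OF fr])
      thus ?thesis using that by (simp add: vec_eq_iff forall_3)
    qed
    hence "invertible B" by (simp add: invertible_left_inverse matrix_left_invertible_ker)
    thus ?thesis by (simp add: invertible_det_nz)
  qed
  moreover have "det A = p * s - q * r" by (simp add: det_3 A_def)
  ultimately show ?thesis by (simp add: det_H_def T_def)
qed

text \<open>Denominators are cleared with the scalar kept apart, since the vectors to be tested are
  scalar multiples of e + w' and e - w'.\<close>

lemma lat_V_mem:
  "c *s x \<in> lat_V w z a \<longleftrightarrow> v c * (v \<pi> ^ a * v (h x e + h x w)) \<le> 1 \<and>
     v c * v (h x e - h x w) \<le> v \<pi> ^ a \<and> v c * v (h x z) \<le> 1"
proof -
  have "h (c *s x) ((\<pi> ^ a / 2) *s (e + w)) = c * (\<pi> ^ a * (h x e + h x w)) / 2"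
    "h (c *s x) (inverse (\<pi> ^ a) *s (e - w)) = c * (h x e - h x w) / \<pi> ^ a"
    by (simp_all add: field_simps)
  thus ?thesis unfolding lat_V_def wlat_def mem_Collect_eq using v_pi_power_pos[of a]
    by (simp only: v_mult v_divide v_power v_2 h_scale_left) (simp add: divide_le_eq)
qed

lemma lat_W_mem:
  "c *s x \<in> lat_W w z b \<longleftrightarrow> v c * v (h x z + h x w) \<le> v \<pi> ^ b \<and>
     v c * (v \<pi> ^ b * v (h x z - h x w)) \<le> 1 \<and> v c * v (h x e) \<le> 1"
proof -
  have "h (c *s x) (inverse (\<pi> ^ b) *s (z + w)) = c * (h x z + h x w) / \<pi> ^ b"
    "h (c *s x) ((\<pi> ^ b / 2) *s (z - w)) = c * (\<pi> ^ b * (h x z - h x w)) / 2"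
    by (simp_all add: field_simps)
  thus ?thesis unfolding lat_W_def wlat_def mem_Collect_eq using v_pi_power_pos[of b]
    by (simp only: v_mult v_divide v_power v_2 h_scale_left) (simp add: divide_le_eq)
qed

text \<open>Equality is tested on the hyperbolic pair, so z' does not enter. Pairing \<pi>^(-a) (e -
  w') with \<pi>^(-a) (e - w) has denominator \<pi>^(2a) and constrains p; pairing it with z has
  denominator \<pi>^a and constrains q.\<close>

lemma lat_V_eq_iff:
  assumes fr: "frame w z" and fr': "frame w' z'" and w': "w' = p *s w + q *s z"
  shows "lat_V w' z' a = lat_V w z a \<longleftrightarrow> v (p - 1) \<le> v \<pi> ^ (2 * a) \<and> v q \<le> v \<pi> ^ a"
proof -
  let ?L = "lat_V w z a"
  have pw: "v \<pi> ^ (2 * a) = v \<pi> ^ a * v \<pi> ^ a" by (simp add: mult_2 power_add)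
  note pos = v_pi_power_pos[of a]
  have le: "v \<pi> ^ (2 * a) \<le> 1" "v \<pi> ^ a \<le> 1" by (rule v_pi_power_le)+
  have p1: "v (1 - p) = v (p - 1)" by (metis minus_diff_eq v_minus)
  have hx: "h (e + w') e = 1" "h (e + w') w = - p" "h (e + w') z = q"
    "h (e - w') e = 1" "h (e - w') w = p" "h (e - w') z = - q"
    by (simp_all add: w' frameD[OF fr])
  have mem1: "(\<pi> ^ a / 2) *s (e + w') \<in> ?L \<longleftrightarrow>
      v \<pi> ^ a * (v \<pi> ^ a * v (1 - p)) \<le> 1 \<and> v (1 + p) \<le> 1 \<and> v \<pi> ^ a * v q \<le> 1"
    using pos unfolding lat_V_mem hx by (simp add: mult_le_cancel_left1)
  have mem2: "inverse (\<pi> ^ a) *s (e - w') \<in> ?L \<longleftrightarrow>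
      v (1 + p) \<le> 1 \<and> v (1 - p) \<le> v \<pi> ^ (2 * a) \<and> v q \<le> v \<pi> ^ a"
    using pos unfolding lat_V_mem hx pw by (simp add: field_simps)
  have "lat_V w' z' a = ?L \<longleftrightarrow> (\<pi> ^ a / 2) *s (e + w') \<in> ?L \<and> inverse (\<pi> ^ a) *s (e - w') \<in> ?L"
    using self_dual_eq_wlat[OF self_dual_lat(1)[OF fr] frame_witt(1)[OF fr']] wlat_gens[OF frame_witt(1)[OF fr', of a]]
    by (auto simp: lat_V_def)
  also have "\<dots> \<longleftrightarrow> v (p - 1) \<le> v \<pi> ^ (2 * a) \<and> v q \<le> v \<pi> ^ a"
  proof
    assume R: "v (p - 1) \<le> v \<pi> ^ (2 * a) \<and> v q \<le> v \<pi> ^ a"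
    hence "v (p - 1) \<le> 1" "v q \<le> 1" using le by auto
    moreover from this have "v (1 + p) \<le> 1" using v_add_le[of "p - 1" 1 2] by (simp add: add.commute)
    ultimately show "(\<pi> ^ a / 2) *s (e + w') \<in> ?L \<and> inverse (\<pi> ^ a) *s (e - w') \<in> ?L"
      unfolding mem1 mem2 using R le by (simp add: p1 mult_le_one)
  next
    assume "(\<pi> ^ a / 2) *s (e + w') \<in> ?L \<and> inverse (\<pi> ^ a) *s (e - w') \<in> ?L"
    thus "v (p - 1) \<le> v \<pi> ^ (2 * a) \<and> v q \<le> v \<pi> ^ a" unfolding mem1 mem2 p1 by blast
  qed
  finally show ?thesis .
qed

text \<open>For integral coefficients only the pairing of \<pi>^(-b) (z' + w') with \<pi>^(-b) (z +
  w) can fail to be integral; its numerator is s + q - r - p.\<close>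

lemma lat_W_eq_iff:
  assumes fr: "frame w z" and fr': "frame w' z'" and w': "w' = p *s w + q *s z" and z': "z' = r *s w + s *s z"
    and int: "v p \<le> 1" "v q \<le> 1" "v r \<le> 1" "v s \<le> 1"
  shows "lat_W w' z' b \<inter> W = lat_W w z b \<inter> W \<longleftrightarrow> v ((s - r) - (p - q)) \<le> v \<pi> ^ (2 * b)"
proof -
  let ?M = "lat_W w z b"
  have pw: "v \<pi> ^ (2 * b) = v \<pi> ^ b * v \<pi> ^ b" by (simp add: mult_2 power_add)
  note pos = v_pi_power_pos[of b]
  have le: "v \<pi> ^ b \<le> 1" by (rule v_pi_power_le)
  have hx: "h (z' + w') e = 0" "h (z' + w') w = - (r + p)" "h (z' + w') z = s + q"
    "h (z' - w') e = 0" "h (z' - w') w = p - r" "h (z' - w') z = s - q"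
    by (simp_all add: w' z' frameD[OF fr])
  have eq: "s + q - (r + p) = (s - r) - (p - q)" by simp
  have mem1: "inverse (\<pi> ^ b) *s (z' + w') \<in> ?M \<longleftrightarrow>
      v ((s - r) - (p - q)) \<le> v \<pi> ^ (2 * b) \<and> v (s + q + (r + p)) \<le> 1"
    using pos unfolding lat_W_mem hx pw eq[symmetric] by (simp add: field_simps)
  have i: "v (s + q + (r + p)) \<le> 1" "v (s - q + (p - r)) \<le> 1" "v (s - q - (p - r)) \<le> 1"
    by (intro v_add_le v_diff_le int)+
  have mem2: "(\<pi> ^ b / 2) *s (z' - w') \<in> ?M"
    using i le unfolding lat_W_mem hx
    by (auto intro!: mult_le_one mult_left_le simp del: mult_le_cancel_left1 mult_le_cancel_left2)
  have "lat_W w' z' b \<inter> W = lat_W w z b \<inter> W \<longleftrightarrow> lat_W w' z' b = ?M"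
    using lat_W_Int_W(2)[OF fr, of b] lat_W_Int_W(2)[OF fr', of b] by metis
  also have "\<dots> \<longleftrightarrow> inverse (\<pi> ^ b) *s (z' + w') \<in> ?M \<and> (\<pi> ^ b / 2) *s (z' - w') \<in> ?M"
    using self_dual_eq_wlat[OF self_dual_lat(2)[OF fr] frame_witt(2)[OF fr']] wlat_gens[OF frame_witt(2)[OF fr', of b]]
    by (auto simp: lat_W_def)
  finally show ?thesis using mem1 mem2 i by simp
qed

text \<open>These are the relations of a unitary matrix for the form with diagonal (-1, 1). The
  conjugated orthogonality relation s cj q = r cj p and the norm of the first column express r and s
  through the determinant.\<close>

lemma frame_coeffs:
  assumes fr: "frame w z" and fr': "frame (p *s w + q *s z) (r *s w + s *s z)"
  shows "p * cj p - q * cj q = 1" "r = (p * s - q * r) * cj q" "s = (p * s - q * r) * cj p"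
    "(p * s - q * r) * cj (p * s - q * r) = 1"
proof -
  note D = frameD[OF fr]
  have n: "p * cj p - q * cj q = 1" "s * cj s - r * cj r = 1" "q * cj s = p * cj r"
    using frameD(1-3)[OF fr'] by (simp_all add: D algebra_simps)
  have n3: "s * cj q = r * cj p" using arg_cong[OF n(3), of cj] by (simp add: mult.commute)
  show "p * cj p - q * cj q = 1" by (rule n)
  have "(p * s - q * r) * cj q = p * (s * cj q) - (q * cj q) * r" by (simp add: algebra_simps)
  also have "\<dots> = (p * cj p - q * cj q) * r" unfolding n3 by (simp add: algebra_simps)
  finally show r: "r = (p * s - q * r) * cj q" using n by simp
  have "(p * s - q * r) * cj p = (p * cj p) * s - q * (r * cj p)" by (simp add: algebra_simps)
  also have "\<dots> = (p * cj p - q * cj q) * s" unfolding n3[symmetric] by (simp add: algebra_simps)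
  finally show s: "s = (p * s - q * r) * cj p" using n by simp
  define d where "d = p * s - q * r"
  have "d * cj d * (p * cj p - q * cj q) = (d * cj p) * cj (d * cj p) - (d * cj q) * cj (d * cj q)"
    by (simp add: algebra_simps)
  also have "\<dots> = s * cj s - r * cj r"
    unfolding r[folded d_def, symmetric] s[folded d_def, symmetric] ..
  finally show "(p * s - q * r) * cj (p * s - q * r) = 1" using n by (simp add: d_def)
qed

text \<open>An element of \<open>U(W\<^sub>\<tau>)\<close> has matrix \<open>(p, \<lambda>q\<^sup>*; q, \<lambda>p\<^sup>*)\<close> in a frame, \<open>*\<close> being the conjugation and \<open>\<lambda>\<close> the
  determinant. It fixes the two lattices iff \<open>p \<equiv> 1\<close> modulo \<open>\<varpi>\<^sup>2\<^sup>a\<close>, \<open>q \<equiv> 0\<close> modulo \<open>\<varpi>\<^sup>a\<close> and \<open>\<lambda>(p - q)\<^sup>* \<equiv> p - q\<close>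
  modulo \<open>\<varpi>\<^sup>2\<^sup>b\<close>.\<close>

lemma det_stabilizer:
  assumes fr: "frame w z"
  shows "det_H ` stabilizer (H_tau S) act (std_pair w z a b) =
    {d. d * cj d = 1 \<and> (\<exists>p q. p * cj p - q * cj q = 1 \<and> v (p - 1) \<le> v \<pi> ^ (2 * a) \<and> v q \<le> v \<pi> ^ a \<and>
      v (d * cj (p - q) - (p - q)) \<le> v \<pi> ^ (2 * b))}" (is "_ = ?R")
proof -
  have stab: "act (extend S g, g) (std_pair w z a b) = std_pair w z a b \<longleftrightarrow>
      v (p - 1) \<le> v \<pi> ^ (2 * a) \<and> v q \<le> v \<pi> ^ a \<and> v (d * cj (p - q) - (p - q)) \<le> v \<pi> ^ (2 * b)"
    if g: "g \<in> carrier (G_W S)" "g w = p *s w + q *s z" "g z = (d * cj q) *s w + (d * cj p) *s z"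
      and d: "d * cj d = 1" for g p q d
  proof -
    note fr' = frame_image[OF g(1) fr]
    have V: "lat_V (g w) (g z) a = lat_V w z a \<longleftrightarrow> v (p - 1) \<le> v \<pi> ^ (2 * a) \<and> v q \<le> v \<pi> ^ a"
      by (rule lat_V_eq_iff[OF fr fr' g(2)])
    \<comment> \<open>The conditions from L_V already force p and q to be integral, as
      \<open>lat_W_eq_iff\<close> demands.\<close>
    have W: "lat_W (g w) (g z) b \<inter> W = lat_W w z b \<inter> W \<longleftrightarrow> v (d * cj (p - q) - (p - q)) \<le> v \<pi> ^ (2 * b)"
      if "v (p - 1) \<le> v \<pi> ^ (2 * a)" "v q \<le> v \<pi> ^ a"
    proof -
      have "v (p - 1) \<le> 1" "v q \<le> 1"
        using that v_pi_power_le[of "2 * a"] v_pi_power_le[of a] by linarith+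
      moreover from this have "v p \<le> 1" using v_add_le[of "p - 1" 1 1] by simp
      ultimately show ?thesis
        using lat_W_eq_iff[OF fr fr' g(2,3), of b] v_norm_one[OF d] by (simp add: algebra_simps)
    qed
    show ?thesis unfolding act_std_pair[OF g(1) fr] unfolding std_pair_def Pair_inject using V W by blast
  qed
  show ?thesis
  proof (intro equalityI subsetI)
    fix d assume "d \<in> det_H ` stabilizer (H_tau S) act (std_pair w z a b)"
    then obtain g where g: "g \<in> carrier (G_W S)" and fixes_pair: "act (extend S g, g) (std_pair w z a b) = std_pair w z a b"
      and d: "d = det_H (extend S g, g)" by (auto simp: stabilizer_def carrier_H)
    have wzW: "w \<in> W" "z \<in> W" using fr by (auto simp: frame_def W_iff)
    have ex: "x = (- h x w) *s w + h x z *s z" if "x \<in> W" for x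
      using frame_expand[OF fr, of x] that by (simp add: W_iff)
    obtain p q where gw: "g w = p *s w + q *s z" using ex[OF unitaryD(6)[OF g wzW(1)]] by blast
    obtain r s where gz: "g z = r *s w + s *s z" using ex[OF unitaryD(6)[OF g wzW(2)]] by blast
    have d': "d = p * s - q * r" unfolding d by (rule det_extend[OF g fr gw gz])
    note c = frame_coeffs[OF fr frame_image[OF g fr, unfolded gw gz], folded d']
    have "g z = (d * cj q) *s w + (d * cj p) *s z" unfolding gz using c(2,3) by simp
    from stab[OF g gw this c(4)] fixes_pair c(1,4) show "d \<in> ?R" by blast
  next
    fix d assume "d \<in> ?R"
    then obtain p q where d: "d * cj d = 1" and pq: "p * cj p - q * cj q = 1"
      and st: "v (p - 1) \<le> v \<pi> ^ (2 * a) \<and> v q \<le> v \<pi> ^ a \<and> v (d * cj (p - q) - (p - q)) \<le> v \<pi> ^ (2 * b)" by blast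
    note D = frameD[OF fr]
    have "frame (p *s w + q *s z) ((d * cj q) *s w + (d * cj p) *s z)"
      unfolding frame_def
    proof (intro conjI)
      show "h (p *s w + q *s z) (p *s w + q *s z) = -1"
        using pq by (simp add: D algebra_simps)
      have "h ((d * cj q) *s w + (d * cj p) *s z) ((d * cj q) *s w + (d * cj p) *s z)
          = (d * cj d) * (p * cj p - q * cj q)" by (simp add: D algebra_simps)
      thus "h ((d * cj q) *s w + (d * cj p) *s z) ((d * cj q) *s w + (d * cj p) *s z) = 1"
        using d pq by simp
    qed (simp_all add: D algebra_simps)
    from frame_map[OF fr this] obtain g where g: "g \<in> carrier (G_W S)" "g w = p *s w + q *s z"
      "g z = (d * cj q) *s w + (d * cj p) *s z" by blast
    have "det_H (extend S g, g) = d * (p * cj p - q * cj q)"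
      unfolding det_extend[OF g(1) fr g(2,3)] by (simp add: algebra_simps)
    hence "d = det_H (extend S g, g)" using pq by simp
    moreover have "(extend S g, g) \<in> stabilizer (H_tau S) act (std_pair w z a b)"
      using stab[OF g d] st g(1) by (auto simp: stabilizer_def carrier_H)
    ultimately show "d \<in> det_H ` stabilizer (H_tau S) act (std_pair w z a b)" by blast
  qed
qed

text \<open>For a > 0, p - q is congruent to 1 modulo \<pi>^a, hence to its conjugate, and the
  condition from L_W becomes d = 1 modulo \<pi>^(min a (2b)). Conversely p and q are produced for a
  given d: p = 1, q = 0 if 2b \<le> a, and otherwise with d cj (p - q) = p - q exactly.\<close>

lemma det_stabilizer_conductor:
  assumes fr: "frame w z"
  shows "det_H ` stabilizer (H_tau S) act (std_pair w z a b) = r_tau S ` order_c_units S (min a (2 * b))"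
  unfolding det_stabilizer[OF fr] r_tau_units
proof (intro equalityI subsetI)
  let ?c = "min a (2 * b)"
  have le_c: "v \<pi> ^ a \<le> v \<pi> ^ ?c" "v \<pi> ^ (2 * b) \<le> v \<pi> ^ ?c" by (simp_all add: v_pi_power_le_iff)
  fix d assume "d \<in> {d. d * cj d = 1 \<and> (\<exists>p q. p * cj p - q * cj q = 1 \<and> v (p - 1) \<le> v \<pi> ^ (2 * a) \<and> v q \<le> v \<pi> ^ a \<and>
      v (d * cj (p - q) - (p - q)) \<le> v \<pi> ^ (2 * b))}"
  then obtain p q where d: "d * cj d = 1" and p: "v (p - 1) \<le> v \<pi> ^ (2 * a)" and q: "v q \<le> v \<pi> ^ a"
    and dpq: "v (d * cj (p - q) - (p - q)) \<le> v \<pi> ^ (2 * b)" by blast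
  have vd: "v d = 1" by (rule v_norm_one[OF d])
  have "v (d - 1) \<le> v \<pi> ^ ?c"
  proof (cases "a = 0")
    case True
    thus ?thesis using vd by (auto intro!: v_diff_le)
  next
    case False
    define y where "y = p - q"
    have "v (p - 1) \<le> v \<pi> ^ a" using p v_pi_power_le_iff[of "2 * a" a] by linarith
    hence y1: "v (y - 1) \<le> v \<pi> ^ a" using q v_diff_le[of "p - 1" _ q] by (simp add: y_def algebra_simps)
    have "v \<pi> ^ a < 1" using False v_pi_less v_pi_pos by (simp add: power_less_one_iff)
    hence vy: "v y = 1" using y1 v_one_add[of "y - 1"] by simp
    have "v (cj (y - 1) - (y - 1)) \<le> v \<pi> ^ a" by (rule v_diff_le) (simp_all only: v_cj y1)
    hence "v (d * cj y - y - (cj (y - 1) - (y - 1))) \<le> v \<pi> ^ ?c"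
      using dpq le_c unfolding y_def[symmetric] by (intro v_diff_le[of _ _ "cj (y - 1) - (y - 1)"]) linarith+
    moreover have "d * cj y - y - (cj (y - 1) - (y - 1)) = (d - 1) * cj y" by (simp add: algebra_simps)
    ultimately show ?thesis using vy by simp
  qed
  thus "d \<in> {x. x * cj x = 1 \<and> v (x - 1) \<le> v \<pi> ^ ?c}" using d by simp
next
  let ?c = "min a (2 * b)"
  fix d assume "d \<in> {x. x * cj x = 1 \<and> v (x - 1) \<le> v \<pi> ^ ?c}"
  hence d: "d * cj d = 1" "v (d - 1) \<le> v \<pi> ^ ?c" by auto
  have vd: "v d = 1" by (rule v_norm_one[OF d(1)])
  have "\<exists>p q. p * cj p - q * cj q = 1 \<and> v (p - 1) \<le> v \<pi> ^ (2 * a) \<and> v q \<le> v \<pi> ^ a \<and>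
      v (d * cj (p - q) - (p - q)) \<le> v \<pi> ^ (2 * b)"
  proof -
    consider "2 * b \<le> a" | "a = 0" | "0 < a" "a < 2 * b" by linarith
    thus ?thesis
    proof cases
      case 1
      thus ?thesis using d by (intro exI[of _ 1] exI[of _ 0]) (simp add: min_absorb2)
    next
      case 2
      have "d \<in> r_tau S ` order_c_units S 0" using d(1) vd by (auto simp: r_tau_units intro!: v_diff_le)
      then obtain s t where st: "s \<in> order_c S 0" "t \<in> order_c S 0" "s * t = 1" "d = cj s / s"
        by (auto simp: order_c_units_def r_tau_def)
      have "v s \<le> 1" "v t \<le> 1" "v s * v t = 1"
        using order_cD(1)[OF st(1)] order_cD(1)[OF st(2)] arg_cong[OF st(3), of v] by simp_all
      hence vs: "v s = 1" by (metis antisym mult_left_le v_ge_0)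
      hence s0: "s \<noteq> 0" by auto
      \<comment> \<open>With p - q = cj s and d = cj s / s the condition from L_W is an equality.
        The norm equation becomes q s + cj (q s) = 1 - s cj s, solved by taking q s to be half the
        right side.\<close>
      define q where "q = (1 - cj s * s) / (2 * s)"
      define p where "p = q + cj s"
      have cq: "cj q = (1 - cj s * s) / (2 * cj s)" by (simp add: q_def mult.commute)
      have "p * cj p - q * cj q = q * s + cj q * cj s + cj s * s" by (simp add: p_def algebra_simps)
      also have "\<dots> = 1" using s0 by (simp add: cq) (simp add: q_def field_simps)
      finally have 1: "p * cj p - q * cj q = 1" .
      have vq: "v q \<le> 1" using vs by (auto simp: q_def intro!: v_diff_le)
      have "v (p - 1) \<le> 1" unfolding p_def by (intro v_diff_le v_add_le vq) (simp_all add: vs)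
      moreover have "d * cj (p - q) - (p - q) = 0" using s0 st(4) by (simp add: p_def)
      ultimately show ?thesis using 1 vq 2 by (intro exI[of _ p] exI[of _ q]) simp
    next
      case 3
      hence c: "?c = a" by simp
      have small: "v \<pi> ^ a < 1" using 3 v_pi_less v_pi_pos by (simp add: power_less_one_iff)
      define m where "m = 2 + d + cj d"
      have "m = 4 + ((d - 1) + cj (d - 1))" by (simp add: m_def)
      moreover have "v ((d - 1) + cj (d - 1)) \<le> v \<pi> ^ a" using d(2) c by (intro v_add_le) (simp_all only: v_cj)
      moreover have "v (4::'k) = 1" using v_mult[of 2 2] by (simp del: v_mult)
      ultimately have vm: "v m = 1" using small v_add_eq_max[of "(d - 1) + cj (d - 1)" 4] by (simp add: add.commute)
      hence m0: "m \<noteq> 0" by auto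
      have cm: "cj m = m" by (simp add: m_def)
      \<comment> \<open>Cayley transform: y = (d - 1)/(d + 1), rewritten with denominator in F. It
        changes sign under conjugation and d = (1 + y)/(1 - y), so p - q = 1 + y solves d cj (p - q)
        = p - q.\<close>
      define y where "y = (d - cj d) / m"
      have cy: "cj y = - y" by (simp add: y_def cm minus_divide_left)
      have "d - cj d = (d - 1) - cj (d - 1)" by simp
      also have "v \<dots> \<le> v \<pi> ^ a" using d(2) c by (intro v_diff_le[of "d - 1"]) (simp_all only: v_cj)
      finally have vy: "v y \<le> v \<pi> ^ a" using vm by (simp only: y_def v_divide)
      have v1y: "v (1 - y) = 1" using v_one_add[of "- y"] vy small by simp
      have v1y': "v (1 + y) = 1" using v_one_add[of y] vy small by simp
      have ne: "1 - y \<noteq> 0" "1 + y \<noteq> 0" using v1y v1y' by auto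
      have dy: "d * (1 - y) = 1 + y"
      proof -
        have "m * (d * (1 - y)) = d * (m - (d - cj d))" using m0 by (simp add: y_def field_simps)
        also have "\<dots> = 2 * d + 2 * (d * cj d)" by (simp add: m_def algebra_simps)
        also have "\<dots> = m + (d - cj d)" unfolding d(1) by (simp add: m_def)
        also have "\<dots> = m * (1 + y)" using m0 by (simp add: y_def field_simps)
        finally show ?thesis using m0 by simp
      qed
      have cancel: "u \<noteq> 0 \<Longrightarrow> x / u * u = x" for u x :: 'k by simp
      \<comment> \<open>With p = 1 - t and q = -y - t the norm equation asks that t (1 - y) and its
        conjugate add up to y^2; each is taken to be y^2 / 2. As t has the order of y^2, p satisfies
        the stronger congruence modulo \<pi>^(2a).\<close>
      define t where "t = y * y / 2 / (1 - y)"
      have ct: "cj t = y * y / 2 / (1 + y)" by (simp add: t_def cy)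
      define p where "p = 1 - t"
      define q where "q = - y - t"
      have "p * cj p - q * cj q = 1 + y * y - t * (1 - y) - cj t * (1 + y)"
        by (simp add: p_def q_def cy algebra_simps)
      also have "t * (1 - y) = y * y / 2" unfolding t_def by (rule cancel[OF ne(1)])
      also have "cj t * (1 + y) = y * y / 2" unfolding ct by (rule cancel[OF ne(2)])
      also have "1 + y * y - y * y / 2 - y * y / 2 = 1" by (simp add: field_simps)
      finally have 1: "p * cj p - q * cj q = 1" .
      have "v t = v y * v y" by (simp only: t_def v_divide v_mult v_2 v1y div_by_1)
      also have "\<dots> \<le> v \<pi> ^ a * v \<pi> ^ a" using vy by (intro mult_mono) auto
      finally have vt: "v t \<le> v \<pi> ^ (2 * a)" by (simp add: mult_2 power_add)
      moreover have "v \<pi> ^ (2 * a) \<le> v \<pi> ^ a" by (simp add: v_pi_power_le_iff)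
      ultimately have "v q \<le> v \<pi> ^ a" unfolding q_def by (intro v_diff_le) (simp_all add: vy)
      moreover have "d * cj (p - q) - (p - q) = 0" using dy by (simp add: p_def q_def cy)
      moreover have "v (p - 1) \<le> v \<pi> ^ (2 * a)" using vt by (simp add: p_def)
      ultimately show ?thesis using 1 by (intro exI[of _ p] exI[of _ q]) simp
    qed
  qed
  thus "d \<in> {d. d * cj d = 1 \<and> (\<exists>p q. p * cj p - q * cj q = 1 \<and> v (p - 1) \<le> v \<pi> ^ (2 * a) \<and> v q \<le> v \<pi> ^ a \<and>
      v (d * cj (p - q) - (p - q)) \<le> v \<pi> ^ (2 * b))}" using d(1) by blast
qed

section \<open>Conductors of orbits and passage to cosets\<close>

lemma conductor_orbit:
  assumes C: "C \<in> orbits (H_tau S) (lattice_pairs S) act" and inv: "inv_tau S ` C = {(real a, real b)}"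
  shows "\<forall>P\<in>C. det_H ` stabilizer (H_tau S) act P = r_tau S ` order_c_units S (min a (2 * b))"
    and "local_conductor S C = \<pi> ^ min a (2 * b)"
proof -
  obtain P where P: "P \<in> lattice_pairs S" "C = orbit (H_tau S) act P" using C unfolding orbits_def by blast
  obtain w z a' b' where fr: "frame w z" and "P = std_pair w z a' b'" using lattice_pair_std[OF P(1)] by blast
  hence C': "C = {std_pair w' z' a' b' | w' z'. frame w' z'}" using P(2) orbit_H[OF fr] by (simp only:)
  have "std_pair w z a' b' \<in> C" using fr C' by blast
  hence "inv_tau S (std_pair w z a' b') \<in> {(real a, real b)}" using inv by blast
  hence ab: "a' = a" "b' = b" by (simp_all add: inv_tau_std_pair[OF fr])
  show st: "\<forall>P\<in>C. det_H ` stabilizer (H_tau S) act P = r_tau S ` order_c_units S (min a (2 * b))"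
  proof
    fix P assume "P \<in> C"
    then obtain w' z' where "frame w' z'" "P = std_pair w' z' a b" unfolding C' ab by blast
    thus "det_H ` stabilizer (H_tau S) act P = r_tau S ` order_c_units S (min a (2 * b))"
      by (simp only: det_stabilizer_conductor)
  qed
  have "(THE c. has_conductor_exponent S C c) = min a (2 * b)"
  proof (rule the_equality)
    show "has_conductor_exponent S C (min a (2 * b))" unfolding has_conductor_exponent_def by (rule st)
    fix c assume "has_conductor_exponent S C c"
    hence "\<forall>P\<in>C. det_H ` stabilizer (H_tau S) act P = r_tau S ` order_c_units S c"
      unfolding has_conductor_exponent_def .
    from bspec[OF this \<open>std_pair w z a' b' \<in> C\<close>] bspec[OF st \<open>std_pair w z a' b' \<in> C\<close>]
    have "r_tau S ` order_c_units S c = r_tau S ` order_c_units S (min a (2 * b))" by (rule trans[OF sym])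
    thus "c = min a (2 * b)" by (rule conductor_unique)
  qed
  thus "local_conductor S C = \<pi> ^ min a (2 * b)" by (simp add: local_conductor_def)
qed

text \<open>H acts on cosets by left translation, which \<open>coset_to_pair\<close> turns into
  \<open>act\<close>; the classification of orbits of pairs is transported along this
  bijection.\<close>

lemma lcosets_bij:
  assumes P: "P \<in> lattice_pairs S" and K: "stabilizer (G_tau S) act P = K"
  shows "bij_betw (coset_to_pair P) (lcosets\<^bsub>G_tau S\<^esub> K) (lattice_pairs S)"
    and "induces_bij (\<lambda>C. inv_tau S (coset_to_pair P C))
      (orbits (H_tau S) (lcosets\<^bsub>G_tau S\<^esub> K) (l_coset (G_tau S))) Inv_tau"
proof -
  interpret set_action "G_tau S" "lattice_pairs S" act by (rule act_G)
  have c: "coset_to_pair P = (\<lambda>C. the_elem ((\<lambda>g. act g P) ` C))" by (simp add: coset_to_pair_def fun_eq_iff)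
  show bij: "bij_betw (coset_to_pair P) (lcosets\<^bsub>G_tau S\<^esub> K) (lattice_pairs S)"
    unfolding c K[symmetric] by (rule bij_betw_lcosets[OF P orbit_G[OF P]])
  have H: "carrier (H_tau S) \<subseteq> carrier (G_tau S)" using extend_unitary by (auto simp: carrier_H)
  have eq: "k <#\<^bsub>G_tau S\<^esub> C \<in> lcosets\<^bsub>G_tau S\<^esub> K"
    "coset_to_pair P (k <#\<^bsub>G_tau S\<^esub> C) = act k (coset_to_pair P C)"
    if "k \<in> carrier (H_tau S)" "C \<in> lcosets\<^bsub>G_tau S\<^esub> K" for k C
    using lcoset_equivariant[OF P subsetD[OF H that(1)], of C] that(2) unfolding c K by blast+
  show "induces_bij (\<lambda>C. inv_tau S (coset_to_pair P C))
      (orbits (H_tau S) (lcosets\<^bsub>G_tau S\<^esub> K) (l_coset (G_tau S))) Inv_tau"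
  proof (rule induces_bij_transfer[OF bij _ _ induces_bij_orbits_H])
    fix C assume C: "C \<in> lcosets\<^bsub>G_tau S\<^esub> K"
    show "orbit (H_tau S) (l_coset (G_tau S)) C \<subseteq> lcosets\<^bsub>G_tau S\<^esub> K"
      using eq(1)[OF _ C] unfolding orbit_def by blast
    have "coset_to_pair P ` orbit (H_tau S) (l_coset (G_tau S)) C =
        (\<lambda>k. coset_to_pair P (k <#\<^bsub>G_tau S\<^esub> C)) ` carrier (H_tau S)" unfolding orbit_eq_image image_image ..
    also have "\<dots> = orbit (H_tau S) act (coset_to_pair P C)"
      unfolding orbit_eq_image by (rule image_cong[OF refl eq(2)[OF _ C]])
    finally show "coset_to_pair P ` orbit (H_tau S) (l_coset (G_tau S)) C = orbit (H_tau S) act (coset_to_pair P C)" .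
  qed
qed

end

theorem theorem1p2:
  fixes S :: "('e::field_char_0, 'k::{field_char_0, complete_space}) datum"
    and KV KW :: "('k ^ 3 \<Rightarrow> 'k ^ 3) set"
  assumes "global_setting S"
    and "allowable_inert_place S KV KW"
  shows
    "(\<forall>P\<in>lattice_pairs S. orbit (G_tau S) act P = lattice_pairs S) \<and>
     (\<exists>P\<in>lattice_pairs S. stabilizer (G_tau S) act P = KV \<times> KW) \<and>
     (\<forall>P\<in>lattice_pairs S. stabilizer (G_tau S) act P = KV \<times> KW \<longrightarrow>
        bij_betw (coset_to_pair P) (lcosets\<^bsub>G_tau S\<^esub> (KV \<times> KW)) (lattice_pairs S) \<and>
        induces_bij (\<lambda>C. inv_tau S (coset_to_pair P C))
          (orbits (H_tau S) (lcosets\<^bsub>G_tau S\<^esub> (KV \<times> KW)) (l_coset (G_tau S))) Inv_tau) \<and>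
     induces_bij (inv_tau S) (orbits (H_tau S) (lattice_pairs S) act) Inv_tau \<and>
     (\<forall>C\<in>orbits (H_tau S) (lattice_pairs S) act. \<forall>a b.
        inv_tau S ` C = {(real a, real b)} \<longrightarrow>
        local_conductor S C = unif S ^ min a (2 * b) \<and>
        (\<forall>P\<in>C. det_H ` stabilizer (H_tau S) act P
                = r_tau S ` order_c_units S (min a (2 * b))))"
proof -
  interpret unitary_place S
    using assms by unfold_locales (auto simp: allowable_inert_place_def)
  obtain LV LW where LV: "self_dual S UNIV LV" "KV = {g \<in> carrier (G_V S). g ` LV = LV}"
    and LW: "self_dual S W LW" "KW = {g \<in> carrier (G_W S). g ` LW = LW}"
    using assms(2) unfolding allowable_inert_place_def hyperspecial_def by blast
  \<comment> \<open>The lattices that witness hyperspeciality of K_V and K_W form a base point with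
    stabilizer K.\<close>
  have "(LV, LW) \<in> lattice_pairs S" using LV LW by (simp add: lattice_pairs_def)
  moreover have "stabilizer (G_tau S) act (LV, LW) = KV \<times> KW"
    by (auto simp: stabilizer_def act_def LV(2) LW(2))
  ultimately have "\<exists>P\<in>lattice_pairs S. stabilizer (G_tau S) act P = KV \<times> KW" by blast
  moreover have "local_conductor S C = unif S ^ min a (2 * b) \<and>
        (\<forall>P\<in>C. det_H ` stabilizer (H_tau S) act P = r_tau S ` order_c_units S (min a (2 * b)))"
    if "C \<in> orbits (H_tau S) (lattice_pairs S) act" "inv_tau S ` C = {(real a, real b)}" for C a b
    using conductor_orbit[OF that] by simp
  ultimately show ?thesis
    using orbit_G lcosets_bij induces_bij_orbits_H by simp
qed

end
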